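(* Let $G$ be a profinite group, $H\le G$ an open subgroup, $(A,B,C)$ a Tate product over $G$ (regarded also as a Tate product over $H$ by restricting the actions), and $r,s\ge0$ integers. Then for every $\alpha''\in H^r(H,A'')$ and $\beta''\in H^s(G,B'')$, $$\operatorname{cor}\bigl(\alpha''\cup_{\mathrm{aug}}\operatorname{res}(\beta'')\bigr)=\operatorname{cor}(\alpha'')\cup_{\mathrm{aug}}\beta''\quad\text{in }H^{r+s+1}(G,C),$$ where $\operatorname{res}:H^s(G,B'')\to H^s(H,B'')$ is restriction, $\operatorname{cor}$ denotes the corestrictions $H^r(H,A'')\to H^r(G,A'')$ and $H^{r+s+1}(H,C)\to H^{r+s+1}(G,C)$, and the augmented cup products on the left and right are those of the Tate product over $H$ and over $G$ respectively.
   Context: For a profinite group $G$ and a discrete $G$-module $A$, $C^r(G,A)$ is the group of continuous maps $G^r\to A$, with coboundary $d_rf(x_1,\ldots,x_{r+1})=x_1 f(x_2,\ldots,x_{r+1})+\sum_{i=1}^r(-1)^i f(x_1,\ldots,x_ix_{i+1},\ldots,x_{r+1})+(-1)^{r+1}f(x_1,\ldots,x_r)$; $Z^r=\ker d_r$, $B^r=\operatorname{im} d_{r-1}$, $H^r=Z^r/B^r$. A map $A\times B\to C$, $(a,b)\mapsto a\times b$, of discrete $G$-modules is $G$-bilinear if it is bilinear and $g(a\times b)=ga\times gb$. It induces the cup product $\cup:C^r(G,A)\times C^s(G,B)\to C^{r+s}(G,C)$, $(f\cup g)(x_1,\ldots,x_{r+s})=f(x_1,\ldots,x_r)\times x_1\cdots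 x_r\, g(x_{r+1},\ldots,x_{r+s})$. A Tate product $(A,B,C)$ over $G$ consists of two short exact sequences of discrete $G$-modules $0\to A'\xrightarrow{i}A\xrightarrow{j}A''\to0$ and $0\to B'\xrightarrow{i}B\xrightarrow{j}B''\to0$, a discrete $G$-module $C$, and two $G$-bilinear maps $A'\times B\to C$ and $A\times B'\to C$ that coincide on $A'\times B'$. One identifies $C^r(G,A')$ with $\ker(j_*:C^r(G,A)\to C^r(G,A''))$, and similarly for $B'$. Augmented cup product $\cup_{\mathrm{aug}}:H^r(G,A'')\times H^s(G,B'')\to H^{r+s+1}(G,C)$: given $\alpha'',\beta''$, choose $f\in C^r(G,A)$, $g\in C^s(G,B)$ with $j_*f,j_*g$ cocycles representing $\alpha'',\beta''$; then $d_rf\in C^{r+1}(G,A')$, $d_sg\in C^{s+1}(G,B')$, and $\alpha''\cup_{\mathrm{aug}}\beta''=[d_rf\cup g+(-1)^rf\cup d_sg]$ (well defined). Restriction and corestriction are the usual maps. Concretely, for a discrete $G$-module $C$ let $\mathrm{Ind}(C)$ be the $G$-module of continuous maps $c^*:G\to C$ with $c^*(hx)=h\,c^*(x)$ for $h\in H$, $x\in G$, with action $(gc^* )(x)=c^*(xg)$. Evaluation $e:\mathrm{Ind}(C)\to C$, $c^*\mapsto c^*(1)$, together with the inclusion $H\hookrightarrow G$ induces the Shapiro isomorphism $e^*:H^r(G,\mathrm{Ind}(C))\to H^r(H,C)$. Then $\operatorname{res}=e^*\circ i_*$ with $i:C\to\mathrm{Ind}(C)$, $i(c)(x)=xc$,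 and $\operatorname{cor}=\pi_*\circ(e^* )^{-1}$ with $\pi:\mathrm{Ind}(C)\to C$, $\pi(c^* )=\sum_{x\in G/H}x\,c^*(x^{-1})$. *)

theory Defs
  imports
    "HOL-Analysis.Analysis"
    "HOL-Algebra.Elementary_Groups"
    "HOL-Algebra.FiniteProduct"
    "HOL-Algebra.Left_Coset"
begin

text \<open>
  Abelian groups are commutative groups in the (multiplicatively written) sense of
  \<^locale>\<open>comm_group\<close>: sums appear as \<open>\<otimes>\<close> and \<^const>\<open>finprod\<close>, and a sign
  \<open>(-1)\<^sup>i\<close> as an integer power.
\<close>

section \<open>Profinite groups\<close>

record 'g topgroup = "'g monoid" +
  gtop :: "'g topology"

definition topological_group :: "'g topgroup \<Rightarrow> bool" where
  "topological_group G \<longleftrightarrow>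
     group G \<and> topspace (gtop G) = carrier G \<and>
     continuous_map (prod_topology (gtop G) (gtop G)) (gtop G) (\<lambda>(x, y). x \<otimes>\<^bsub>G\<^esub> y) \<and>
     continuous_map (gtop G) (gtop G) (\<lambda>x. inv\<^bsub>G\<^esub> x)"

definition profinite_group :: "'g topgroup \<Rightarrow> bool" where
  "profinite_group G \<longleftrightarrow>
     topological_group G \<and> compact_space (gtop G) \<and> Hausdorff_space (gtop G) \<and>
     (\<forall>S. connectedin (gtop G) S \<longrightarrow> (\<exists>a. S \<subseteq> {a}))"

definition subtopgroup :: "'g topgroup \<Rightarrow> 'g set \<Rightarrow> 'g topgroup" where
  "subtopgroup G H = G\<lparr>carrier := H, gtop := subtopology (gtop G) H\<rparr>"

section \<open>Discrete modules\<close>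

record ('g, 'a) gmodule = "'a monoid" +
  act :: "'g \<Rightarrow> 'a \<Rightarrow> 'a"

definition discrete_module :: "'g topgroup \<Rightarrow> ('g, 'a) gmodule \<Rightarrow> bool" where
  "discrete_module G A \<longleftrightarrow>
     comm_group A \<and>
     (\<forall>g\<in>carrier G. act A g \<in> hom A A) \<and>
     (\<forall>a\<in>carrier A. act A \<one>\<^bsub>G\<^esub> a = a) \<and>
     (\<forall>g\<in>carrier G. \<forall>h\<in>carrier G. \<forall>a\<in>carrier A.
        act A (g \<otimes>\<^bsub>G\<^esub> h) a = act A g (act A h a)) \<and>
     continuous_map (prod_topology (gtop G) (discrete_topology (carrier A)))
       (discrete_topology (carrier A)) (\<lambda>(g, a). act A g a)"

definition equivariant ::
    "'g topgroup \<Rightarrow> ('g, 'a) gmodule \<Rightarrow> ('g, 'b) gmodule \<Rightarrow> ('a \<Rightarrow> 'b) \<Rightarrow> bool" where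
  "equivariant G A B \<phi> \<longleftrightarrow>
     (\<forall>g\<in>carrier G. \<forall>a\<in>carrier A. \<phi> (act A g a) = act B g (\<phi> a))"

definition short_exact ::
    "'g topgroup \<Rightarrow> ('g, 'a1) gmodule \<Rightarrow> ('g, 'a) gmodule \<Rightarrow> ('g, 'a2) gmodule \<Rightarrow>
     ('a1 \<Rightarrow> 'a) \<Rightarrow> ('a \<Rightarrow> 'a2) \<Rightarrow> bool" where
  "short_exact G A' A A'' i j \<longleftrightarrow>
     discrete_module G A' \<and> discrete_module G A \<and> discrete_module G A'' \<and>
     equivariant G A' A i \<and> equivariant G A A'' j \<and>
     i \<in> mon A' A \<and> kernel A A'' j = i ` carrier A' \<and> j \<in> epi A A''"

definition bilinear_pairing ::
    "'g topgroup \<Rightarrow> ('g, 'a) gmodule \<Rightarrow> ('g, 'b) gmodule \<Rightarrow> ('g, 'c) gmodule \<Rightarrow>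
     ('a \<Rightarrow> 'b \<Rightarrow> 'c) \<Rightarrow> bool" where
  "bilinear_pairing G A B C p \<longleftrightarrow>
     (\<forall>a\<in>carrier A. p a \<in> hom B C) \<and>
     (\<forall>b\<in>carrier B. (\<lambda>a. p a b) \<in> hom A C) \<and>
     (\<forall>g\<in>carrier G. \<forall>a\<in>carrier A. \<forall>b\<in>carrier B.
        act C g (p a b) = p (act A g a) (act B g b))"

section \<open>Continuous cochains and cohomology\<close>

text \<open>
  An \<open>r\<close>-tuple \<open>(x\<^sub>1, \<dots>, x\<^sub>r)\<close> is an extensional function on \<open>{..<r}\<close>, so the
  entry \<open>x\<^sub>i\<close> is \<open>x (i - 1)\<close>. Cochains are extensional functions on such tuples, so
  equality of cochains is equality in HOL.
\<close>

definition tuples :: "'g topgroup \<Rightarrow> nat \<Rightarrow> (nat \<Rightarrow> 'g) set" where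
  "tuples G r = (\<Pi>\<^sub>E i\<in>{..<r}. carrier G)"

definition cochains :: "'g topgroup \<Rightarrow> ('g, 'a) gmodule \<Rightarrow> nat \<Rightarrow> ((nat \<Rightarrow> 'g) \<Rightarrow> 'a) monoid" where
  "cochains G A r =
     \<lparr>carrier = {f \<in> extensional (tuples G r).
        continuous_map (product_topology (\<lambda>_. gtop G) {..<r}) (discrete_topology (carrier A)) f},
      mult = (\<lambda>f g. \<lambda>x\<in>tuples G r. f x \<otimes>\<^bsub>A\<^esub> g x),
      one = (\<lambda>x\<in>tuples G r. \<one>\<^bsub>A\<^esub>)\<rparr>"

definition merge_at :: "'g topgroup \<Rightarrow> nat \<Rightarrow> nat \<Rightarrow> (nat \<Rightarrow> 'g) \<Rightarrow> (nat \<Rightarrow> 'g)" where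
  "merge_at G r i x =
     (\<lambda>j\<in>{..<r}. if j < i then x j else if j = i then x i \<otimes>\<^bsub>G\<^esub> x (Suc i) else x (Suc j))"

text \<open>
  Since entries are numbered from \<open>0\<close>, the \<open>i\<close>-th factor below is the usual
  term number \<open>i + 1\<close>.
\<close>

definition coboundary ::
    "'g topgroup \<Rightarrow> ('g, 'a) gmodule \<Rightarrow> nat \<Rightarrow> ((nat \<Rightarrow> 'g) \<Rightarrow> 'a) \<Rightarrow> ((nat \<Rightarrow> 'g) \<Rightarrow> 'a)" where
  "coboundary G A r f =
     (\<lambda>x\<in>tuples G (Suc r).
        act A (x 0) (f (\<lambda>j\<in>{..<r}. x (Suc j)))
        \<otimes>\<^bsub>A\<^esub> (\<Otimes>\<^bsub>A\<^esub>i\<in>{..<r}. f (merge_at G r i x) [^]\<^bsub>A\<^esub> ((-1) ^ Suc i :: int))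
        \<otimes>\<^bsub>A\<^esub> f (restrict x {..<r}) [^]\<^bsub>A\<^esub> ((-1) ^ Suc r :: int))"

definition cocycles :: "'g topgroup \<Rightarrow> ('g, 'a) gmodule \<Rightarrow> nat \<Rightarrow> ((nat \<Rightarrow> 'g) \<Rightarrow> 'a) set" where
  "cocycles G A r = kernel (cochains G A r) (cochains G A (Suc r)) (coboundary G A r)"

definition coboundaries :: "'g topgroup \<Rightarrow> ('g, 'a) gmodule \<Rightarrow> nat \<Rightarrow> ((nat \<Rightarrow> 'g) \<Rightarrow> 'a) set" where
  "coboundaries G A r =
     (case r of 0 \<Rightarrow> {\<one>\<^bsub>cochains G A 0\<^esub>}
      | Suc q \<Rightarrow> coboundary G A q ` carrier (cochains G A q))"

definition cohomology ::
    "'g topgroup \<Rightarrow> ('g, 'a) gmodule \<Rightarrow> nat \<Rightarrow> ((nat \<Rightarrow> 'g) \<Rightarrow> 'a) set monoid" where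
  "cohomology G A r = (cochains G A r)\<lparr>carrier := cocycles G A r\<rparr> Mod coboundaries G A r"

definition coh_class ::
    "'g topgroup \<Rightarrow> ('g, 'a) gmodule \<Rightarrow> nat \<Rightarrow> ((nat \<Rightarrow> 'g) \<Rightarrow> 'a) \<Rightarrow> ((nat \<Rightarrow> 'g) \<Rightarrow> 'a) set" where
  "coh_class G A r f = coboundaries G A r #>\<^bsub>cochains G A r\<^esub> f"

definition push ::
    "'g topgroup \<Rightarrow> nat \<Rightarrow> ('a \<Rightarrow> 'b) \<Rightarrow> ((nat \<Rightarrow> 'g) \<Rightarrow> 'a) \<Rightarrow> ((nat \<Rightarrow> 'g) \<Rightarrow> 'b)" where
  "push G r \<phi> f = (\<lambda>x\<in>tuples G r. \<phi> (f x))"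

definition coh_push ::
    "'g topgroup \<Rightarrow> ('g, 'b) gmodule \<Rightarrow> nat \<Rightarrow> ('a \<Rightarrow> 'b) \<Rightarrow>
     ((nat \<Rightarrow> 'g) \<Rightarrow> 'a) set \<Rightarrow> ((nat \<Rightarrow> 'g) \<Rightarrow> 'b) set" where
  "coh_push G B r \<phi> \<alpha> = coh_class G B r (push G r \<phi> (SOME f. f \<in> \<alpha>))"

section \<open>Restriction and corestriction\<close>

definition Ind :: "'g topgroup \<Rightarrow> 'g set \<Rightarrow> ('g, 'c) gmodule \<Rightarrow> ('g, 'g \<Rightarrow> 'c) gmodule" where
  "Ind G H C =
     \<lparr>carrier = {c \<in> extensional (carrier G).
        continuous_map (gtop G) (discrete_topology (carrier C)) c \<and>
        (\<forall>h\<in>H. \<forall>x\<in>carrier G. c (h \<otimes>\<^bsub>G\<^esub> x) = act C h (c x))},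
      mult = (\<lambda>c d. \<lambda>x\<in>carrier G. c x \<otimes>\<^bsub>C\<^esub> d x),
      one = (\<lambda>x\<in>carrier G. \<one>\<^bsub>C\<^esub>),
      act = (\<lambda>g c. \<lambda>x\<in>carrier G. c (x \<otimes>\<^bsub>G\<^esub> g))\<rparr>"

definition shapiro ::
    "'g topgroup \<Rightarrow> 'g set \<Rightarrow> ('g, 'c) gmodule \<Rightarrow> nat \<Rightarrow>
     ((nat \<Rightarrow> 'g) \<Rightarrow> 'g \<Rightarrow> 'c) set \<Rightarrow> ((nat \<Rightarrow> 'g) \<Rightarrow> 'c) set" where
  "shapiro G H C r \<alpha> =
     coh_class (subtopgroup G H) C r
       (\<lambda>x\<in>tuples (subtopgroup G H) r. (SOME f. f \<in> \<alpha>) x \<one>\<^bsub>G\<^esub>)"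

definition ind_incl :: "'g topgroup \<Rightarrow> ('g, 'c) gmodule \<Rightarrow> 'c \<Rightarrow> ('g \<Rightarrow> 'c)" where
  "ind_incl G C c = (\<lambda>x\<in>carrier G. act C x c)"

text \<open>
  The summand \<open>x c(x\<^sup>-\<^sup>1)\<close> depends only on the left coset \<open>xH\<close>, so any
  representative of the coset may be used.
\<close>

definition ind_trace :: "'g topgroup \<Rightarrow> 'g set \<Rightarrow> ('g, 'c) gmodule \<Rightarrow> ('g \<Rightarrow> 'c) \<Rightarrow> 'c" where
  "ind_trace G H C c =
     (\<Otimes>\<^bsub>C\<^esub>X\<in>lcosets\<^bsub>G\<^esub> H. let x = (SOME x. x \<in> X) in act C x (c (inv\<^bsub>G\<^esub> x)))"

definition res ::
    "'g topgroup \<Rightarrow> 'g set \<Rightarrow> ('g, 'c) gmodule \<Rightarrow> nat \<Rightarrow>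
     ((nat \<Rightarrow> 'g) \<Rightarrow> 'c) set \<Rightarrow> ((nat \<Rightarrow> 'g) \<Rightarrow> 'c) set" where
  "res G H C r \<alpha> = shapiro G H C r (coh_push G (Ind G H C) r (ind_incl G C) \<alpha>)"

definition cor ::
    "'g topgroup \<Rightarrow> 'g set \<Rightarrow> ('g, 'c) gmodule \<Rightarrow> nat \<Rightarrow>
     ((nat \<Rightarrow> 'g) \<Rightarrow> 'c) set \<Rightarrow> ((nat \<Rightarrow> 'g) \<Rightarrow> 'c) set" where
  "cor G H C r \<alpha> =
     coh_push G C r (ind_trace G H C)
       (inv_into (carrier (cohomology G (Ind G H C) r)) (shapiro G H C r) \<alpha>)"

section \<open>Tate products and the augmented cup product\<close>

record ('g, 'a1, 'a, 'a2, 'b1, 'b, 'b2, 'c) tate =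
  A_sub :: "('g, 'a1) gmodule"
  A_mid :: "('g, 'a) gmodule"
  A_quot :: "('g, 'a2) gmodule"
  A_inj :: "'a1 \<Rightarrow> 'a"
  A_proj :: "'a \<Rightarrow> 'a2"
  B_sub :: "('g, 'b1) gmodule"
  B_mid :: "('g, 'b) gmodule"
  B_quot :: "('g, 'b2) gmodule"
  B_inj :: "'b1 \<Rightarrow> 'b"
  B_proj :: "'b \<Rightarrow> 'b2"
  C_mod :: "('g, 'c) gmodule"
  sub_mid :: "'a1 \<Rightarrow> 'b \<Rightarrow> 'c"
  mid_sub :: "'a \<Rightarrow> 'b1 \<Rightarrow> 'c"

definition tate_product ::
    "'g topgroup \<Rightarrow> ('g, 'a1, 'a, 'a2, 'b1, 'b, 'b2, 'c) tate \<Rightarrow> bool" where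
  "tate_product G P \<longleftrightarrow>
     short_exact G (A_sub P) (A_mid P) (A_quot P) (A_inj P) (A_proj P) \<and>
     short_exact G (B_sub P) (B_mid P) (B_quot P) (B_inj P) (B_proj P) \<and>
     discrete_module G (C_mod P) \<and>
     bilinear_pairing G (A_sub P) (B_mid P) (C_mod P) (sub_mid P) \<and>
     bilinear_pairing G (A_mid P) (B_sub P) (C_mod P) (mid_sub P) \<and>
     (\<forall>a\<in>carrier (A_sub P). \<forall>b\<in>carrier (B_sub P).
        sub_mid P a (B_inj P b) = mid_sub P (A_inj P a) b)"

primrec tuple_prod :: "'g topgroup \<Rightarrow> (nat \<Rightarrow> 'g) \<Rightarrow> nat \<Rightarrow> 'g" where
  "tuple_prod G x 0 = \<one>\<^bsub>G\<^esub>"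
| "tuple_prod G x (Suc n) = tuple_prod G x n \<otimes>\<^bsub>G\<^esub> x n"

definition cup ::
    "'g topgroup \<Rightarrow> ('g, 'b) gmodule \<Rightarrow> ('a \<Rightarrow> 'b \<Rightarrow> 'c) \<Rightarrow> nat \<Rightarrow> nat \<Rightarrow>
     ((nat \<Rightarrow> 'g) \<Rightarrow> 'a) \<Rightarrow> ((nat \<Rightarrow> 'g) \<Rightarrow> 'b) \<Rightarrow> ((nat \<Rightarrow> 'g) \<Rightarrow> 'c)" where
  "cup G B p r s f g =
     (\<lambda>x\<in>tuples G (r + s).
        p (f (restrict x {..<r})) (act B (tuple_prod G x r) (g (\<lambda>j\<in>{..<s}. x (r + j)))))"

text \<open>
  Inverse of the identification, via \<open>i\<close>, of \<open>C\<^sup>r(G, A')\<close> with the kernel of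
  \<open>j\<^sub>* : C\<^sup>r(G, A) \<rightarrow> C\<^sup>r(G, A'')\<close>.
\<close>

definition pull ::
    "'g topgroup \<Rightarrow> nat \<Rightarrow> ('g, 'a1) gmodule \<Rightarrow> ('a1 \<Rightarrow> 'a) \<Rightarrow>
     ((nat \<Rightarrow> 'g) \<Rightarrow> 'a) \<Rightarrow> ((nat \<Rightarrow> 'g) \<Rightarrow> 'a1)" where
  "pull G r A' i = push G r (inv_into (carrier A') i)"

definition lifts ::
    "'g topgroup \<Rightarrow> ('g, 'a) gmodule \<Rightarrow> ('g, 'a2) gmodule \<Rightarrow> ('a \<Rightarrow> 'a2) \<Rightarrow> nat \<Rightarrow>
     ((nat \<Rightarrow> 'g) \<Rightarrow> 'a2) set \<Rightarrow> ((nat \<Rightarrow> 'g) \<Rightarrow> 'a) \<Rightarrow> bool" where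
  "lifts G A A'' j r \<alpha> f \<longleftrightarrow>
     f \<in> carrier (cochains G A r) \<and> push G r j f \<in> cocycles G A'' r \<and>
     coh_class G A'' r (push G r j f) = \<alpha>"

definition aug_cup ::
    "'g topgroup \<Rightarrow> ('g, 'a1, 'a, 'a2, 'b1, 'b, 'b2, 'c) tate \<Rightarrow> nat \<Rightarrow> nat \<Rightarrow>
     ((nat \<Rightarrow> 'g) \<Rightarrow> 'a2) set \<Rightarrow> ((nat \<Rightarrow> 'g) \<Rightarrow> 'b2) set \<Rightarrow> ((nat \<Rightarrow> 'g) \<Rightarrow> 'c) set" where
  "aug_cup G P r s \<alpha> \<beta> =
     (let f = (SOME f. lifts G (A_mid P) (A_quot P) (A_proj P) r \<alpha> f);
          g = (SOME g. lifts G (B_mid P) (B_quot P) (B_proj P) s \<beta> g);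
          df = pull G (r + 1) (A_sub P) (A_inj P) (coboundary G (A_mid P) r f);
          dg = pull G (s + 1) (B_sub P) (B_inj P) (coboundary G (B_mid P) s g);
          n = r + s + 1
      in coh_class G (C_mod P) n
           (cup G (B_mid P) (sub_mid P) (r + 1) s df g
            \<otimes>\<^bsub>cochains G (C_mod P) n\<^esub>
            cup G (B_sub P) (mid_sub P) r (s + 1) f dg [^]\<^bsub>cochains G (C_mod P) n\<^esub> ((-1) ^ r :: int)))"

end

(*
  The induced modules Ind A', Ind A, Ind A'' together with B', B, B'' and Ind C, paired by
  (c x b)(y) = c(y) x yb, form a Tate product over G. Evaluation at 1 is a morphism from it to
  (A, B, C) over H, and the trace is a morphism from it to (A, B, C) over G. Lift a cocycle F''
  in Ind A'' whose evaluation represents alpha to F in Ind A, and lift beta to g. The augmented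
  cup product cocycle of F and g over the induced Tate product is then sent by evaluation to the
  one computing alpha cup res beta over H, and by the trace to the one computing cor alpha cup beta
  over G. As the corestriction takes the class of the evaluation of a cocycle to the class of its
  trace, this is the projection formula. It remains that the augmented cup product does not
  depend on the lifts (Leibniz rule) and Shapiro's lemma. The latter is proved on homogeneous cochains:
  composing with an H-equivariant retraction of G onto H inverts the restriction to H up to the
  prism homotopy.
*)
theory Submission
  imports Defs
begin

section \<open>Alternating sums over lists\<close>

text \<open>\<open>aug_cup\<close> picks its lifts by \<open>SOME\<close>, and \<open>cor\<close>
  inverts the Shapiro map on classes by \<open>inv_into\<close>. Neither side can be computed by
  unfolding, so each must first be evaluated on explicit representatives;
  \<open>aug_cup_coh_class\<close> and \<open>cor_coh_class\<close> do this. The sign computations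
  (square zero, Leibniz, prism identity) are inductions on lists of vertices and avoid the bar
  formula: splitting off the first vertex turns an alternating sum into a difference of two terms.
  The retraction comes from the factorisation y = \<open>retract y\<close> \<open>rep y\<close>,
  with \<open>rep\<close> constant on right cosets of H. It is continuous because these cosets are
  open, and it fixes H because H is represented by the unit. So extending a cocycle of H along it
  and evaluating returns that very cocycle, not just a cohomologous one. Finitely many cosets exist
  by compactness. The same factorisation gives surjectivity of Ind A -> Ind A'': values are lifted
  at representatives and spread by the action. The projection formula itself is visible in one
  summand of the trace: x(c(x^-1) \<times> x^-1 b) = x c(x^-1) \<times> b.\<close>

context comm_group
begin

lemma mult_inv_cancel_ends:
  assumes "x \<in> carrier G" "u \<in> carrier G"
  shows "x \<otimes> (u \<otimes> inv x) = u" "inv x \<otimes> (u \<otimes> x) = u"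
  using assms by (simp_all add: m_comm[of u] flip: m_assoc)

lemma mult_inv_cancel_mid:
  assumes "x \<in> carrier G" "u \<in> carrier G" "y \<in> carrier G"
  shows "x \<otimes> (u \<otimes> (inv x \<otimes> y)) = u \<otimes> y" "inv x \<otimes> (u \<otimes> (x \<otimes> y)) = u \<otimes> y"
  using assms by (simp_all add: m_comm[of u] flip: m_assoc)

lemma mult_inv_cancel_0:
  "\<lbrakk>x \<in> carrier G; y \<in> carrier G\<rbrakk>
      \<Longrightarrow> x \<otimes> (inv x \<otimes> y) = y"
    "\<lbrakk>x \<in> carrier G; y \<in> carrier G\<rbrakk>
      \<Longrightarrow> inv x \<otimes> (x \<otimes> y) = y"
  by (simp_all flip: m_assoc)

lemma mult_inv_cancel_1:
  "\<lbrakk>x \<in> carrier G; a \<in> carrier G\<rbrakk>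
      \<Longrightarrow> x \<otimes> (a \<otimes> inv x) = a"
    "\<lbrakk>x \<in> carrier G; a \<in> carrier G\<rbrakk>
      \<Longrightarrow> inv x \<otimes> (a \<otimes> x) = a"
    "\<lbrakk>x \<in> carrier G; a \<in> carrier G; y \<in> carrier G\<rbrakk>
      \<Longrightarrow> x \<otimes> (a \<otimes> (inv x \<otimes> y)) = a \<otimes> y"
    "\<lbrakk>x \<in> carrier G; a \<in> carrier G; y \<in> carrier G\<rbrakk>
      \<Longrightarrow> inv x \<otimes> (a \<otimes> (x \<otimes> y)) = a \<otimes> y"
  using mult_inv_cancel_ends[of x "a"] mult_inv_cancel_mid[of x "a" y] by (simp_all add: m_assoc)

lemma mult_inv_cancel_2:
  "\<lbrakk>x \<in> carrier G; a \<in> carrier G; b \<in> carrier G\<rbrakk>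
      \<Longrightarrow> x \<otimes> (a \<otimes> (b \<otimes> inv x)) = a \<otimes> b"
    "\<lbrakk>x \<in> carrier G; a \<in> carrier G; b \<in> carrier G\<rbrakk>
      \<Longrightarrow> inv x \<otimes> (a \<otimes> (b \<otimes> x)) = a \<otimes> b"
    "\<lbrakk>x \<in> carrier G; a \<in> carrier G; b \<in> carrier G; y \<in> carrier G\<rbrakk>
      \<Longrightarrow> x \<otimes> (a \<otimes> (b \<otimes> (inv x \<otimes> y))) = a \<otimes> (b \<otimes> y)"
    "\<lbrakk>x \<in> carrier G; a \<in> carrier G; b \<in> carrier G; y \<in> carrier G\<rbrakk>
      \<Longrightarrow> inv x \<otimes> (a \<otimes> (b \<otimes> (x \<otimes> y))) = a \<otimes> (b \<otimes> y)"
  using mult_inv_cancel_ends[of x "a \<otimes> b"] mult_inv_cancel_mid[of x "a \<otimes> b" y] by (simp_all add: m_assoc)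

lemma mult_inv_cancel_3:
  "\<lbrakk>x \<in> carrier G; a \<in> carrier G; b \<in> carrier G; c \<in> carrier G\<rbrakk>
      \<Longrightarrow> x \<otimes> (a \<otimes> (b \<otimes> (c \<otimes> inv x))) = a \<otimes> (b \<otimes> c)"
    "\<lbrakk>x \<in> carrier G; a \<in> carrier G; b \<in> carrier G; c \<in> carrier G\<rbrakk>
      \<Longrightarrow> inv x \<otimes> (a \<otimes> (b \<otimes> (c \<otimes> x))) = a \<otimes> (b \<otimes> c)"
    "\<lbrakk>x \<in> carrier G; a \<in> carrier G; b \<in> carrier G; c \<in> carrier G; y \<in> carrier G\<rbrakk>
      \<Longrightarrow> x \<otimes> (a \<otimes> (b \<otimes> (c \<otimes> (inv x \<otimes> y)))) = a \<otimes> (b \<otimes> (c \<otimes> y))"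
    "\<lbrakk>x \<in> carrier G; a \<in> carrier G; b \<in> carrier G; c \<in> carrier G; y \<in> carrier G\<rbrakk>
      \<Longrightarrow> inv x \<otimes> (a \<otimes> (b \<otimes> (c \<otimes> (x \<otimes> y)))) = a \<otimes> (b \<otimes> (c \<otimes> y))"
  using mult_inv_cancel_ends[of x "a \<otimes> (b \<otimes> c)"] mult_inv_cancel_mid[of x "a \<otimes> (b \<otimes> c)" y] by (simp_all add: m_assoc)

text \<open>Sorting by associativity and commutativity does not cancel a factor against its inverse
  when others stand between them. These rules cancel across up to three factors, which suffices for
  the identities below.\<close>

lemmas group_ac = m_ac inv_mult
  mult_inv_cancel_0 mult_inv_cancel_1 mult_inv_cancel_2
  mult_inv_cancel_3

end

text \<open>The homogeneous coboundary: the alternating sum of \<phi> over the lists with one entry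
  deleted. Deleting the head gives the first factor; all other deletions keep the head and have
  their position, hence their sign, shifted by one, whence the inverse.\<close>

fun hdiff :: "('c, 'm) monoid_scheme \<Rightarrow> ('g list \<Rightarrow> 'c) \<Rightarrow> 'g list \<Rightarrow> 'c" where
  "hdiff A \<phi> [] = \<one>\<^bsub>A\<^esub>"
| "hdiff A \<phi> (x # xs) = \<phi> xs \<otimes>\<^bsub>A\<^esub> inv\<^bsub>A\<^esub> hdiff A (\<lambda>zs. \<phi> (x # zs)) xs"

text \<open>
  The signs are hidden in the recursion: unfolded, \<open>hprism\<close> is the alternating sum of
  \<open>\<phi>(x\<^sub>0, \<dots>, x\<^sub>i, \<rho> x\<^sub>i, \<dots>, \<rho> x\<^sub>n)\<close>.
\<close>

fun hprism :: "('c, 'm) monoid_scheme \<Rightarrow> ('g \<Rightarrow> 'g) \<Rightarrow> ('g list \<Rightarrow> 'c) \<Rightarrow> 'g list \<Rightarrow> 'c" where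
  "hprism A \<rho> \<phi> [] = \<one>\<^bsub>A\<^esub>"
| "hprism A \<rho> \<phi> (x # xs) =
     \<phi> (x # \<rho> x # map \<rho> xs) \<otimes>\<^bsub>A\<^esub> inv\<^bsub>A\<^esub> hprism A \<rho> (\<lambda>zs. \<phi> (x # zs)) xs"

text \<open>The homogeneous cup product: \<phi> on the front face of the first r+1 vertices, \<psi>
  on the back face, with vertex r common to both. The twist by the action of the inhomogeneous
  formula is absent. Recursion on r moves the heads into \<phi>, so that the Leibniz rule can be
  proved by slicing.\<close>

fun hcup :: "('c, 'm) monoid_scheme \<Rightarrow> ('a \<Rightarrow> 'b \<Rightarrow> 'c) \<Rightarrow> nat \<Rightarrow>
    ('g list \<Rightarrow> 'a) \<Rightarrow> ('g list \<Rightarrow> 'b) \<Rightarrow> 'g list \<Rightarrow> 'c" where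
  "hcup C p r \<phi> \<psi> [] = \<one>\<^bsub>C\<^esub>"
| "hcup C p 0 \<phi> \<psi> (x # xs) = p (\<phi> [x]) (\<psi> (x # xs))"
| "hcup C p (Suc r) \<phi> \<psi> (x # xs) = hcup C p r (\<lambda>zs. \<phi> (x # zs)) \<psi> xs"

context comm_group
begin

lemma hdiff_closed [simp]: "(\<And>zs. \<phi> zs \<in> carrier G) \<Longrightarrow> hdiff G \<phi> zs \<in> carrier G"
  by (induction zs arbitrary: \<phi>) auto

lemma hprism_closed [simp]: "(\<And>zs. \<phi> zs \<in> carrier G) \<Longrightarrow> hprism G \<rho> \<phi> zs \<in> carrier G"
  by (induction zs arbitrary: \<phi>) auto

lemma hdiff_one [simp]: "hdiff G (\<lambda>_. \<one>) zs = \<one>"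
  by (induction zs) auto

lemma hprism_one [simp]: "hprism G \<rho> (\<lambda>_. \<one>) zs = \<one>"
  by (induction zs) auto

text \<open>Additivity is stated for a quotient because the recursion equation of
  \<open>hdiff\<close> produces terms of exactly this shape.\<close>

lemma hdiff_mult_inv:
  assumes "\<And>zs. \<phi> zs \<in> carrier G" "\<And>zs. \<psi> zs \<in> carrier G"
  shows "hdiff G (\<lambda>zs. \<phi> zs \<otimes> inv \<psi> zs) zs = hdiff G \<phi> zs \<otimes> inv hdiff G \<psi> zs"
  using assms
proof (induction zs arbitrary: \<phi> \<psi>)
  case (Cons x xs)
  show ?case
    using Cons.prems Cons.IH[of "\<lambda>zs. \<phi> (x # zs)" "\<lambda>zs. \<psi> (x # zs)"] by (simp add: group_ac)
qed simp

lemma hprism_mult_inv: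
  assumes "\<And>zs. \<phi> zs \<in> carrier G" "\<And>zs. \<psi> zs \<in> carrier G"
  shows "hprism G \<rho> (\<lambda>zs. \<phi> zs \<otimes> inv \<psi> zs) zs = hprism G \<rho> \<phi> zs \<otimes> inv hprism G \<rho> \<psi> zs"
  using assms
proof (induction zs arbitrary: \<phi> \<psi>)
  case (Cons x xs)
  show ?case
    using Cons.prems Cons.IH[of "\<lambda>zs. \<phi> (x # zs)" "\<lambda>zs. \<psi> (x # zs)"] by (simp add: group_ac)
qed simp

text \<open>With \<phi>x the slice of \<phi> at the head x, the double differential at x # xs is
  d\<phi>(xs) - d\<phi>(xs) + dd\<phi>x(xs), and the last term vanishes by induction.\<close>

lemma hdiff_hdiff:
  assumes "\<And>zs. \<phi> zs \<in> carrier G"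
  shows "hdiff G (hdiff G \<phi>) zs = \<one>"
  using assms
proof (induction zs arbitrary: \<phi>)
  case (Cons x xs)
  then show ?case
    by (simp add: hdiff_mult_inv group_ac)
qed simp

lemma hdiff_map: "hdiff G (\<lambda>zs. \<phi> (map f zs)) zs = hdiff G \<phi> (map f zs)"
proof (induction zs arbitrary: \<phi>)
  case (Cons x xs)
  then show ?case
    using Cons.IH[of "\<lambda>zs. \<phi> (f x # zs)"] by simp
qed simp

text \<open>The prism operator is a chain homotopy between pullback along \<rho> and the identity.
  The map \<rho> is arbitrary here; its equivariance and continuity enter only when the prism has to
  be a cochain again.\<close>

lemma hprism_homotopy:
  assumes "\<And>zs. \<phi> zs \<in> carrier G"
  shows "hdiff G (hprism G \<rho> \<phi>) zs \<otimes> hprism G \<rho> (hdiff G \<phi>) zs = \<phi> (map \<rho> zs) \<otimes> inv \<phi> zs"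
  using assms
proof (induction zs arbitrary: \<phi>)
  case (Cons x xs)
  let ?\<phi>x = "\<lambda>zs. \<phi> (x # zs)"
  have 1: "hdiff G (\<lambda>zs. \<phi> (x # \<rho> x # map \<rho> zs)) xs = hdiff G (\<lambda>zs. \<phi> (x # \<rho> x # zs)) (map \<rho> xs)"
    by (rule hdiff_map)
  have c: "\<And>zs. \<phi> zs \<in> carrier G" by (fact Cons.prems)
  \<comment> \<open>The induction hypothesis for the slice at x, solved for the prism of its
    differential; substituting it leaves terms that cancel formally.\<close>
  have "hprism G \<rho> (hdiff G ?\<phi>x) xs
      = inv hdiff G (hprism G \<rho> ?\<phi>x) xs \<otimes> (?\<phi>x (map \<rho> xs) \<otimes> inv ?\<phi>x xs)"
    using Cons.IH[of ?\<phi>x] c by (simp add: inv_solve_left)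
  then show ?case
    by (simp add: c hdiff_mult_inv hprism_mult_inv 1) (simp add: c group_ac)
qed simp

text \<open>Link between the recursive form, suited to induction, and the indexed product that
  occurs in \<open>coboundary\<close>.\<close>

lemma hdiff_eq_finprod:
  assumes "\<And>zs. \<phi> zs \<in> carrier G"
  shows "hdiff G \<phi> zs =
    (\<Otimes>i\<in>{..<length zs}. \<phi> (take i zs @ drop (Suc i) zs) [^] ((-1) ^ i :: int))"
  using assms
proof (induction zs arbitrary: \<phi>)
  case (Cons x xs)
  let ?f = "\<lambda>i. \<phi> (take i (x # xs) @ drop (Suc i) (x # xs)) [^] ((-1) ^ i :: int)"
  have inv: "(\<Otimes>i\<in>A. inv h i) = inv (\<Otimes>i\<in>A. h i)" if "finite A" "\<And>i. h i \<in> carrier G" for h and A :: "nat set"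
    using that by (induction rule: finite_induct) (auto simp: inv_mult Pi_def)
  have "(\<Otimes>i\<in>{..<length (x # xs)}. ?f i) = (\<Otimes>i\<in>insert 0 (Suc ` {..<length xs}). ?f i)"
    by (simp add: lessThan_Suc_eq_insert_0)
  also have "\<dots> = ?f 0 \<otimes> (\<Otimes>i\<in>Suc ` {..<length xs}. ?f i)"
    using Cons.prems by (subst finprod_insert) (auto simp: Pi_def)
  also have "(\<Otimes>i\<in>Suc ` {..<length xs}. ?f i) = (\<Otimes>i\<in>{..<length xs}. ?f (Suc i))"
    using Cons.prems by (subst finprod_reindex) (auto simp: Pi_def)
  \<comment> \<open>Past the head every exponent is shifted by one, so the remaining product is the
    inverse of the sum for the slice.\<close>
  also have "\<dots> = inv (hdiff G (\<lambda>zs. \<phi> (x # zs)) xs)"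
    using Cons by (simp add: inv int_pow_neg)
  finally show ?case using Cons.prems by simp
qed simp

end

lemma hdiff_hom:
  assumes "comm_group A" "comm_group B" "h \<in> hom A B" "\<And>zs. \<phi> zs \<in> carrier A"
  shows "h (hdiff A \<phi> zs) = hdiff B (\<lambda>zs. h (\<phi> zs)) zs"
proof -
  interpret A: comm_group A by fact
  interpret B: comm_group B by fact
  interpret h: group_hom A B h
    using assms(3) by unfold_locales
  show ?thesis
    using assms(4) by (induction zs arbitrary: \<phi>) (auto)
qed

text \<open>Induction on r by slicing off the head: the inverse in front of the slice turns the sign
  (-1)^r into (-1)^(r+1). The condition on \<open>\<psi> []\<close> serves one-entry lists in degree
  r = 0, where the right-hand side becomes \<open>p (\<phi> [x]) (\<psi> [])\<close> while the
  left-hand side is trivial.\<close>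

lemma hcup_leibniz:
  assumes "comm_group A" "comm_group B" "comm_group C"
    and pA: "\<And>a. a \<in> carrier A \<Longrightarrow> p a \<in> hom B C"
    and pB: "\<And>b. b \<in> carrier B \<Longrightarrow> (\<lambda>a. p a b) \<in> hom A C"
    and \<phi>: "\<And>zs. \<phi> zs \<in> carrier A" and \<psi>: "\<And>zs. \<psi> zs \<in> carrier B" and \<psi>0: "\<psi> [] = \<one>\<^bsub>B\<^esub>"
  shows "hdiff C (hcup C p r \<phi> \<psi>) zs =
    hcup C p (Suc r) (hdiff A \<phi>) \<psi> zs \<otimes>\<^bsub>C\<^esub> hcup C p r \<phi> (hdiff B \<psi>) zs [^]\<^bsub>C\<^esub> ((-1) ^ r :: int)"
proof -
  interpret A: comm_group A by fact
  interpret B: comm_group B by fact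
  interpret C: comm_group C by fact
  have gA: "group_hom B C (p a)" if "a \<in> carrier A" for a
    using pA[OF that] by unfold_locales
  have gB: "group_hom A C (\<lambda>a. p a b)" if "b \<in> carrier B" for b
    using pB[OF that] by unfold_locales
  have p1: "p a \<one>\<^bsub>B\<^esub> = \<one>\<^bsub>C\<^esub>" if "a \<in> carrier A" for a
    using group_hom.hom_one[OF gA[OF that]] .
  have pc: "p a b \<in> carrier C" if "a \<in> carrier A" "b \<in> carrier B" for a b
    using group_hom.hom_closed[OF gA] that by blast
  have pR: "p a (b \<otimes>\<^bsub>B\<^esub> inv\<^bsub>B\<^esub> b') = p a b \<otimes>\<^bsub>C\<^esub> inv\<^bsub>C\<^esub> p a b'"
    if "a \<in> carrier A" "b \<in> carrier B" "b' \<in> carrier B" for a b b'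
    using that group_hom.hom_mult[OF gA[OF that(1)]] group_hom.hom_inv[OF gA[OF that(1)]] by simp
  have pL: "p (a \<otimes>\<^bsub>A\<^esub> inv\<^bsub>A\<^esub> a') b = p a b \<otimes>\<^bsub>C\<^esub> inv\<^bsub>C\<^esub> p a' b"
    if "b \<in> carrier B" "a \<in> carrier A" "a' \<in> carrier A" for a a' b
    using that group_hom.hom_mult[OF gB[OF that(1)]] group_hom.hom_inv[OF gB[OF that(1)]] by simp
  have cc: "hcup C p r \<phi> \<psi> zs \<in> carrier C"
    if "\<And>zs. \<phi> zs \<in> carrier A" "\<And>zs. \<psi> zs \<in> carrier B" for r \<phi> \<psi> and zs :: "'g list"
    using that
  proof (induction r arbitrary: \<phi> zs)
    case 0
    then show ?case by (cases zs) (auto simp: pc)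
  next
    case (Suc r)
    then show ?case by (cases zs) auto
  qed
  \<comment> \<open>Linearity in the first cochain, again in quotient form, to split the slice of
    \<open>hdiff A \<phi>\<close>.\<close>
  have lin: "hcup C p r (\<lambda>zs. \<phi> zs \<otimes>\<^bsub>A\<^esub> inv\<^bsub>A\<^esub> \<phi>' zs) \<psi> zs
      = hcup C p r \<phi> \<psi> zs \<otimes>\<^bsub>C\<^esub> inv\<^bsub>C\<^esub> hcup C p r \<phi>' \<psi> zs"
    if "\<And>zs. \<phi> zs \<in> carrier A" "\<And>zs. \<phi>' zs \<in> carrier A" for r \<phi> \<phi>' and zs :: "'g list"
    using that
  proof (induction r arbitrary: \<phi> \<phi>' zs)
    case 0
    then show ?case by (cases zs) (auto simp: \<psi> pL)
  next
    case (Suc r)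
    then show ?case by (cases zs) auto
  qed
  show ?thesis
    using \<phi>
  proof (induction r arbitrary: \<phi> zs)
    case 0
    note \<phi> = this
    show ?case
    proof (cases zs)
      case (Cons x xs)
      have 1: "hdiff C (\<lambda>zs. p (\<phi> [x]) (\<theta> zs)) ys = p (\<phi> [x]) (hdiff B \<theta> ys)"
        if "\<And>zs. \<theta> zs \<in> carrier B" for \<theta> and ys :: "'g list"
        by (rule hdiff_hom[symmetric]) (use that \<phi> pA assms in auto)
      show ?thesis
        by (cases xs; simp add: Cons 1 p1 \<phi> \<psi> pL pR pc \<psi>0) (simp add: C.group_ac \<phi> \<psi> pc)
    qed simp
  next
    case (Suc r)
    show ?case
    proof (cases zs)
      case (Cons x xs)
      have "hdiff C (\<lambda>zs. hcup C p (Suc r) \<phi> \<psi> (x # zs)) xs =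
        hcup C p (Suc r) (hdiff A (\<lambda>zs. \<phi> (x # zs))) \<psi> xs \<otimes>\<^bsub>C\<^esub>
        hcup C p r (\<lambda>zs. \<phi> (x # zs)) (hdiff B \<psi>) xs [^]\<^bsub>C\<^esub> ((-1) ^ r :: int)"
        using Suc.IH[of "\<lambda>zs. \<phi> (x # zs)" xs] Suc.prems by simp
      then show ?thesis
        by (simp add: Cons lin Suc.prems C.int_pow_neg cc \<psi> C.inv_mult)
           (simp add: cc \<psi> Suc.prems C.m_assoc)
    qed simp
  qed
qed

section \<open>Cochains and the coboundary\<close>

text \<open>A product of two discrete spaces is discrete, so any operation on the values preserves
  continuity.\<close>

lemma continuous_map_discrete_binop:
  assumes "continuous_map X (discrete_topology A) f" "continuous_map X (discrete_topology B) g"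
    and "\<And>a b. a \<in> A \<Longrightarrow> b \<in> B \<Longrightarrow> p a b \<in> C"
  shows "continuous_map X (discrete_topology C) (\<lambda>x. p (f x) (g x))"
proof -
  have "continuous_map X (prod_topology (discrete_topology A) (discrete_topology B)) (\<lambda>x. (f x, g x))"
    using assms by (intro continuous_map_pairedI)
  moreover have "continuous_map (prod_topology (discrete_topology A) (discrete_topology B)) (discrete_topology C)
      (\<lambda>(a, b). p a b)"
    using assms(3) by (auto simp: prod_topology_discrete_topology[symmetric])
  ultimately show ?thesis
    by (auto simp: o_def dest: continuous_map_compose)
qed

lemma continuous_map_discrete_unop:
  assumes "continuous_map X (discrete_topology A) f" "\<And>a. a \<in> A \<Longrightarrow> h a \<in> B"
  shows "continuous_map X (discrete_topology B) (\<lambda>x. h (f x))"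
  using continuous_map_discrete_binop[OF assms(1,1), of "\<lambda>a _. h a"] assms(2) by blast

section \<open>Topological groups and tuples of group elements\<close>

locale topgrp =
  fixes G :: "'g topgroup" (structure)
  assumes topological_group: "topological_group G"
begin

sublocale group G
  using topological_group by (simp add: topological_group_def)

lemma topspace_gtop [simp]: "topspace (gtop G) = carrier G"
  using topological_group by (simp add: topological_group_def)

lemma continuous_map_mult:
  assumes "continuous_map X (gtop G) f" "continuous_map X (gtop G) g"
  shows "continuous_map X (gtop G) (\<lambda>x. f x \<otimes> g x)"
proof -
  have "continuous_map (prod_topology (gtop G) (gtop G)) (gtop G) (\<lambda>(x, y). x \<otimes> y)"
    using topological_group by (simp add: topological_group_def)
  from continuous_map_compose[OF continuous_map_pairedI[OF assms] this] show ?thesis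
    by (simp add: o_def)
qed

lemma continuous_map_inv:
  assumes "continuous_map X (gtop G) f"
  shows "continuous_map X (gtop G) (\<lambda>x. inv (f x))"
  using topological_group continuous_map_compose[OF assms] by (force simp: topological_group_def o_def)

lemma continuous_map_restrict_tuples [simp]:
  "continuous_map (product_topology (\<lambda>_. gtop G) {..<r}) Y (restrict f (tuples G r))
    \<longleftrightarrow> continuous_map (product_topology (\<lambda>_. gtop G) {..<r}) Y f"
  by (rule restrict_continuous_map) (simp add: tuples_def)

lemma tuples_mem: "x \<in> tuples G r \<Longrightarrow> i < r \<Longrightarrow> x i \<in> carrier G"
  by (auto simp: tuples_def)

lemma restrict_tuples: "(\<And>i. i < r \<Longrightarrow> x i \<in> carrier G) \<Longrightarrow> (\<lambda>i\<in>{..<r}. x i) \<in> tuples G r"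
  by (auto simp: tuples_def)

lemma tuples_eqI:
  "x \<in> tuples G r \<Longrightarrow> y \<in> tuples G r \<Longrightarrow> (\<And>i. i < r \<Longrightarrow> x i = y i) \<Longrightarrow> x = y"
  unfolding tuples_def by (rule PiE_ext) auto

lemma merge_at_tuples: "x \<in> tuples G (Suc r) \<Longrightarrow> i < r \<Longrightarrow> merge_at G r i x \<in> tuples G r"
  unfolding merge_at_def by (rule restrict_tuples) (auto simp: tuples_mem)

lemma tuple_prod_closed [simp]: "x \<in> tuples G r \<Longrightarrow> i \<le> r \<Longrightarrow> tuple_prod G x i \<in> carrier G"
  by (induction i) (auto simp: tuples_mem)

lemma continuous_map_coordinate:
  "i < r \<Longrightarrow> continuous_map (product_topology (\<lambda>_. gtop G) {..<r}) (gtop G) (\<lambda>x. x i)"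
  by (rule continuous_map_product_projection) simp

lemma continuous_map_tuple_prod:
  "i \<le> r \<Longrightarrow> continuous_map (product_topology (\<lambda>_. gtop G) {..<r}) (gtop G) (\<lambda>x. tuple_prod G x i)"
  by (induction i) (auto intro!: continuous_map_mult continuous_map_coordinate)

end

section \<open>Discrete modules and their continuous cochains\<close>

locale discrete_gmodule = topgrp G for G :: "'g topgroup" (structure) +
  fixes A :: "('g, 'a) gmodule"
  assumes discrete_module: "discrete_module G A"
begin

sublocale M: comm_group A
  using discrete_module by (simp add: discrete_module_def)

lemma act_hom: "g \<in> carrier G \<Longrightarrow> act A g \<in> hom A A"
  using discrete_module by (simp add: discrete_module_def)

lemma act_group_hom: "g \<in> carrier G \<Longrightarrow> group_hom A A (act A g)"
  by unfold_locales (rule act_hom)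

lemma act_closed [simp]: "g \<in> carrier G \<Longrightarrow> a \<in> carrier A \<Longrightarrow> act A g a \<in> carrier A"
  using act_hom by (auto simp: hom_def)

lemma act_one [simp]: "a \<in> carrier A \<Longrightarrow> act A \<one> a = a"
  using discrete_module by (simp add: discrete_module_def)

lemma act_mult: "g \<in> carrier G \<Longrightarrow> h \<in> carrier G \<Longrightarrow> a \<in> carrier A \<Longrightarrow>
    act A (g \<otimes> h) a = act A g (act A h a)"
  using discrete_module by (simp add: discrete_module_def)

lemma act_inv_cancel [simp]: "g \<in> carrier G \<Longrightarrow> a \<in> carrier A \<Longrightarrow> act A g (act A (inv g) a) = a"
  by (simp flip: act_mult)

lemma act_unit [simp]: "g \<in> carrier G \<Longrightarrow> act A g \<one>\<^bsub>A\<^esub> = \<one>\<^bsub>A\<^esub>"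
  using group_hom.hom_one[OF act_group_hom] .

lemma act_distrib [simp]: "g \<in> carrier G \<Longrightarrow> a \<in> carrier A \<Longrightarrow> b \<in> carrier A \<Longrightarrow>
    act A g (a \<otimes>\<^bsub>A\<^esub> b) = act A g a \<otimes>\<^bsub>A\<^esub> act A g b"
  using act_hom by (auto simp: hom_def)

lemma act_inv [simp]: "g \<in> carrier G \<Longrightarrow> a \<in> carrier A \<Longrightarrow>
    act A g (inv\<^bsub>A\<^esub> a) = inv\<^bsub>A\<^esub> act A g a"
  using group_hom.hom_inv[OF act_group_hom] .

lemma act_int_pow [simp]: "g \<in> carrier G \<Longrightarrow> a \<in> carrier A \<Longrightarrow>
    act A g (a [^]\<^bsub>A\<^esub> (k::int)) = act A g a [^]\<^bsub>A\<^esub> k"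
  using group_hom.hom_int_pow[OF act_group_hom] .

lemma continuous_map_act:
  assumes "continuous_map X (gtop G) z" "continuous_map X (discrete_topology (carrier A)) f"
  shows "continuous_map X (discrete_topology (carrier A)) (\<lambda>x. act A (z x) (f x))"
proof -
  have "continuous_map (prod_topology (gtop G) (discrete_topology (carrier A)))
       (discrete_topology (carrier A)) (\<lambda>(g, a). act A g a)"
    using discrete_module by (simp add: discrete_module_def)
  from continuous_map_compose[OF continuous_map_pairedI[OF assms] this] show ?thesis
    by (simp add: o_def)
qed

lemma cochain_closed: "f \<in> carrier (cochains G A r) \<Longrightarrow> x \<in> tuples G r \<Longrightarrow> f x \<in> carrier A"
  unfolding cochains_def tuples_def using continuous_map_funspace by fastforce

lemma cochain_extensional: "f \<in> carrier (cochains G A r) \<Longrightarrow> f \<in> extensional (tuples G r)"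
  by (simp add: cochains_def)

lemma cochain_eqI:
  "f \<in> extensional (tuples G r) \<Longrightarrow> g \<in> extensional (tuples G r) \<Longrightarrow>
    (\<And>x. x \<in> tuples G r \<Longrightarrow> f x = g x) \<Longrightarrow> f = g"
  by (rule extensionalityI[of f "tuples G r" g])

lemma cochainI:
  assumes "continuous_map (product_topology (\<lambda>_. gtop G) {..<r}) (discrete_topology (carrier A)) f"
  shows "(\<lambda>x\<in>tuples G r. f x) \<in> carrier (cochains G A r)"
  using assms by (simp add: cochains_def)

text \<open>Substitution of continuous coordinates into a cochain. Points of the product topology
  are extensional functions, hence the last premise.\<close>

lemma continuous_map_cochain:
  assumes "f \<in> carrier (cochains G A r)"
    and "\<And>i. i < r \<Longrightarrow> continuous_map X (gtop G) (\<lambda>t. u t i)"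
    and "\<And>t. t \<in> topspace X \<Longrightarrow> u t \<in> extensional {..<r}"
  shows "continuous_map X (discrete_topology (carrier A)) (\<lambda>t. f (u t))"
proof -
  have "continuous_map X (product_topology (\<lambda>_. gtop G) {..<r}) u"
    using assms by (auto simp: continuous_map_componentwise)
  from continuous_map_compose[OF this, of "discrete_topology (carrier A)" f] assms(1) show ?thesis
    by (simp add: cochains_def o_def)
qed

lemma continuous_map_module_mult:
  assumes "continuous_map X (discrete_topology (carrier A)) f" "continuous_map X (discrete_topology (carrier A)) g"
  shows "continuous_map X (discrete_topology (carrier A)) (\<lambda>x. f x \<otimes>\<^bsub>A\<^esub> g x)"
  using assms by (rule continuous_map_discrete_binop) auto

lemma continuous_map_module_int_pow:
  assumes "continuous_map X (discrete_topology (carrier A)) f"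
  shows "continuous_map X (discrete_topology (carrier A)) (\<lambda>x. f x [^]\<^bsub>A\<^esub> (k::int))"
  using assms by (rule continuous_map_discrete_unop) auto

lemma continuous_map_module_inv:
  assumes "continuous_map X (discrete_topology (carrier A)) f"
  shows "continuous_map X (discrete_topology (carrier A)) (\<lambda>x. inv\<^bsub>A\<^esub> f x)"
  using assms by (rule continuous_map_discrete_unop) auto

lemma continuous_map_finprod:
  assumes "\<And>i. i \<in> I \<Longrightarrow> continuous_map X (discrete_topology (carrier A)) (f i)" "finite I"
  shows "continuous_map X (discrete_topology (carrier A)) (\<lambda>x. \<Otimes>\<^bsub>A\<^esub>i\<in>I. f i x)"
  using assms(2,1)
proof (induction rule: finite_induct)
  case (insert a I)
  have "continuous_map X (discrete_topology (carrier A)) (\<lambda>x. f a x \<otimes>\<^bsub>A\<^esub> (\<Otimes>\<^bsub>A\<^esub>i\<in>I. f i x))"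
    using insert by (intro continuous_map_module_mult) auto
  moreover have "(\<Otimes>\<^bsub>A\<^esub>i\<in>insert a I. f i x) = f a x \<otimes>\<^bsub>A\<^esub> (\<Otimes>\<^bsub>A\<^esub>i\<in>I. f i x)"
    if "x \<in> topspace X" for x
    using insert.hyps continuous_map_funspace[OF insert.prems] that
    by (intro M.finprod_insert) (auto simp: Pi_iff)
  ultimately show ?case
    by (auto elim: continuous_map_eq)
qed simp

lemma cochains_mult: "x \<in> tuples G r \<Longrightarrow> (f \<otimes>\<^bsub>cochains G A r\<^esub> g) x = f x \<otimes>\<^bsub>A\<^esub> g x"
  by (simp add: cochains_def)

lemma cochains_one: "x \<in> tuples G r \<Longrightarrow> \<one>\<^bsub>cochains G A r\<^esub> x = \<one>\<^bsub>A\<^esub>"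
  by (simp add: cochains_def)

lemma comm_group_cochains: "comm_group (cochains G A r)"
proof (rule comm_groupI)
  fix f g assume f: "f \<in> carrier (cochains G A r)" and g: "g \<in> carrier (cochains G A r)"
  show "f \<otimes>\<^bsub>cochains G A r\<^esub> g \<in> carrier (cochains G A r)"
    using cochainI[OF continuous_map_module_mult, of r f g] f g by (simp add: cochains_def)
  show "f \<otimes>\<^bsub>cochains G A r\<^esub> g = g \<otimes>\<^bsub>cochains G A r\<^esub> f"
    using cochain_closed[OF f] cochain_closed[OF g] by (auto simp: cochains_def M.m_comm)
  fix h assume h: "h \<in> carrier (cochains G A r)"
  show "f \<otimes>\<^bsub>cochains G A r\<^esub> g \<otimes>\<^bsub>cochains G A r\<^esub> h = f \<otimes>\<^bsub>cochains G A r\<^esub> (g \<otimes>\<^bsub>cochains G A r\<^esub> h)"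
    using cochain_closed[OF f] cochain_closed[OF g] cochain_closed[OF h]
    by (auto simp: cochains_def M.m_assoc)
next
  show "\<one>\<^bsub>cochains G A r\<^esub> \<in> carrier (cochains G A r)"
    by (simp add: cochains_def)
next
  fix f assume f: "f \<in> carrier (cochains G A r)"
  show "\<one>\<^bsub>cochains G A r\<^esub> \<otimes>\<^bsub>cochains G A r\<^esub> f = f"
    by (rule cochain_eqI[of _ r]) (use cochain_closed[OF f] cochain_extensional[OF f] in \<open>auto simp: cochains_def\<close>)
  show "\<exists>g\<in>carrier (cochains G A r). g \<otimes>\<^bsub>cochains G A r\<^esub> f = \<one>\<^bsub>cochains G A r\<^esub>"
  proof
    show "(\<lambda>x\<in>tuples G r. inv\<^bsub>A\<^esub> f x) \<in> carrier (cochains G A r)"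
      using f by (intro cochainI continuous_map_module_inv) (simp add: cochains_def)
    show "(\<lambda>x\<in>tuples G r. inv\<^bsub>A\<^esub> f x) \<otimes>\<^bsub>cochains G A r\<^esub> f = \<one>\<^bsub>cochains G A r\<^esub>"
      using cochain_closed[OF f] by (auto simp: cochains_def)
  qed
qed

text \<open>Evaluation at a tuple as a homomorphism: inverses and integer powers of cochains can
  then be computed on values without unfolding their abstract definitions.\<close>

lemma cochains_eval_hom: "x \<in> tuples G r \<Longrightarrow> group_hom (cochains G A r) A (\<lambda>f. f x)"
  by (intro group_hom.intro group_hom_axioms.intro homI comm_group.axioms(2)[OF comm_group_cochains] M.group_axioms)
    (auto simp: cochain_closed cochains_mult)

lemma cochains_inv:
  "x \<in> tuples G r \<Longrightarrow> f \<in> carrier (cochains G A r) \<Longrightarrow> (inv\<^bsub>cochains G A r\<^esub> f) x = inv\<^bsub>A\<^esub> f x"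
  using group_hom.hom_inv[OF cochains_eval_hom] by blast

lemma cochains_int_pow:
  "x \<in> tuples G r \<Longrightarrow> f \<in> carrier (cochains G A r) \<Longrightarrow>
    (f [^]\<^bsub>cochains G A r\<^esub> (k::int)) x = f x [^]\<^bsub>A\<^esub> k"
  using group_hom.hom_int_pow[OF cochains_eval_hom] by blast

lemma coboundary_closed:
  assumes f: "f \<in> carrier (cochains G A r)"
  shows "coboundary G A r f \<in> carrier (cochains G A (Suc r))"
  unfolding coboundary_def
proof (intro cochainI continuous_map_module_mult continuous_map_act continuous_map_finprod
    continuous_map_module_int_pow continuous_map_cochain[OF f])
  fix i j assume "i \<in> {..<r}" "j < r"
  then have "continuous_map (product_topology (\<lambda>_. gtop G) {..<Suc r}) (gtop G) (\<lambda>x. x i \<otimes> x (Suc i))"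
    by (intro continuous_map_mult continuous_map_coordinate) auto
  then have "continuous_map (product_topology (\<lambda>_. gtop G) {..<Suc r}) (gtop G)
      (\<lambda>x. if j < i then x j else if j = i then x i \<otimes> x (Suc i) else x (Suc j))"
    using \<open>j < r\<close> by (auto intro: continuous_map_coordinate)
  then show "continuous_map (product_topology (\<lambda>_. gtop G) {..<Suc r}) (gtop G) (\<lambda>x. merge_at G r i x j)"
    using \<open>j < r\<close> by (simp add: merge_at_def)
qed (auto simp: merge_at_def intro: continuous_map_coordinate)

lemma coboundary_hom: "coboundary G A r \<in> hom (cochains G A r) (cochains G A (Suc r))"
proof (rule homI)
  fix f g assume f: "f \<in> carrier (cochains G A r)" and g: "g \<in> carrier (cochains G A r)"
  interpret C: comm_group "cochains G A r" by (rule comm_group_cochains)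
  interpret C': comm_group "cochains G A (Suc r)" by (rule comm_group_cochains)
  show "coboundary G A r (f \<otimes>\<^bsub>cochains G A r\<^esub> g)
      = coboundary G A r f \<otimes>\<^bsub>cochains G A (Suc r)\<^esub> coboundary G A r g"
  proof (rule cochain_eqI[of _ "Suc r"])
    fix x assume x: "x \<in> tuples G (Suc r)"
    have t: "(\<lambda>j\<in>{..<r}. x (Suc j)) \<in> tuples G r" "restrict x {..<r} \<in> tuples G r"
      using x by (auto intro!: restrict_tuples simp: tuples_mem)
    note c = cochain_closed[OF f] cochain_closed[OF g] t merge_at_tuples[OF x]
    let ?P = "\<lambda>f. \<Otimes>\<^bsub>A\<^esub>i\<in>{..<r}. f (merge_at G r i x) [^]\<^bsub>A\<^esub> ((-1) ^ Suc i :: int)"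
    have "?P (f \<otimes>\<^bsub>cochains G A r\<^esub> g)
        = (\<Otimes>\<^bsub>A\<^esub>i\<in>{..<r}. f (merge_at G r i x) [^]\<^bsub>A\<^esub> ((-1) ^ Suc i :: int) \<otimes>\<^bsub>A\<^esub>
            g (merge_at G r i x) [^]\<^bsub>A\<^esub> ((-1) ^ Suc i :: int))"
      by (rule M.finprod_cong') (auto simp: c cochains_mult M.int_pow_distrib)
    also have "\<dots> = ?P f \<otimes>\<^bsub>A\<^esub>
        ?P g"
      by (rule M.finprod_multf) (auto simp: c)
    finally have prod: "?P (f \<otimes>\<^bsub>cochains G A r\<^esub> g)
        = ?P f \<otimes>\<^bsub>A\<^esub>
        ?P g" .
    have closed: "?P f \<in> carrier A"
      "?P g \<in> carrier A"
      by (auto simp: c intro!: M.finprod_closed)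
    have shuffle: "(a \<otimes>\<^bsub>A\<^esub> a') \<otimes>\<^bsub>A\<^esub> (b \<otimes>\<^bsub>A\<^esub> b') \<otimes>\<^bsub>A\<^esub> (d \<otimes>\<^bsub>A\<^esub> d')
        = (a \<otimes>\<^bsub>A\<^esub> b \<otimes>\<^bsub>A\<^esub> d) \<otimes>\<^bsub>A\<^esub> (a' \<otimes>\<^bsub>A\<^esub> b' \<otimes>\<^bsub>A\<^esub> d')"
      if "{a, a', b, b', d, d'} \<subseteq> carrier A" for a a' b b' d d'
      using that by (simp add: M.m_ac)
    show "coboundary G A r (f \<otimes>\<^bsub>cochains G A r\<^esub> g) x
      = (coboundary G A r f \<otimes>\<^bsub>cochains G A (Suc r)\<^esub> coboundary G A r g) x"
      unfolding coboundary_def cochains_mult[OF x] restrict_apply'[OF x] prod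
      using tuples_mem[OF x] by (subst shuffle[symmetric])
        (simp_all only: cochains_mult t c closed M.int_pow_distrib M.int_pow_closed act_closed act_distrib
          zero_less_Suc insert_subset empty_subsetI simp_thms)
  qed (intro cochain_extensional coboundary_closed C'.m_closed C.m_closed f g)+
qed (rule coboundary_closed)

end

section \<open>Homogeneous cochains\<close>

text \<open>
  The cochain \<open>f\<close> corresponds to the homogeneous cochain
  \<open>\<phi>(z\<^sub>0, \<dots>, z\<^sub>r) = z\<^sub>0 f(z\<^sub>0\<^sup>-\<^sup>1 z\<^sub>1, \<dots>, z\<^sub>r\<^sub>-\<^sub>1\<^sup>-\<^sup>1 z\<^sub>r)\<close>. It is made total on lists
  (entries outside the group are replaced by the unit, and lists of the wrong length are
  sent to the neutral element), so that identities between homogeneous cochains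
  are equalities of functions.
\<close>

definition clip :: "'g topgroup \<Rightarrow> 'g \<Rightarrow> 'g" where
  "clip G x = (if x \<in> carrier G then x else \<one>\<^bsub>G\<^esub>)"

definition steps :: "'g topgroup \<Rightarrow> nat \<Rightarrow> 'g list \<Rightarrow> (nat \<Rightarrow> 'g)" where
  "steps G r zs = (\<lambda>i\<in>{..<r}. inv\<^bsub>G\<^esub> clip G (zs ! i) \<otimes>\<^bsub>G\<^esub> clip G (zs ! Suc i))"

text \<open>Inverse to \<open>steps\<close>: the vertices y, y x1, y x1 x2, ... with first vertex
  \<open>y\<close> and successive quotients \<open>x\<close>. On them a homogeneous cochain shows
  the values of the inhomogeneous one.\<close>

definition walk :: "'g topgroup \<Rightarrow> nat \<Rightarrow> 'g \<Rightarrow> (nat \<Rightarrow> 'g) \<Rightarrow> 'g list" where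
  "walk G r y x = map (\<lambda>i. y \<otimes>\<^bsub>G\<^esub> tuple_prod G x i) [0..<Suc r]"

definition hmg :: "'g topgroup \<Rightarrow> ('g, 'a) gmodule \<Rightarrow> nat \<Rightarrow> ((nat \<Rightarrow> 'g) \<Rightarrow> 'a) \<Rightarrow> 'g list \<Rightarrow> 'a" where
  "hmg G A r f zs =
     (if length zs = Suc r then act A (clip G (zs ! 0)) (f (steps G r zs)) else \<one>\<^bsub>A\<^esub>)"

context topgrp
begin

lemma clip_closed [simp]: "clip G x \<in> carrier G"
  by (simp add: clip_def)

lemma clip_id [simp]: "x \<in> carrier G \<Longrightarrow> clip G x = x"
  by (simp add: clip_def)

lemma steps_tuples [simp]: "steps G r zs \<in> tuples G r"
  unfolding steps_def by (rule restrict_tuples) auto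

lemma steps_nth: "i < r \<Longrightarrow> steps G r zs i = inv clip G (zs ! i) \<otimes> clip G (zs ! Suc i)"
  by (simp add: steps_def)

lemma length_walk [simp]: "length (walk G r y x) = Suc r"
  by (simp add: walk_def)

lemma walk_nth: "i \<le> r \<Longrightarrow> walk G r y x ! i = y \<otimes> tuple_prod G x i"
  unfolding walk_def by (subst nth_map) (auto simp del: upt_Suc)

lemma steps_walk:
  assumes "y \<in> carrier G" "x \<in> tuples G r"
  shows "steps G r (walk G r y x) = x"
proof (rule tuples_eqI)
  fix i assume "i < r"
  with assms show "steps G r (walk G r y x) i = x i"
    by (simp add: steps_nth walk_nth inv_mult_group tuples_mem m_assoc) (simp add: tuples_mem flip: m_assoc)
qed (use assms in auto)

text \<open>The product of the first i quotients telescopes, so it leads from vertex 0 to vertex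
  i.\<close>

lemma tuple_prod_steps:
  "i \<le> r \<Longrightarrow> clip G (zs ! 0) \<otimes> tuple_prod G (steps G r zs) i = clip G (zs ! i)"
proof (induction i)
  case (Suc i)
  have "clip G (zs ! 0) \<otimes> tuple_prod G (steps G r zs) (Suc i)
      = (clip G (zs ! 0) \<otimes> tuple_prod G (steps G r zs) i) \<otimes> steps G r zs i"
    using Suc.prems tuples_mem[OF steps_tuples, of i r zs] tuple_prod_closed[OF steps_tuples, of i r zs]
      by (simp add: m_assoc)
  also have "\<dots> = clip G (zs ! Suc i)"
    using Suc by (simp add: steps_nth flip: m_assoc)
  finally show ?case .
qed simp

lemma walk_steps:
  assumes "length zs = Suc r"
  shows "walk G r (clip G (zs ! 0)) (steps G r zs) = map (clip G) zs"
  using assms by (intro nth_equalityI) (auto simp: walk_nth tuple_prod_steps)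

text \<open>This and the next two lemmas match the deletion of a vertex with the three kinds of
  terms of \<open>coboundary\<close>: deleting an end drops a step, and deleting the inner vertex
  \<open>Suc i\<close> merges the steps \<open>i\<close> and \<open>Suc i\<close>.\<close>

lemma steps_delete_0: "length zs = Suc (Suc r) \<Longrightarrow> steps G r (drop (Suc 0) zs) = (\<lambda>j\<in>{..<r}. steps G (Suc r) zs (Suc j))"
  by (auto simp: steps_def)

lemma steps_delete_last: "length zs = Suc (Suc r) \<Longrightarrow> steps G r (take (Suc r) zs) = restrict (steps G (Suc r) zs) {..<r}"
  by (auto simp: steps_def)

lemma steps_delete_middle:
  assumes "length zs = Suc (Suc r)" "i < r"
  shows "steps G r (take (Suc i) zs @ drop (Suc (Suc i)) zs) = merge_at G r i (steps G (Suc r) zs)"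
proof (rule tuples_eqI)
  fix j assume j: "j < r"
  have nth: "(take (Suc i) zs @ drop (Suc (Suc i)) zs) ! k = (if k \<le> i then zs ! k else zs ! Suc k)" if "k \<le> r" for k
    using assms that by (auto simp: nth_append)
  have cancel: "inv a \<otimes> b \<otimes> (inv b \<otimes> c) = inv a \<otimes> c"
    if "a \<in> carrier G" "b \<in> carrier G" "c \<in> carrier G" for a b c
    using that by (metis inv_closed inv_solve_left m_assoc m_closed)
  show "steps G r (take (Suc i) zs @ drop (Suc (Suc i)) zs) j = merge_at G r i (steps G (Suc r) zs) j"
    using j by (auto simp: steps_nth nth merge_at_def cancel)
qed (use assms in \<open>auto intro!: merge_at_tuples\<close>)

end

lemma finprod_hom:
  assumes "comm_group A" "comm_group B" "h \<in> hom A B" "\<And>i. i \<in> I \<Longrightarrow> f i \<in> carrier A" "finite I"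
  shows "h (\<Otimes>\<^bsub>A\<^esub>i\<in>I. f i) = (\<Otimes>\<^bsub>B\<^esub>i\<in>I. h (f i))"
proof -
  interpret A: comm_group A by fact
  interpret B: comm_group B by fact
  interpret h: group_hom A B h
    using assms(3) by unfold_locales
  show ?thesis
    using assms(5,4) by (induction rule: finite_induct) (auto simp: Pi_def)
qed

lemma (in comm_group) finprod_lessThan_Suc_Suc:
  assumes "\<And>i. f i \<in> carrier G"
  shows "(\<Otimes>i\<in>{..<Suc (Suc n)}. f i) = f 0 \<otimes> (\<Otimes>i\<in>{..<n}. f (Suc i)) \<otimes> f (Suc n)"
proof -
  have 1: "(\<Otimes>i\<in>{..<Suc (Suc n)}. f i) = f (Suc n) \<otimes> (\<Otimes>i\<in>{..<Suc n}. f i)"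
    using assms by (simp add: lessThan_Suc[of "Suc n"])
  have 2: "(\<Otimes>i\<in>{..<Suc n}. f i) = f 0 \<otimes> (\<Otimes>i\<in>Suc ` {..<n}. f i)"
    using assms unfolding lessThan_Suc_eq_insert_0[of n] by (subst finprod_insert) (auto simp: Pi_def)
  have 3: "(\<Otimes>i\<in>Suc ` {..<n}. f i) = (\<Otimes>i\<in>{..<n}. f (Suc i))"
    using assms by (subst finprod_reindex) (auto simp: Pi_def)
  show ?thesis
    using assms unfolding 1 2 3 by (subst m_comm) auto
qed

section \<open>Passage from inhomogeneous to homogeneous cochains\<close>

context discrete_gmodule
begin

lemma hmg_closed [simp]: "f \<in> carrier (cochains G A r) \<Longrightarrow> hmg G A r f zs \<in> carrier A"
  by (auto simp: hmg_def cochain_closed)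

lemma hmg_walk:
  assumes "f \<in> carrier (cochains G A r)" "y \<in> carrier G" "x \<in> tuples G r"
  shows "hmg G A r f (walk G r y x) = act A y (f x)"
  using assms by (simp add: hmg_def steps_walk walk_nth)

text \<open>The values f(x) are recovered on walks that start at the unit, where the acting base
  point is trivial.\<close>

lemma hmg_inject:
  assumes f: "f \<in> carrier (cochains G A r)" and g: "g \<in> carrier (cochains G A r)"
    and eq: "\<And>zs. hmg G A r f zs = hmg G A r g zs"
  shows "f = g"
proof (rule cochain_eqI[of _ r])
  fix x assume x: "x \<in> tuples G r"
  show "f x = g x"
    using eq[of "walk G r \<one> x"] x
    by (simp add: hmg_walk[OF f] hmg_walk[OF g] cochain_closed[OF f] cochain_closed[OF g])
qed (use f g cochain_extensional in auto)

lemma hmg_mult: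
  assumes "f \<in> carrier (cochains G A r)" "g \<in> carrier (cochains G A r)"
  shows "hmg G A r (f \<otimes>\<^bsub>cochains G A r\<^esub> g) zs = hmg G A r f zs \<otimes>\<^bsub>A\<^esub> hmg G A r g zs"
  using assms by (simp add: hmg_def cochains_mult cochain_closed)

lemma hmg_int_pow:
  assumes "f \<in> carrier (cochains G A r)"
  shows "hmg G A r (f [^]\<^bsub>cochains G A r\<^esub> (k::int)) zs = hmg G A r f zs [^]\<^bsub>A\<^esub> k"
  using assms by (simp add: hmg_def cochains_int_pow cochain_closed)

lemma hmg_one [simp]: "hmg G A r \<one>\<^bsub>cochains G A r\<^esub> zs = \<one>\<^bsub>A\<^esub>"
  by (simp add: hmg_def cochains_one)

text \<open>Term by term: deleting vertex 0 moves the base point to z0 x0, which accounts for the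
  action of the first entry in \<open>coboundary\<close>; all other deletions keep the base point
  z0.\<close>

lemma hmg_coboundary:
  assumes f: "f \<in> carrier (cochains G A r)"
  shows "hmg G A (Suc r) (coboundary G A r f) = hdiff A (hmg G A r f)"
proof
  fix zs :: "'g list"
  let ?del = "\<lambda>i. take i zs @ drop (Suc i) zs"
  let ?F = "\<lambda>i. hmg G A r f (?del i) [^]\<^bsub>A\<^esub> ((-1) ^ i :: int)"
  have hdiff: "hdiff A (hmg G A r f) zs = (\<Otimes>\<^bsub>A\<^esub>i\<in>{..<length zs}. ?F i)"
    by (rule M.hdiff_eq_finprod) (simp add: f)
  show "hmg G A (Suc r) (coboundary G A r f) zs = hdiff A (hmg G A r f) zs"
  proof (cases "length zs = Suc (Suc r)")
    case False
    \<comment> \<open>A list of the wrong length still has the wrong length after one deletion, so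
      every term takes the default value.\<close>
    have "(\<Otimes>\<^bsub>A\<^esub>i\<in>{..<length zs}. ?F i) = \<one>\<^bsub>A\<^esub>"
      using False by (intro M.finprod_one_eqI) (auto simp: hmg_def)
    then show ?thesis
      using False by (simp add: hdiff hmg_def)
  next
    case True
    let ?x = "steps G (Suc r) zs" and ?z = "clip G (zs ! 0)"
    have tl: "(\<lambda>j\<in>{..<r}. ?x (Suc j)) \<in> tuples G r" "restrict ?x {..<r} \<in> tuples G r"
      by (auto intro!: restrict_tuples tuples_mem[of _ "Suc r"])
    have c: "f (\<lambda>j\<in>{..<r}. ?x (Suc j)) \<in> carrier A" "f (restrict ?x {..<r}) \<in> carrier A"
      "i < r \<Longrightarrow> f (merge_at G r i ?x) \<in> carrier A" for i
      using f tl by (auto intro!: cochain_closed merge_at_tuples)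
    have act_prod: "act A ?z (\<Otimes>\<^bsub>A\<^esub>i\<in>{..<r}. f (merge_at G r i ?x) [^]\<^bsub>A\<^esub> ((-1) ^ Suc i :: int))
        = (\<Otimes>\<^bsub>A\<^esub>i\<in>{..<r}. act A ?z (f (merge_at G r i ?x)) [^]\<^bsub>A\<^esub> ((-1) ^ Suc i :: int))"
      using c by (subst finprod_hom[OF M.comm_group_axioms M.comm_group_axioms act_hom])
        (auto intro!: M.finprod_cong' simp del: power_Suc)
    \<comment> \<open>The base point after deletion of vertex 0.\<close>
    have x0: "?z \<otimes> ?x 0 = clip G (zs ! Suc 0)"
      using tuple_prod_steps[of "Suc 0" "Suc r" zs] tuples_mem[of ?x "Suc r" 0] by simp
    have F0: "?F 0 = act A ?z (act A (?x 0) (f (\<lambda>j\<in>{..<r}. ?x (Suc j))))"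
      using True c x0 tuples_mem[of ?x "Suc r" 0] by (simp add: hmg_def steps_delete_0 flip: act_mult)
    have FS: "?F (Suc i) = act A ?z (f (merge_at G r i ?x)) [^]\<^bsub>A\<^esub> ((-1) ^ Suc i :: int)" if "i < r" for i
      using True that by (simp add: hmg_def steps_delete_middle nth_append del: power_Suc)
    have Fr: "?F (Suc r) = act A ?z (f (restrict ?x {..<r})) [^]\<^bsub>A\<^esub> ((-1) ^ Suc r :: int)"
      using True by (simp add: hmg_def steps_delete_last del: power_Suc)
    have "(\<Otimes>\<^bsub>A\<^esub>i\<in>{..<length zs}. ?F i)
        = ?F 0 \<otimes>\<^bsub>A\<^esub> (\<Otimes>\<^bsub>A\<^esub>i\<in>{..<r}. ?F (Suc i)) \<otimes>\<^bsub>A\<^esub> ?F (Suc r)"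
      unfolding True by (rule M.finprod_lessThan_Suc_Suc) (simp add: f)
    also have "(\<Otimes>\<^bsub>A\<^esub>i\<in>{..<r}. ?F (Suc i))
        = (\<Otimes>\<^bsub>A\<^esub>i\<in>{..<r}. act A ?z (f (merge_at G r i ?x)) [^]\<^bsub>A\<^esub> ((-1) ^ Suc i :: int))"
      by (rule M.finprod_cong') (use FS c in \<open>auto simp del: power_Suc\<close>)
    finally show ?thesis
      unfolding hdiff F0 Fr using True c tuples_mem[of ?x "Suc r" 0] act_prod
      by (simp add: hmg_def coboundary_def M.finprod_closed Pi_def del: power_Suc)
  qed
qed

text \<open>The identity is \<open>hdiff_hdiff\<close>, carried back by injectivity of the passage
  to homogeneous cochains.\<close>

lemma coboundary_coboundary:
  assumes "f \<in> carrier (cochains G A r)"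
  shows "coboundary G A (Suc r) (coboundary G A r f) = \<one>\<^bsub>cochains G A (Suc (Suc r))\<^esub>"
proof (rule hmg_inject)
  show "\<one>\<^bsub>cochains G A (Suc (Suc r))\<^esub> \<in> carrier (cochains G A (Suc (Suc r)))"
    using comm_group_cochains comm_group.axioms(2) group.is_monoid monoid.one_closed by blast
qed (use assms in \<open>auto simp: coboundary_closed hmg_coboundary M.hdiff_hdiff\<close>)

end

lemma hcup_short: "length zs \<le> r \<Longrightarrow> hcup C p r \<phi> \<psi> zs = \<one>\<^bsub>C\<^esub>"
proof (induction r arbitrary: \<phi> zs)
  case (Suc r)
  then show ?case by (cases zs) auto
qed simp

lemma hcup_eq: "r < length zs \<Longrightarrow> hcup C p r \<phi> \<psi> zs = p (\<phi> (take (Suc r) zs)) (\<psi> (drop r zs))"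
proof (induction r arbitrary: \<phi> zs)
  case 0
  then show ?case by (cases zs) auto
next
  case (Suc r)
  then show ?case by (cases zs) auto
qed

section \<open>Pairings and the cup product of cochains\<close>

locale gmodule_pairing = A: discrete_gmodule G A + B: discrete_gmodule G B + C: discrete_gmodule G C
  for G :: "'g topgroup" (structure) and A :: "('g, 'a) gmodule" and B :: "('g, 'b) gmodule"
    and C :: "('g, 'c) gmodule" +
  fixes p :: "'a \<Rightarrow> 'b \<Rightarrow> 'c"
  assumes bilinear_pairing: "bilinear_pairing G A B C p"
begin

lemma pairing_hom_right: "a \<in> carrier A \<Longrightarrow> p a \<in> hom B C"
  and pairing_hom_left: "b \<in> carrier B \<Longrightarrow> (\<lambda>a. p a b) \<in> hom A C"
  and act_pairing: "g \<in> carrier G \<Longrightarrow> a \<in> carrier A \<Longrightarrow> b \<in> carrier B \<Longrightarrow>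
        act C g (p a b) = p (act A g a) (act B g b)"
  using bilinear_pairing by (auto simp: bilinear_pairing_def)

lemma pairing_closed [simp]: "a \<in> carrier A \<Longrightarrow> b \<in> carrier B \<Longrightarrow> p a b \<in> carrier C"
  using pairing_hom_right by (auto simp: hom_def)

lemma pairing_mult_left: "a \<in> carrier A \<Longrightarrow> a' \<in> carrier A \<Longrightarrow> b \<in> carrier B \<Longrightarrow>
    p (a \<otimes>\<^bsub>A\<^esub> a') b = p a b \<otimes>\<^bsub>C\<^esub> p a' b"
  using pairing_hom_left by (auto simp: hom_def)

lemma pairing_mult_right: "a \<in> carrier A \<Longrightarrow> b \<in> carrier B \<Longrightarrow> b' \<in> carrier B \<Longrightarrow>
    p a (b \<otimes>\<^bsub>B\<^esub> b') = p a b \<otimes>\<^bsub>C\<^esub> p a b'"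
  using pairing_hom_right by (auto simp: hom_def)

lemma pairing_one_right: "a \<in> carrier A \<Longrightarrow> p a \<one>\<^bsub>B\<^esub> = \<one>\<^bsub>C\<^esub>"
  by (intro hom_one[OF pairing_hom_right] B.M.group_axioms C.M.group_axioms)

lemma pairing_one_left: "b \<in> carrier B \<Longrightarrow> p \<one>\<^bsub>A\<^esub> b = \<one>\<^bsub>C\<^esub>"
  using hom_one[OF pairing_hom_left A.M.group_axioms C.M.group_axioms] .

lemma cup_tuples:
  assumes "x \<in> tuples G (r + s)"
  shows "restrict x {..<r} \<in> tuples G r" "(\<lambda>j\<in>{..<s}. x (r + j)) \<in> tuples G s"
    "tuple_prod G x r \<in> carrier G"
  using assms by (auto intro!: A.restrict_tuples A.tuples_mem[of x "r + s"] A.tuple_prod_closed)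

lemma cup_closed:
  assumes f: "f \<in> carrier (cochains G A r)" and g: "g \<in> carrier (cochains G B s)"
  shows "cup G B p r s f g \<in> carrier (cochains G C (r + s))"
  unfolding cup_def
proof (intro C.cochainI continuous_map_discrete_binop[where p = p])
  show "continuous_map (product_topology (\<lambda>_. gtop G) {..<r + s}) (discrete_topology (carrier A))
      (\<lambda>x. f (restrict x {..<r}))"
    by (rule A.continuous_map_cochain[OF f]) (auto intro: A.continuous_map_coordinate)
  show "continuous_map (product_topology (\<lambda>_. gtop G) {..<r + s}) (discrete_topology (carrier B))
      (\<lambda>x. act B (tuple_prod G x r) (g (\<lambda>j\<in>{..<s}. x (r + j))))"
    by (intro B.continuous_map_act B.continuous_map_cochain[OF g] A.continuous_map_tuple_prod)
      (auto intro: A.continuous_map_coordinate)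
qed auto

lemma cup_mult_left:
  assumes "f \<in> carrier (cochains G A r)" "f' \<in> carrier (cochains G A r)" "g \<in> carrier (cochains G B s)"
  shows "cup G B p r s (f \<otimes>\<^bsub>cochains G A r\<^esub> f') g
    = cup G B p r s f g \<otimes>\<^bsub>cochains G C (r + s)\<^esub> cup G B p r s f' g"
  by (rule C.cochain_eqI[of _ "r + s"])
    (use assms cup_tuples in \<open>auto simp: cup_def A.cochains_mult C.cochains_mult A.cochain_closed
      B.cochain_closed pairing_mult_left\<close>, simp add: cochains_def)

lemma cup_mult_right:
  assumes "f \<in> carrier (cochains G A r)" "g \<in> carrier (cochains G B s)" "g' \<in> carrier (cochains G B s)"
  shows "cup G B p r s f (g \<otimes>\<^bsub>cochains G B s\<^esub> g')
    = cup G B p r s f g \<otimes>\<^bsub>cochains G C (r + s)\<^esub> cup G B p r s f g'"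
  by (rule C.cochain_eqI[of _ "r + s"])
    (use assms cup_tuples in \<open>auto simp: cup_def B.cochains_mult C.cochains_mult A.cochain_closed
      B.cochain_closed pairing_mult_right\<close>, simp add: cochains_def)

lemma cup_one_left:
  assumes "g \<in> carrier (cochains G B s)"
  shows "cup G B p r s \<one>\<^bsub>cochains G A r\<^esub> g = \<one>\<^bsub>cochains G C (r + s)\<^esub>"
  by (rule C.cochain_eqI[of _ "r + s"])
    (use assms cup_tuples in \<open>auto simp: cup_def A.cochains_one C.cochains_one
      B.cochain_closed pairing_one_left\<close>, simp add: cochains_def)

lemma cup_one_right:
  assumes "f \<in> carrier (cochains G A r)"
  shows "cup G B p r s f \<one>\<^bsub>cochains G B s\<^esub> = \<one>\<^bsub>cochains G C (r + s)\<^esub>"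
  by (rule C.cochain_eqI[of _ "r + s"])
    (use assms cup_tuples in \<open>auto simp: cup_def B.cochains_one C.cochains_one
      A.cochain_closed pairing_one_right\<close>, simp add: cochains_def)

text \<open>Multiplying the base point by the product of the first r steps gives vertex r, which is
  the base point of the back face. This absorbs the twist x1...xr of the cup product.\<close>

lemma hmg_cup:
  assumes f: "f \<in> carrier (cochains G A r)" and g: "g \<in> carrier (cochains G B s)"
  shows "hmg G C (r + s) (cup G B p r s f g) = hcup C p r (hmg G A r f) (hmg G B s g)"
proof
  fix zs :: "'g list"
  show "hmg G C (r + s) (cup G B p r s f g) zs = hcup C p r (hmg G A r f) (hmg G B s g) zs"
  proof (cases "length zs = Suc (r + s)")
    case True
    let ?x = "steps G (r + s) zs"
    have 1: "restrict ?x {..<r} = steps G r (take (Suc r) zs)"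
      and 2: "(\<lambda>j\<in>{..<s}. ?x (r + j)) = steps G s (drop r zs)"
      using True by (auto simp: steps_def)
    have 3: "steps G r (take (Suc r) zs) \<in> tuples G r" "steps G s (drop r zs) \<in> tuples G s"
      "tuple_prod G ?x r \<in> carrier G"
      by (auto intro: A.tuple_prod_closed[of _ "r + s"])
    have 4: "clip G (zs ! 0) \<otimes> tuple_prod G ?x r = clip G (zs ! r)"
      by (rule A.tuple_prod_steps) simp
    have "hmg G C (r + s) (cup G B p r s f g) zs
        = act C (clip G (zs ! 0)) (p (f (steps G r (take (Suc r) zs)))
            (act B (tuple_prod G ?x r) (g (steps G s (drop r zs)))))"
      using True by (simp add: hmg_def cup_def 1 2)
    also have "\<dots> = p (act A (clip G (zs ! 0)) (f (steps G r (take (Suc r) zs))))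
        (act B (clip G (zs ! r)) (g (steps G s (drop r zs))))"
      using f g 3 by (simp add: act_pairing A.cochain_closed B.cochain_closed B.act_mult flip: 4)
    also have "\<dots> = hcup C p r (hmg G A r f) (hmg G B s g) zs"
      using True by (simp add: hcup_eq hmg_def)
    finally show ?thesis .
  next
    case False
    show ?thesis
    proof (cases "r < length zs")
      case True
      \<comment> \<open>The front face has the right length here, so the total length is wrong
        because of the back face, whose default value makes the pairing trivial.\<close>
      have "hmg G A r f (take (Suc r) zs) \<in> carrier A"
        using f by simp
      then show ?thesis
        using True False by (auto simp: hcup_eq hmg_def[of G B] hmg_def[of G C] pairing_one_right)
    qed (use False in \<open>simp add: hcup_short hmg_def\<close>)
  qed
qed

text \<open>Transfer of \<open>hcup_leibniz\<close>; its condition on the empty list holds because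
  \<open>hmg\<close> is neutral on lists of the wrong length.\<close>

lemma coboundary_cup:
  assumes f: "f \<in> carrier (cochains G A r)" and g: "g \<in> carrier (cochains G B s)"
  shows "coboundary G C (r + s) (cup G B p r s f g) =
    cup G B p (Suc r) s (coboundary G A r f) g \<otimes>\<^bsub>cochains G C (Suc (r + s))\<^esub>
    cup G B p r (Suc s) f (coboundary G B s g) [^]\<^bsub>cochains G C (Suc (r + s))\<^esub> ((-1) ^ r :: int)"
proof (rule C.hmg_inject)
  interpret K: comm_group "cochains G C (Suc (r + s))" by (rule C.comm_group_cochains)
  note cl = cup_closed[OF f g] A.coboundary_closed[OF f] B.coboundary_closed[OF g]
  have c1: "cup G B p (Suc r) s (coboundary G A r f) g \<in> carrier (cochains G C (Suc (r + s)))"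
    using cup_closed[OF cl(2) g] by simp
  have c2: "cup G B p r (Suc s) f (coboundary G B s g) \<in> carrier (cochains G C (Suc (r + s)))"
    using cup_closed[OF f cl(3)] by simp
  show "coboundary G C (r + s) (cup G B p r s f g) \<in> carrier (cochains G C (Suc (r + s)))"
    by (rule C.coboundary_closed[OF cl(1)])
  show "cup G B p (Suc r) s (coboundary G A r f) g \<otimes>\<^bsub>cochains G C (Suc (r + s))\<^esub>
      cup G B p r (Suc s) f (coboundary G B s g) [^]\<^bsub>cochains G C (Suc (r + s))\<^esub> ((-1) ^ r :: int)
      \<in> carrier (cochains G C (Suc (r + s)))"
    using c1 c2 by simp
  fix zs
  have h1: "hmg G C (Suc (r + s)) (cup G B p (Suc r) s (coboundary G A r f) g)
      = hcup C p (Suc r) (hdiff A (hmg G A r f)) (hmg G B s g)"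
    using hmg_cup[OF cl(2) g] by (simp add: A.hmg_coboundary[OF f])
  have h2: "hmg G C (Suc (r + s)) (cup G B p r (Suc s) f (coboundary G B s g))
      = hcup C p r (hmg G A r f) (hdiff B (hmg G B s g))"
    using hmg_cup[OF f cl(3)] by (simp add: B.hmg_coboundary[OF g])
  show "hmg G C (Suc (r + s)) (coboundary G C (r + s) (cup G B p r s f g)) zs =
    hmg G C (Suc (r + s)) (cup G B p (Suc r) s (coboundary G A r f) g \<otimes>\<^bsub>cochains G C (Suc (r + s))\<^esub>
      cup G B p r (Suc s) f (coboundary G B s g) [^]\<^bsub>cochains G C (Suc (r + s))\<^esub> ((-1) ^ r :: int)) zs"
    unfolding C.hmg_coboundary[OF cl(1)] hmg_cup[OF f g] C.hmg_mult[OF c1 K.int_pow_closed[OF c2]]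
      C.hmg_int_pow[OF c2] h1 h2
    by (rule hcup_leibniz)
      (auto simp: A.M.comm_group_axioms B.M.comm_group_axioms C.M.comm_group_axioms pairing_hom_left
        pairing_hom_right f g, simp add: hmg_def)
qed

end

section \<open>Cohomology classes\<close>

lemma cocycles_iff: "f \<in> cocycles G A r \<longleftrightarrow>
    f \<in> carrier (cochains G A r) \<and> coboundary G A r f = \<one>\<^bsub>cochains G A (Suc r)\<^esub>"
  by (simp add: cocycles_def kernel_def)

context discrete_gmodule
begin

lemma coboundary_group_hom:
  "group_hom (cochains G A r) (cochains G A (Suc r)) (coboundary G A r)"
  by (intro group_hom.intro group_hom_axioms.intro comm_group.axioms(2) comm_group_cochains coboundary_hom)

lemma subgroup_coboundaries: "subgroup (coboundaries G A r) (cochains G A r)"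
proof (cases r)
  case 0
  then show ?thesis
    using group.triv_subgroup[OF comm_group.axioms(2)[OF comm_group_cochains]]
    by (simp add: coboundaries_def)
next
  case (Suc q)
  then show ?thesis
    using group_hom.img_is_subgroup[OF coboundary_group_hom] by (simp add: coboundaries_def)
qed

lemma coboundaries_closed: "b \<in> coboundaries G A r \<Longrightarrow> b \<in> carrier (cochains G A r)"
  using subgroup.subset[OF subgroup_coboundaries] by blast

lemma one_coboundaries: "\<one>\<^bsub>cochains G A r\<^esub> \<in> coboundaries G A r"
  using subgroup.one_closed[OF subgroup_coboundaries] .

lemma coboundary_one: "coboundary G A r \<one>\<^bsub>cochains G A r\<^esub> = \<one>\<^bsub>cochains G A (Suc r)\<^esub>"
  using group_hom.hom_one[OF coboundary_group_hom] .

lemma coboundary_mult: "f \<in> carrier (cochains G A r) \<Longrightarrow> g \<in> carrier (cochains G A r) \<Longrightarrow>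
    coboundary G A r (f \<otimes>\<^bsub>cochains G A r\<^esub> g)
      = coboundary G A r f \<otimes>\<^bsub>cochains G A (Suc r)\<^esub> coboundary G A r g"
  using group_hom.hom_mult[OF coboundary_group_hom] .

lemma coboundary_coboundaries: "b \<in> coboundaries G A r \<Longrightarrow> coboundary G A r b = \<one>\<^bsub>cochains G A (Suc r)\<^esub>"
  by (cases r) (auto simp: coboundaries_def coboundary_one coboundary_coboundary)

lemma coh_class_eqI:
  assumes "f \<in> carrier (cochains G A r)" "b \<in> coboundaries G A r"
  shows "coh_class G A r (b \<otimes>\<^bsub>cochains G A r\<^esub> f) = coh_class G A r f"
proof -
  interpret K: comm_group "cochains G A r" by (rule comm_group_cochains)
  show ?thesis
    unfolding coh_class_def
    using assms K.coset_mult_assoc[of "coboundaries G A r" b f] K.coset_join2[OF _ subgroup_coboundaries]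
      subgroup.subset[OF subgroup_coboundaries, of r] coboundaries_closed
    by simp
qed

lemma coh_class_self: "f \<in> carrier (cochains G A r) \<Longrightarrow> f \<in> coh_class G A r f"
  unfolding coh_class_def
  by (rule group.rcos_self[OF comm_group.axioms(2)[OF comm_group_cochains] _ subgroup_coboundaries])

lemma coh_class_eqD:
  assumes "f \<in> carrier (cochains G A r)" "coh_class G A r f = coh_class G A r g"
  shows "\<exists>b\<in>coboundaries G A r. f = b \<otimes>\<^bsub>cochains G A r\<^esub> g"
  using coh_class_self[OF assms(1)] assms(2) by (auto simp: coh_class_def r_coset_def)

lemma carrier_cohomology: "carrier (cohomology G A r) = coh_class G A r ` cocycles G A r"
  by (auto simp: cohomology_def FactGroup_def RCOSETS_def r_coset_def coh_class_def)

text \<open>Controls the representative chosen by \<open>SOME\<close> in \<open>coh_push\<close> and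
  \<open>shapiro\<close>: it differs from any given one by a coboundary.\<close>

lemma someI_coh_class:
  assumes "f \<in> carrier (cochains G A r)"
  shows "\<exists>b\<in>coboundaries G A r. (SOME f'. f' \<in> coh_class G A r f) = b \<otimes>\<^bsub>cochains G A r\<^esub> f"
  using someI[of "\<lambda>f'. f' \<in> coh_class G A r f", OF coh_class_self[OF assms]]
  by (auto simp: coh_class_def r_coset_def)

end

text \<open>
  A homomorphism of modules that may at the same time restrict from \<open>G\<close> to a subgroup \<open>K\<close>;
  on cochains it acts by \<^const>\<open>push\<close>, which also shrinks the domain.
\<close>

locale gmodule_hom = A: discrete_gmodule G A + B: discrete_gmodule K B
  for G :: "'g topgroup" (structure) and K :: "'g topgroup"
    and A :: "('g, 'a) gmodule" and B :: "('g, 'b) gmodule" +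
  fixes \<phi> :: "'a \<Rightarrow> 'b"
  assumes carrier_subset: "carrier K \<subseteq> carrier G"
    and mult_eq: "mult K = mult G" and one_eq: "one K = one G"
    and continuous_inclusion: "continuous_map (gtop K) (gtop G) (\<lambda>x. x)"
    and hom: "\<phi> \<in> hom A B"
    and equivariant: "equivariant K A B \<phi>"
begin

lemma equivariantD: "g \<in> carrier K \<Longrightarrow> a \<in> carrier A \<Longrightarrow> \<phi> (act A g a) = act B g (\<phi> a)"
  using equivariant by (simp add: equivariant_def)

lemma hom_closed [simp]: "a \<in> carrier A \<Longrightarrow> \<phi> a \<in> carrier B"
  using hom by (auto simp: hom_def)

lemma map_mult: "a \<in> carrier A \<Longrightarrow> b \<in> carrier A \<Longrightarrow> \<phi> (a \<otimes>\<^bsub>A\<^esub> b) = \<phi> a \<otimes>\<^bsub>B\<^esub> \<phi> b"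
  using hom by (auto simp: hom_def)

lemma map_one [simp]: "\<phi> \<one>\<^bsub>A\<^esub> = \<one>\<^bsub>B\<^esub>"
  using hom_one[OF hom] by (simp add: A.M.group_axioms B.M.group_axioms)

lemma map_int_pow: "a \<in> carrier A \<Longrightarrow> \<phi> (a [^]\<^bsub>A\<^esub> (k::int)) = \<phi> a [^]\<^bsub>B\<^esub> k"
  using hom_int_pow[OF hom] by (simp add: A.M.group_axioms B.M.group_axioms)

lemma tuples_subset: "x \<in> tuples K r \<Longrightarrow> x \<in> tuples G r"
  using carrier_subset by (auto simp: tuples_def)

lemma merge_at_eq: "merge_at K = merge_at G"
  by (intro ext) (simp add: merge_at_def mult_eq)

lemma tuple_prod_eq: "tuple_prod K x n = tuple_prod G x n"
  by (induction n) (auto simp: mult_eq one_eq)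

lemma push_apply: "x \<in> tuples K r \<Longrightarrow> push K r \<phi> f x = \<phi> (f x)"
  by (simp add: push_def)

lemma push_closed:
  assumes f: "f \<in> carrier (cochains G A r)"
  shows "push K r \<phi> f \<in> carrier (cochains K B r)"
  unfolding push_def
proof (intro B.cochainI continuous_map_discrete_unop[where h = \<phi>])
  show "continuous_map (product_topology (\<lambda>_. gtop K) {..<r}) (discrete_topology (carrier A)) (\<lambda>x. f x)"
  proof (rule A.continuous_map_cochain[OF f])
    fix i assume "i < r"
    from continuous_map_compose[OF B.continuous_map_coordinate[OF this] continuous_inclusion]
    show "continuous_map (product_topology (\<lambda>_. gtop K) {..<r}) (gtop G) (\<lambda>x. x i)"
      by (simp add: o_def)
  qed (simp add: PiE_def)
qed simp

lemma push_mult: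
  assumes "f \<in> carrier (cochains G A r)" "g \<in> carrier (cochains G A r)"
  shows "push K r \<phi> (f \<otimes>\<^bsub>cochains G A r\<^esub> g) = push K r \<phi> f \<otimes>\<^bsub>cochains K B r\<^esub> push K r \<phi> g"
  by (rule B.cochain_eqI[of _ r])
    (use assms in \<open>auto simp: push_def A.cochains_mult B.cochains_mult tuples_subset
      A.cochain_closed map_mult\<close>, simp add: cochains_def)

lemma push_one: "push K r \<phi> \<one>\<^bsub>cochains G A r\<^esub> = \<one>\<^bsub>cochains K B r\<^esub>"
  by (rule B.cochain_eqI[of _ r])
    (auto simp: push_def A.cochains_one B.cochains_one tuples_subset, simp add: cochains_def)

lemma push_hom: "push K r \<phi> \<in> hom (cochains G A r) (cochains K B r)"
  by (intro homI push_closed push_mult)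

lemma push_int_pow:
  "f \<in> carrier (cochains G A r) \<Longrightarrow>
    push K r \<phi> (f [^]\<^bsub>cochains G A r\<^esub> (k::int)) = push K r \<phi> f [^]\<^bsub>cochains K B r\<^esub> k"
  using hom_int_pow[OF push_hom] A.comm_group_cochains B.comm_group_cochains
  by (simp add: comm_group.axioms)

lemma push_coboundary:
  assumes f: "f \<in> carrier (cochains G A r)"
  shows "push K (Suc r) \<phi> (coboundary G A r f) = coboundary K B r (push K r \<phi> f)"
proof (rule B.cochain_eqI[of _ "Suc r"])
  fix x assume xK: "x \<in> tuples K (Suc r)"
  then have x: "x \<in> tuples G (Suc r)" by (rule tuples_subset)
  have tK: "(\<lambda>j\<in>{..<r}. x (Suc j)) \<in> tuples K r" "restrict x {..<r} \<in> tuples K r"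
    using xK by (auto intro!: B.restrict_tuples simp: B.tuples_mem)
  have mK: "merge_at G r i x \<in> tuples K r" if "i < r" for i
    using B.merge_at_tuples[OF xK that] by (simp add: merge_at_eq)
  have c: "f (\<lambda>j\<in>{..<r}. x (Suc j)) \<in> carrier A" "f (restrict x {..<r}) \<in> carrier A"
    "i < r \<Longrightarrow> f (merge_at G r i x) \<in> carrier A" for i
    using A.cochain_closed[OF f] tK mK tuples_subset by auto
  have x0: "x 0 \<in> carrier K" "x 0 \<in> carrier G"
    using B.tuples_mem[OF xK] A.tuples_mem[OF x] by auto
  let ?P = "\<Otimes>\<^bsub>A\<^esub>i\<in>{..<r}. f (merge_at G r i x) [^]\<^bsub>A\<^esub> ((-1) ^ Suc i :: int)"
  have prod: "\<phi> ?P
      = (\<Otimes>\<^bsub>B\<^esub>i\<in>{..<r}. push K r \<phi> f (merge_at K r i x) [^]\<^bsub>B\<^esub> ((-1) ^ Suc i :: int))"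
    using c mK
    by (subst finprod_hom[OF A.M.comm_group_axioms B.M.comm_group_axioms hom])
      (auto intro!: B.M.finprod_cong' simp: map_int_pow push_apply merge_at_eq simp del: power_Suc)
  have cl: "?P \<in> carrier A"
    using c by (intro A.M.finprod_closed) auto
  show "push K (Suc r) \<phi> (coboundary G A r f) x = coboundary K B r (push K r \<phi> f) x"
    unfolding push_apply[OF xK] coboundary_def restrict_apply'[OF x] restrict_apply'[OF xK] prod[symmetric]
    using c cl x0 by (simp add: map_mult equivariantD push_apply tK map_int_pow del: power_Suc)
qed (use B.cochain_extensional[OF B.coboundary_closed[OF push_closed[OF f]]] in \<open>auto simp: push_def\<close>)

lemma push_cocycle: "f \<in> cocycles G A r \<Longrightarrow> push K r \<phi> f \<in> cocycles K B r"
  by (auto simp: cocycles_iff push_closed push_one simp flip: push_coboundary)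

lemma push_coboundaries: "b \<in> coboundaries G A r \<Longrightarrow> push K r \<phi> b \<in> coboundaries K B r"
  by (cases r) (auto simp: coboundaries_def push_one push_coboundary push_closed)

text \<open>Removes the choice of representative in \<open>coh_push\<close>, where K is G, and in
  \<open>shapiro\<close>, where K is the subgroup and \<phi> is evaluation at the unit.\<close>

lemma coh_class_push_some:
  assumes "f \<in> carrier (cochains G A r)"
  shows "coh_class K B r (push K r \<phi> (SOME f'. f' \<in> coh_class G A r f)) = coh_class K B r (push K r \<phi> f)"
  using A.someI_coh_class[OF assms] assms
  by (auto simp: push_mult A.coboundaries_closed push_coboundaries push_closed B.coh_class_eqI)

end

lemma coh_push_coh_class:
  assumes "gmodule_hom G G A B \<phi>" "f \<in> carrier (cochains G A r)"
  shows "coh_push G B r \<phi> (coh_class G A r f) = coh_class G B r (push G r \<phi> f)"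
  unfolding coh_push_def by (rule gmodule_hom.coh_class_push_some[OF assms])

section \<open>The augmented cup product\<close>

locale short_exact_sequence = topgrp G for G :: "'g topgroup" (structure) +
  fixes A' :: "('g, 'a1) gmodule" and A :: "('g, 'a) gmodule" and A'' :: "('g, 'a2) gmodule"
    and i :: "'a1 \<Rightarrow> 'a" and j :: "'a \<Rightarrow> 'a2"
  assumes short_exact: "short_exact G A' A A'' i j"
begin

sublocale sub: discrete_gmodule G A'
  using short_exact by unfold_locales (simp add: short_exact_def)

sublocale mid: discrete_gmodule G A
  using short_exact by unfold_locales (simp add: short_exact_def)

sublocale quot: discrete_gmodule G A''
  using short_exact by unfold_locales (simp add: short_exact_def)

sublocale i: gmodule_hom G G A' A i
  using short_exact by unfold_locales (auto simp: short_exact_def mon_def)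

sublocale j: gmodule_hom G G A A'' j
  using short_exact by unfold_locales (auto simp: short_exact_def epi_def)

lemma inj_i: "inj_on i (carrier A')"
  using short_exact by (auto simp: short_exact_def mon_def)

lemma j_i [simp]: "a \<in> carrier A' \<Longrightarrow> j (i a) = \<one>\<^bsub>A''\<^esub>"
  using short_exact by (auto simp: short_exact_def kernel_def)

lemma kernel_j: "a \<in> carrier A \<Longrightarrow> j a = \<one>\<^bsub>A''\<^esub> \<Longrightarrow> a \<in> i ` carrier A'"
  using short_exact by (auto simp: short_exact_def kernel_def)

lemma inv_i:
  assumes "a \<in> carrier A" "j a = \<one>\<^bsub>A''\<^esub>"
  shows "inv_into (carrier A') i a \<in> carrier A'" "i (inv_into (carrier A') i a) = a"
  using kernel_j[OF assms] by (auto intro: inv_into_into f_inv_into_f)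

lemma surj_j: "j ` carrier A = carrier A''"
  using short_exact by (auto simp: short_exact_def epi_def)

text \<open>Any set-theoretic section of \<open>j\<close> is continuous between discrete modules, so
  composing with it lifts continuous cochains.\<close>

lemma lift_cochain:
  assumes u: "u \<in> carrier (cochains G A'' r)"
  shows "\<exists>f\<in>carrier (cochains G A r). push G r j f = u"
proof
  let ?s = "inv_into (carrier A) j"
  have s: "?s a \<in> carrier A" "j (?s a) = a" if "a \<in> carrier A''" for a
    using that surj_j by (auto intro: inv_into_into f_inv_into_f)
  show "push G r ?s u \<in> carrier (cochains G A r)"
    unfolding push_def
    by (intro mid.cochainI continuous_map_discrete_unop[where h = ?s])
      (use u s in \<open>auto simp: cochains_def\<close>)
  show "push G r j (push G r ?s u) = u"
    by (rule quot.cochain_eqI[of _ r])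
      (use u s in \<open>auto simp: push_def quot.cochain_closed quot.cochain_extensional\<close>)
qed

lemma pull_closed:
  assumes f: "f \<in> carrier (cochains G A r)" and j: "push G r j f = \<one>\<^bsub>cochains G A'' r\<^esub>"
  shows "pull G r A' i f \<in> carrier (cochains G A' r)" "push G r i (pull G r A' i f) = f"
proof -
  let ?s = "inv_into (carrier A') i"
  have jf: "j (f x) = \<one>\<^bsub>A''\<^esub>" if "x \<in> tuples G r" for x
    using fun_cong[OF j, of x] that by (simp add: push_def quot.cochains_one)
  have fx: "f x \<in> carrier A" if "x \<in> tuples G r" for x
    using mid.cochain_closed[OF f that] .
  \<comment> \<open>\<open>inv_into\<close> lands in A' only on the image of \<open>i\<close>, so
    the codomain is cut down to that image before composing.\<close>
  have "continuous_map (product_topology (\<lambda>_. gtop G) {..<r})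
      (subtopology (discrete_topology (carrier A)) (i ` carrier A')) f"
    using f fx jf kernel_j
    by (auto simp: continuous_map_in_subtopology cochains_def tuples_def simp del: subtopology_discrete_topology)
  then have "continuous_map (product_topology (\<lambda>_. gtop G) {..<r}) (discrete_topology (carrier A')) (\<lambda>x. ?s (f x))"
    unfolding subtopology_discrete_topology
    by (rule continuous_map_discrete_unop) (auto intro: inv_into_into)
  then show "pull G r A' i f \<in> carrier (cochains G A' r)"
    unfolding pull_def push_def by (rule sub.cochainI)
  show "push G r i (pull G r A' i f) = f"
    by (rule mid.cochain_eqI[of _ r])
      (use fx jf f in \<open>auto simp: push_def pull_def inv_i mid.cochain_extensional\<close>)
qed

lemma push_i_inject:
  assumes f: "f \<in> carrier (cochains G A' r)" and g: "g \<in> carrier (cochains G A' r)"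
    and eq: "push G r i f = push G r i g"
  shows "f = g"
proof (rule sub.cochain_eqI[of _ r])
  fix x assume x: "x \<in> tuples G r"
  show "f x = g x"
    using fun_cong[OF eq, of x] inj_onD[OF inj_i] x
    by (simp add: push_def sub.cochain_closed[OF f] sub.cochain_closed[OF g])
qed (use f g sub.cochain_extensional in auto)

lemma push_j_push_i: "f \<in> carrier (cochains G A' r) \<Longrightarrow> push G r j (push G r i f) = \<one>\<^bsub>cochains G A'' r\<^esub>"
  by (rule quot.cochain_eqI[of _ r])
    (auto simp: push_def sub.cochain_closed quot.cochains_one, simp add: cochains_def)

definition liftable :: "nat \<Rightarrow> ((nat \<Rightarrow> 'g) \<Rightarrow> 'a) set" where
  "liftable r = {f \<in> carrier (cochains G A r). push G r j f \<in> cocycles G A'' r}"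

text \<open>
  The connecting map: \<open>f\<close> lifts a cocycle of the quotient, so its coboundary comes from the submodule.
\<close>

definition bdry :: "nat \<Rightarrow> ((nat \<Rightarrow> 'g) \<Rightarrow> 'a) \<Rightarrow> ((nat \<Rightarrow> 'g) \<Rightarrow> 'a1)" where
  "bdry r f = pull G (Suc r) A' i (coboundary G A r f)"

lemma liftable_closed: "f \<in> liftable r \<Longrightarrow> f \<in> carrier (cochains G A r)"
  by (simp add: liftable_def)

lemma push_j_coboundary:
  "f \<in> liftable r \<Longrightarrow> push G (Suc r) j (coboundary G A r f) = \<one>\<^bsub>cochains G A'' (Suc r)\<^esub>"
  by (simp add: liftable_def j.push_coboundary cocycles_iff)

lemma bdry_closed: "f \<in> liftable r \<Longrightarrow> bdry r f \<in> carrier (cochains G A' (Suc r))"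
  and push_bdry: "f \<in> liftable r \<Longrightarrow> push G (Suc r) i (bdry r f) = coboundary G A r f"
  using pull_closed[OF mid.coboundary_closed[OF liftable_closed] push_j_coboundary]
  by (auto simp: bdry_def)

lemma bdry_eqI:
  assumes "f \<in> liftable r" "w \<in> carrier (cochains G A' (Suc r))" "push G (Suc r) i w = coboundary G A r f"
  shows "bdry r f = w"
  using assms by (intro push_i_inject[of _ "Suc r"] bdry_closed) (auto simp: push_bdry)

text \<open>After applying the injective \<open>i\<close> it becomes the double coboundary of
  \<open>f\<close>.\<close>

lemma coboundary_bdry:
  assumes "f \<in> liftable r"
  shows "coboundary G A' (Suc r) (bdry r f) = \<one>\<^bsub>cochains G A' (Suc (Suc r))\<^esub>"
  using assms bdry_closed[OF assms]
  by (intro push_i_inject[of _ "Suc (Suc r)"])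
    (auto simp: sub.coboundary_closed i.push_coboundary push_bdry i.push_one mid.coboundary_coboundary
      liftable_closed sub.coboundaries_closed[OF sub.one_coboundaries])

lemma liftable_mult:
  assumes "f \<in> liftable r" "g \<in> liftable r"
  shows "f \<otimes>\<^bsub>cochains G A r\<^esub> g \<in> liftable r"
    "bdry r (f \<otimes>\<^bsub>cochains G A r\<^esub> g) = bdry r f \<otimes>\<^bsub>cochains G A' (Suc r)\<^esub> bdry r g"
proof -
  interpret K: comm_group "cochains G A r" by (rule mid.comm_group_cochains)
  interpret K': comm_group "cochains G A' (Suc r)" by (rule sub.comm_group_cochains)
  interpret Q: comm_group "cochains G A'' r" by (rule quot.comm_group_cochains)
  interpret Q1: comm_group "cochains G A'' (Suc r)" by (rule quot.comm_group_cochains)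
  show 1: "f \<otimes>\<^bsub>cochains G A r\<^esub> g \<in> liftable r"
    using assms by (auto simp: liftable_def j.push_mult cocycles_iff quot.coboundary_mult)
  show "bdry r (f \<otimes>\<^bsub>cochains G A r\<^esub> g) = bdry r f \<otimes>\<^bsub>cochains G A' (Suc r)\<^esub> bdry r g"
    using assms bdry_closed
    by (intro bdry_eqI[OF 1]) (auto simp: i.push_mult push_bdry mid.coboundary_mult liftable_closed)
qed

lemma liftable_coboundaries:
  assumes "e \<in> coboundaries G A r"
  shows "e \<in> liftable r" "bdry r e = \<one>\<^bsub>cochains G A' (Suc r)\<^esub>"
proof -
  show 1: "e \<in> liftable r"
    using assms quot.coboundary_coboundaries[OF j.push_coboundaries[OF assms]]
      quot.coboundaries_closed[OF j.push_coboundaries[OF assms]]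
    by (auto simp: liftable_def mid.coboundaries_closed cocycles_iff)
  show "bdry r e = \<one>\<^bsub>cochains G A' (Suc r)\<^esub>"
    using assms
    by (intro bdry_eqI[OF 1]) (auto simp: i.push_one mid.coboundary_coboundaries
        sub.coboundaries_closed[OF sub.one_coboundaries])
qed

lemma liftable_sub:
  assumes "f \<in> carrier (cochains G A' r)"
  shows "push G r i f \<in> liftable r" "bdry r (push G r i f) = coboundary G A' r f"
proof -
  show 1: "push G r i f \<in> liftable r"
    using assms by (auto simp: liftable_def i.push_closed push_j_push_i cocycles_iff quot.coboundary_one
        quot.coboundaries_closed[OF quot.one_coboundaries])
  show "bdry r (push G r i f) = coboundary G A' r f"
    using assms by (intro bdry_eqI[OF 1]) (auto simp: i.push_coboundary sub.coboundary_closed)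
qed

text \<open>Isolates the two ambiguities in the choice of a lift: a coboundary in A, and a cochain
  coming from A'. Independence of the lifts only has to be checked for these two.\<close>

lemma liftable_same_class:
  assumes f: "f \<in> liftable r" and g: "g \<in> liftable r"
    and eq: "coh_class G A'' r (push G r j f) = coh_class G A'' r (push G r j g)"
  shows "\<exists>e\<in>coboundaries G A r. \<exists>h\<in>carrier (cochains G A' r).
    f = e \<otimes>\<^bsub>cochains G A r\<^esub> (push G r i h \<otimes>\<^bsub>cochains G A r\<^esub> g)"
proof -
  interpret K: comm_group "cochains G A r" by (rule mid.comm_group_cochains)
  interpret Q: comm_group "cochains G A'' r" by (rule quot.comm_group_cochains)
  interpret j: group_hom "cochains G A r" "cochains G A'' r" "push G r j"
    by unfold_locales (rule j.push_hom)
  have fc: "f \<in> carrier (cochains G A r)" "g \<in> carrier (cochains G A r)"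
    using f g liftable_closed by auto
  obtain b where b: "b \<in> coboundaries G A'' r" and fb: "push G r j f = b \<otimes>\<^bsub>cochains G A'' r\<^esub> push G r j g"
    using quot.coh_class_eqD[OF j.push_closed[OF fc(1)] eq] by blast
  \<comment> \<open>A coboundary of A'' lifts to a coboundary of A: lift the cochain that it bounds.
    Degree 0 is separate, since there the only coboundary is the neutral cochain.\<close>
  obtain e where e: "e \<in> coboundaries G A r" and je: "push G r j e = b"
  proof (cases r)
    case 0
    with b have "b = \<one>\<^bsub>cochains G A'' r\<^esub>" by (simp add: coboundaries_def)
    then show ?thesis
      using that[OF mid.one_coboundaries] by (simp add: j.push_one)
  next
    case (Suc q)
    with b obtain u where u: "u \<in> carrier (cochains G A'' q)" "b = coboundary G A'' q u"
      by (auto simp: coboundaries_def)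
    obtain v where v: "v \<in> carrier (cochains G A q)" "push G q j v = u"
      using lift_cochain[OF u(1)] by blast
    show ?thesis
      by (rule that[of "coboundary G A q v"]) (use v u Suc in \<open>auto simp: coboundaries_def j.push_coboundary\<close>)
  qed
  have ec: "e \<in> carrier (cochains G A r)"
    using e by (rule mid.coboundaries_closed)
  \<comment> \<open>What is left of \<open>f\<close> after removing \<open>e\<close> and
    \<open>g\<close>; it dies in A'', hence comes from A'.\<close>
  define d where "d = inv\<^bsub>cochains G A r\<^esub> e \<otimes>\<^bsub>cochains G A r\<^esub> (f \<otimes>\<^bsub>cochains G A r\<^esub> inv\<^bsub>cochains G A r\<^esub> g)"
  have dc: "d \<in> carrier (cochains G A r)"
    using ec fc by (simp add: d_def)
  have "push G r j d = \<one>\<^bsub>cochains G A'' r\<^esub>"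
    using ec fc quot.coboundaries_closed[OF b] unfolding d_def
    by (simp add: j.hom_mult j.hom_inv je fb Q.m_assoc)
  then have h: "pull G r A' i d \<in> carrier (cochains G A' r)" "push G r i (pull G r A' i d) = d"
    using pull_closed[OF dc] by auto
  have "f = e \<otimes>\<^bsub>cochains G A r\<^esub> (d \<otimes>\<^bsub>cochains G A r\<^esub> g)"
    using ec fc by (simp add: d_def K.m_assoc K.mult_inv_cancel_0)
  with e h show ?thesis by metis
qed

end

section \<open>The augmented cup product and its independence of the lifts\<close>

locale tate = topgrp G for G :: "'g topgroup" (structure) +
  fixes P :: "('g, 'a1, 'a, 'a2, 'b1, 'b, 'b2, 'c) tate"
  assumes tate_product: "tate_product G P"
begin

sublocale A: short_exact_sequence G "A_sub P" "A_mid P" "A_quot P" "A_inj P" "A_proj P"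
  using tate_product by unfold_locales (simp add: tate_product_def)

sublocale B: short_exact_sequence G "B_sub P" "B_mid P" "B_quot P" "B_inj P" "B_proj P"
  using tate_product by unfold_locales (simp add: tate_product_def)

sublocale C: discrete_gmodule G "C_mod P"
  using tate_product by unfold_locales (simp add: tate_product_def)

sublocale p: gmodule_pairing G "A_sub P" "B_mid P" "C_mod P" "sub_mid P"
  using tate_product by unfold_locales (simp add: tate_product_def)

sublocale q: gmodule_pairing G "A_mid P" "B_sub P" "C_mod P" "mid_sub P"
  using tate_product by unfold_locales (simp add: tate_product_def)

lemma pairings_agree:
  "a \<in> carrier (A_sub P) \<Longrightarrow> b \<in> carrier (B_sub P) \<Longrightarrow> sub_mid P a (B_inj P b) = mid_sub P (A_inj P a) b"
  using tate_product by (simp add: tate_product_def)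

abbreviation CC :: "nat \<Rightarrow> ((nat \<Rightarrow> 'g) \<Rightarrow> 'c) monoid" where
  "CC n \<equiv> cochains G (C_mod P) n"

abbreviation cup_sub :: "nat \<Rightarrow> nat \<Rightarrow> ((nat \<Rightarrow> 'g) \<Rightarrow> 'a1) \<Rightarrow> ((nat \<Rightarrow> 'g) \<Rightarrow> 'b) \<Rightarrow> (nat \<Rightarrow> 'g) \<Rightarrow> 'c" where
  "cup_sub r s \<equiv> cup G (B_mid P) (sub_mid P) r s"

abbreviation cup_mid :: "nat \<Rightarrow> nat \<Rightarrow> ((nat \<Rightarrow> 'g) \<Rightarrow> 'a) \<Rightarrow> ((nat \<Rightarrow> 'g) \<Rightarrow> 'b1) \<Rightarrow> (nat \<Rightarrow> 'g) \<Rightarrow> 'c" where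
  "cup_mid r s \<equiv> cup G (B_sub P) (mid_sub P) r s"

text \<open>The cochain whose class \<open>aug_cup\<close> takes, for two explicitly given
  lifts.\<close>

definition aug :: "nat \<Rightarrow> nat \<Rightarrow> ((nat \<Rightarrow> 'g) \<Rightarrow> 'a) \<Rightarrow> ((nat \<Rightarrow> 'g) \<Rightarrow> 'b) \<Rightarrow> (nat \<Rightarrow> 'g) \<Rightarrow> 'c" where
  "aug r s f g = cup_sub (Suc r) s (A.bdry r f) g \<otimes>\<^bsub>CC (Suc (r + s))\<^esub>
     cup_mid r (Suc s) f (B.bdry s g) [^]\<^bsub>CC (Suc (r + s))\<^esub> ((-1) ^ r :: int)"

lemma cup_sub_closed:
  "f \<in> A.liftable r \<Longrightarrow> g \<in> B.liftable s \<Longrightarrow> cup_sub (Suc r) s (A.bdry r f) g \<in> carrier (CC (Suc (r + s)))"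
  using p.cup_closed[OF A.bdry_closed B.liftable_closed] by simp

lemma cup_mid_closed:
  "f \<in> A.liftable r \<Longrightarrow> g \<in> B.liftable s \<Longrightarrow> cup_mid r (Suc s) f (B.bdry s g) \<in> carrier (CC (Suc (r + s)))"
  using q.cup_closed[OF A.liftable_closed B.bdry_closed] by simp

text \<open>Agreement of the two pairings on A' \<times> B', on cochains. It allows the two halves
  of \<open>aug\<close> to be compared although they use different pairings.\<close>

lemma cup_sub_eq_cup_mid:
  assumes f: "f \<in> carrier (cochains G (A_sub P) r)" and g: "g \<in> carrier (cochains G (B_sub P) s)"
  shows "cup_sub r s f (push G s (B_inj P) g) = cup_mid r s (push G r (A_inj P) f) g"
  unfolding cup_def
proof (rule restrict_ext)
  fix x assume x: "x \<in> tuples G (r + s)"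
  show "sub_mid P (f (restrict x {..<r})) (act (B_mid P) (tuple_prod G x r)
       (push G s (B_inj P) g (\<lambda>j\<in>{..<s}. x (r + j)))) =
    mid_sub P (push G r (A_inj P) f (restrict x {..<r})) (act (B_sub P) (tuple_prod G x r)
       (g (\<lambda>j\<in>{..<s}. x (r + j))))"
    using p.cup_tuples[OF x] A.sub.cochain_closed[OF f] B.sub.cochain_closed[OF g]
    by (simp add: push_def pairings_agree flip: B.i.equivariantD)
qed

lemma sign_cancel: "x \<in> carrier (CC n) \<Longrightarrow> (x [^]\<^bsub>CC n\<^esub> ((-1) ^ r :: int)) [^]\<^bsub>CC n\<^esub> ((-1) ^ r :: int) = x"
  using group.int_pow_pow[OF comm_group.axioms(2)[OF C.comm_group_cochains], of x n]
    group.int_pow_1[OF comm_group.axioms(2)[OF C.comm_group_cochains], of x n]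
  by (simp flip: power_add)

lemma aug_closed:
  assumes "f \<in> A.liftable r" "g \<in> B.liftable s"
  shows "aug r s f g \<in> carrier (CC (Suc (r + s)))"
proof -
  interpret K: comm_group "CC (Suc (r + s))" by (rule C.comm_group_cochains)
  show ?thesis
    unfolding aug_def using cup_sub_closed[OF assms] cup_mid_closed[OF assms] by simp
qed

text \<open>With w = df \<union> dg, the Leibniz rule and vanishing double coboundaries give
  (-1)^(r+1) w for the coboundary of the first half. The second half yields w, which carries the
  sign (-1)^r in \<open>aug\<close>, so the two cancel.\<close>

lemma aug_cocycle:
  assumes f: "f \<in> A.liftable r" and g: "g \<in> B.liftable s"
  shows "aug r s f g \<in> cocycles G (C_mod P) (Suc (r + s))"
  unfolding cocycles_iff
proof
  interpret K: comm_group "CC (Suc (r + s))" by (rule C.comm_group_cochains)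
  interpret K': comm_group "CC (Suc (Suc (r + s)))" by (rule C.comm_group_cochains)
  interpret d: group_hom "CC (Suc (r + s))" "CC (Suc (Suc (r + s)))" "coboundary G (C_mod P) (Suc (r + s))"
    by (rule C.coboundary_group_hom)
  show "aug r s f g \<in> carrier (CC (Suc (r + s)))"
    by (rule aug_closed[OF f g])
  let ?w = "cup_mid (Suc r) (Suc s) (coboundary G (A_mid P) r f) (B.bdry s g)"
  have w: "?w \<in> carrier (CC (Suc (Suc (r + s))))"
    using q.cup_closed[OF A.mid.coboundary_closed[OF A.liftable_closed[OF f]] B.bdry_closed[OF g]] by simp
  have dsub: "coboundary G (C_mod P) (Suc (r + s)) (cup_sub (Suc r) s (A.bdry r f) g)
      = ?w [^]\<^bsub>CC (Suc (Suc (r + s)))\<^esub> ((-1) ^ Suc r :: int)"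
  proof -
    have "coboundary G (C_mod P) (Suc (r + s)) (cup_sub (Suc r) s (A.bdry r f) g)
      = \<one>\<^bsub>CC (Suc (Suc (r + s)))\<^esub> \<otimes>\<^bsub>CC (Suc (Suc (r + s)))\<^esub>
        cup_sub (Suc r) (Suc s) (A.bdry r f) (coboundary G (B_mid P) s g)
          [^]\<^bsub>CC (Suc (Suc (r + s)))\<^esub> ((-1) ^ Suc r :: int)"
      using p.coboundary_cup[OF A.bdry_closed[OF f] B.liftable_closed[OF g]]
        p.cup_one_left[OF B.liftable_closed[OF g], of "Suc (Suc r)"]
      by (simp add: A.coboundary_bdry[OF f])
    also have "cup_sub (Suc r) (Suc s) (A.bdry r f) (coboundary G (B_mid P) s g) = ?w"
      using cup_sub_eq_cup_mid[OF A.bdry_closed[OF f] B.bdry_closed[OF g]] A.push_bdry[OF f] B.push_bdry[OF g]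
      by simp
    finally show ?thesis
      using w by simp
  qed
  have dmid: "coboundary G (C_mod P) (Suc (r + s)) (cup_mid r (Suc s) f (B.bdry s g)) = ?w"
  proof -
    have "coboundary G (C_mod P) (Suc (r + s)) (cup_mid r (Suc s) f (B.bdry s g))
      = ?w \<otimes>\<^bsub>CC (Suc (Suc (r + s)))\<^esub> \<one>\<^bsub>CC (Suc (Suc (r + s)))\<^esub> [^]\<^bsub>CC (Suc (Suc (r + s)))\<^esub> ((-1) ^ r :: int)"
      using q.coboundary_cup[OF A.liftable_closed[OF f] B.bdry_closed[OF g]]
        q.cup_one_right[OF A.liftable_closed[OF f], of "Suc (Suc s)"]
      by (simp add: B.coboundary_bdry[OF g])
    then show ?thesis
      using w by simp
  qed
  show "coboundary G (C_mod P) (Suc (r + s)) (aug r s f g) = \<one>\<^bsub>CC (Suc (Suc (r + s)))\<^esub>"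
    unfolding aug_def
    using w cup_sub_closed[OF f g] cup_mid_closed[OF f g]
    by (simp add: d.hom_mult d.hom_int_pow dsub dmid K'.int_pow_neg)
qed

lemma aug_mult_left:
  assumes f: "f \<in> A.liftable r" "f' \<in> A.liftable r" and g: "g \<in> B.liftable s"
  shows "aug r s (f \<otimes>\<^bsub>cochains G (A_mid P) r\<^esub> f') g
    = aug r s f g \<otimes>\<^bsub>CC (Suc (r + s))\<^esub> aug r s f' g"
proof -
  interpret K: comm_group "CC (Suc (r + s))" by (rule C.comm_group_cochains)
  note cl = cup_sub_closed[OF f(1) g] cup_mid_closed[OF f(1) g] cup_sub_closed[OF f(2) g] cup_mid_closed[OF f(2) g]
  show ?thesis
    unfolding aug_def
    using p.cup_mult_left[OF A.bdry_closed[OF f(1)] A.bdry_closed[OF f(2)] B.liftable_closed[OF g]]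
      q.cup_mult_left[OF A.liftable_closed[OF f(1)] A.liftable_closed[OF f(2)] B.bdry_closed[OF g]] cl
    by (simp add: A.liftable_mult[OF f] K.int_pow_distrib K.m_ac)
qed

lemma aug_mult_right:
  assumes f: "f \<in> A.liftable r" and g: "g \<in> B.liftable s" "g' \<in> B.liftable s"
  shows "aug r s f (g \<otimes>\<^bsub>cochains G (B_mid P) s\<^esub> g')
    = aug r s f g \<otimes>\<^bsub>CC (Suc (r + s))\<^esub> aug r s f g'"
proof -
  interpret K: comm_group "CC (Suc (r + s))" by (rule C.comm_group_cochains)
  note cl = cup_sub_closed[OF f g(1)] cup_mid_closed[OF f g(1)] cup_sub_closed[OF f g(2)] cup_mid_closed[OF f g(2)]
  show ?thesis
    unfolding aug_def
    using p.cup_mult_right[OF A.bdry_closed[OF f] B.liftable_closed[OF g(1)] B.liftable_closed[OF g(2)]]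
      q.cup_mult_right[OF A.liftable_closed[OF f] B.bdry_closed[OF g(1)] B.bdry_closed[OF g(2)]] cl
    by (simp add: B.liftable_mult[OF g] K.int_pow_distrib K.m_ac)
qed

lemma coboundaries_SucI: "w \<in> carrier (CC n) \<Longrightarrow> coboundary G (C_mod P) n w \<in> coboundaries G (C_mod P) (Suc n)"
  by (simp add: coboundaries_def)

lemma coboundaries_int_pow:
  "b \<in> coboundaries G (C_mod P) n \<Longrightarrow> b [^]\<^bsub>CC n\<^esub> (k::int) \<in> coboundaries G (C_mod P) n"
  by (rule group.subgroup_int_pow_closed[OF comm_group.axioms(2)[OF C.comm_group_cochains] C.subgroup_coboundaries])

text \<open>For a lift i(h) the connecting map is dh, and the two halves of \<open>aug\<close> are
  the two Leibniz terms of d(h \<union> g).\<close>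

lemma aug_sub_left:
  assumes h: "h \<in> carrier (cochains G (A_sub P) r)" and g: "g \<in> B.liftable s"
  shows "aug r s (push G r (A_inj P) h) g \<in> coboundaries G (C_mod P) (Suc (r + s))"
proof -
  have "cup_mid r (Suc s) (push G r (A_inj P) h) (B.bdry s g)
      = cup_sub r (Suc s) h (coboundary G (B_mid P) s g)"
    using cup_sub_eq_cup_mid[OF h B.bdry_closed[OF g]] by (simp add: B.push_bdry[OF g])
  then have "aug r s (push G r (A_inj P) h) g = coboundary G (C_mod P) (r + s) (cup_sub r s h g)"
    unfolding aug_def p.coboundary_cup[OF h B.liftable_closed[OF g]] by (simp add: A.liftable_sub[OF h])
  then show ?thesis
    using coboundaries_SucI[OF p.cup_closed[OF h B.liftable_closed[OF g]]] by simp
qed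

lemma aug_sub_right:
  assumes f: "f \<in> A.liftable r" and h: "h \<in> carrier (cochains G (B_sub P) s)"
  shows "aug r s f (push G s (B_inj P) h) \<in> coboundaries G (C_mod P) (Suc (r + s))"
proof -
  have "cup_sub (Suc r) s (A.bdry r f) (push G s (B_inj P) h)
      = cup_mid (Suc r) s (coboundary G (A_mid P) r f) h"
    using cup_sub_eq_cup_mid[OF A.bdry_closed[OF f] h] by (simp add: A.push_bdry[OF f])
  then have "aug r s f (push G s (B_inj P) h) = coboundary G (C_mod P) (r + s) (cup_mid r s f h)"
    unfolding aug_def q.coboundary_cup[OF A.liftable_closed[OF f] h] by (simp add: B.liftable_sub[OF h])
  then show ?thesis
    using coboundaries_SucI[OF q.cup_closed[OF A.liftable_closed[OF f] h]] by simp
qed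

text \<open>The first half vanishes since the connecting map kills \<open>e\<close>. In the second,
  if e = du, then du \<union> dg = d(u \<union> dg) because ddg vanishes; in degree 0
  \<open>e\<close> itself is trivial.\<close>

lemma aug_coboundary_left:
  assumes e: "e \<in> coboundaries G (A_mid P) r" and g: "g \<in> B.liftable s"
  shows "aug r s e g \<in> coboundaries G (C_mod P) (Suc (r + s))"
proof -
  interpret K: comm_group "CC (Suc (r + s))" by (rule C.comm_group_cochains)
  have 1: "cup_sub (Suc r) s (A.bdry r e) g = \<one>\<^bsub>CC (Suc (r + s))\<^esub>"
    using p.cup_one_left[OF B.liftable_closed[OF g], of "Suc r"] by (simp add: A.liftable_coboundaries[OF e])
  have 2: "cup_mid r (Suc s) e (B.bdry s g) \<in> coboundaries G (C_mod P) (Suc (r + s))"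
  proof (cases r)
    case 0
    then show ?thesis
      using e q.cup_one_left[OF B.bdry_closed[OF g], of 0] C.one_coboundaries[of "Suc s"]
      by (simp add: coboundaries_def)
  next
    case (Suc k)
    with e obtain u where u: "u \<in> carrier (cochains G (A_mid P) k)" "e = coboundary G (A_mid P) k u"
      by (auto simp: coboundaries_def)
    interpret K: comm_group "CC (Suc (Suc (k + s)))" by (rule C.comm_group_cochains)
    have "cup_mid (Suc k) (Suc s) e (B.bdry s g) \<in> carrier (CC (Suc (Suc (k + s))))"
      using q.cup_closed[OF A.mid.coboundary_closed[OF u(1)] B.bdry_closed[OF g]] u(2) by simp
    then have "coboundary G (C_mod P) (k + Suc s) (cup_mid k (Suc s) u (B.bdry s g))
        = cup_mid (Suc k) (Suc s) e (B.bdry s g)"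
      using q.coboundary_cup[OF u(1) B.bdry_closed[OF g]] q.cup_one_right[OF u(1), of "Suc (Suc s)"]
      by (simp add: B.coboundary_bdry[OF g] u(2))
    then show ?thesis
      using coboundaries_SucI[OF q.cup_closed[OF u(1) B.bdry_closed[OF g]]] Suc by simp
  qed
  show ?thesis
    unfolding aug_def 1 using coboundaries_int_pow[OF 2, of "(-1) ^ r"]
      C.coboundaries_closed[OF 2] by simp
qed

text \<open>Mirror image of the previous case, with df \<union> dv = d(df \<union> v) up to the sign
  (-1)^(r+1), df being of degree r+1.\<close>

lemma aug_coboundary_right:
  assumes f: "f \<in> A.liftable r" and e: "e \<in> coboundaries G (B_mid P) s"
  shows "aug r s f e \<in> coboundaries G (C_mod P) (Suc (r + s))"
proof -
  interpret K: comm_group "CC (Suc (r + s))" by (rule C.comm_group_cochains)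
  have 1: "cup_mid r (Suc s) f (B.bdry s e) = \<one>\<^bsub>CC (Suc (r + s))\<^esub>"
    using q.cup_one_right[OF A.liftable_closed[OF f], of "Suc s"] by (simp add: B.liftable_coboundaries[OF e])
  have 2: "cup_sub (Suc r) s (A.bdry r f) e \<in> coboundaries G (C_mod P) (Suc (r + s))"
  proof (cases s)
    case 0
    then show ?thesis
      using e p.cup_one_right[OF A.bdry_closed[OF f], of 0] C.one_coboundaries[of "Suc r"]
      by (simp add: coboundaries_def)
  next
    case (Suc k)
    with e obtain v where v: "v \<in> carrier (cochains G (B_mid P) k)" "e = coboundary G (B_mid P) k v"
      by (auto simp: coboundaries_def)
    interpret K: comm_group "CC (Suc (Suc (r + k)))" by (rule C.comm_group_cochains)
    have cl: "cup_sub (Suc r) (Suc k) (A.bdry r f) e \<in> carrier (CC (Suc (Suc (r + k))))"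
      using p.cup_closed[OF A.bdry_closed[OF f] B.mid.coboundary_closed[OF v(1)]] v(2) by simp
    have "coboundary G (C_mod P) (Suc r + k) (cup_sub (Suc r) k (A.bdry r f) v)
        = cup_sub (Suc r) (Suc k) (A.bdry r f) e [^]\<^bsub>CC (Suc (Suc (r + k)))\<^esub> ((-1) ^ Suc r :: int)"
      using p.coboundary_cup[OF A.bdry_closed[OF f] v(1)] p.cup_one_left[OF v(1), of "Suc (Suc r)"] cl
      by (simp add: A.coboundary_bdry[OF f] v(2))
    \<comment> \<open>A power with exponent (-1)^k is its own inverse, so the sign can be moved to
      the other side.\<close>
    then have "cup_sub (Suc r) (Suc k) (A.bdry r f) e
        = coboundary G (C_mod P) (Suc r + k) (cup_sub (Suc r) k (A.bdry r f) v)
          [^]\<^bsub>CC (Suc (Suc (r + k)))\<^esub> ((-1) ^ Suc r :: int)"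
      using sign_cancel[OF cl, of "Suc r"] by simp
    then show ?thesis
      using coboundaries_int_pow[OF coboundaries_SucI[OF p.cup_closed[OF A.bdry_closed[OF f] v(1)]], of "(-1) ^ Suc r"] Suc
      by simp
  qed
  show ?thesis
    unfolding aug_def 1 using 2 C.coboundaries_closed[OF 2] by simp
qed

text \<open>First \<open>f\<close> is replaced with \<open>g\<close> fixed, then \<open>g\<close>
  with \<open>f'\<close> fixed. By bilinearity each replacement splits off two corrections, both of
  which are coboundaries.\<close>

lemma coh_class_aug_eqI:
  assumes f: "f \<in> A.liftable r" "f' \<in> A.liftable r" and g: "g \<in> B.liftable s" "g' \<in> B.liftable s"
    and eq: "coh_class G (A_quot P) r (push G r (A_proj P) f) = coh_class G (A_quot P) r (push G r (A_proj P) f')"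
      "coh_class G (B_quot P) s (push G s (B_proj P) g) = coh_class G (B_quot P) s (push G s (B_proj P) g')"
  shows "coh_class G (C_mod P) (Suc (r + s)) (aug r s f g) = coh_class G (C_mod P) (Suc (r + s)) (aug r s f' g')"
proof -
  interpret K: comm_group "CC (Suc (r + s))" by (rule C.comm_group_cochains)
  obtain e h where e: "e \<in> coboundaries G (A_mid P) r" and h: "h \<in> carrier (cochains G (A_sub P) r)"
    and feq: "f = e \<otimes>\<^bsub>cochains G (A_mid P) r\<^esub> (push G r (A_inj P) h \<otimes>\<^bsub>cochains G (A_mid P) r\<^esub> f')"
    using A.liftable_same_class[OF f eq(1)] by blast
  obtain u k where u: "u \<in> coboundaries G (B_mid P) s" and k: "k \<in> carrier (cochains G (B_sub P) s)"
    and geq: "g = u \<otimes>\<^bsub>cochains G (B_mid P) s\<^esub> (push G s (B_inj P) k \<otimes>\<^bsub>cochains G (B_mid P) s\<^esub> g')"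
    using B.liftable_same_class[OF g eq(2)] by blast
  have 1: "aug r s f g = aug r s e g \<otimes>\<^bsub>CC (Suc (r + s))\<^esub>
      (aug r s (push G r (A_inj P) h) g \<otimes>\<^bsub>CC (Suc (r + s))\<^esub> aug r s f' g)"
    using A.liftable_coboundaries(1)[OF e] A.liftable_sub(1)[OF h] f g A.liftable_mult(1)
    by (subst feq) (simp add: aug_mult_left)
  have 2: "aug r s f' g = aug r s f' u \<otimes>\<^bsub>CC (Suc (r + s))\<^esub>
      (aug r s f' (push G s (B_inj P) k) \<otimes>\<^bsub>CC (Suc (r + s))\<^esub> aug r s f' g')"
    using B.liftable_coboundaries(1)[OF u] B.liftable_sub(1)[OF k] f g B.liftable_mult(1)
    by (subst geq) (simp add: aug_mult_right)
  have "coh_class G (C_mod P) (Suc (r + s)) (aug r s f g) = coh_class G (C_mod P) (Suc (r + s)) (aug r s f' g)"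
    unfolding 1 using aug_coboundary_left[OF e g(1)] aug_sub_left[OF h g(1)] aug_closed[OF f(2) g(1)]
      C.coboundaries_closed by (simp add: C.coh_class_eqI)
  also have "\<dots> = coh_class G (C_mod P) (Suc (r + s)) (aug r s f' g')"
    unfolding 2 using aug_coboundary_right[OF f(2) u] aug_sub_right[OF f(2) k] aug_closed[OF f(2) g(2)]
      C.coboundaries_closed by (simp add: C.coh_class_eqI)
  finally show ?thesis .
qed

text \<open>Evaluates \<open>aug_cup\<close> on lifts of one's own choice; from here on its
  \<open>SOME\<close> never has to be inspected.\<close>

lemma aug_cup_coh_class:
  assumes f: "f \<in> A.liftable r" and g: "g \<in> B.liftable s"
  shows "aug_cup G P r s (coh_class G (A_quot P) r (push G r (A_proj P) f))
      (coh_class G (B_quot P) s (push G s (B_proj P) g))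
    = coh_class G (C_mod P) (Suc (r + s)) (aug r s f g)"
proof -
  define f' where "f' = (SOME f'. lifts G (A_mid P) (A_quot P) (A_proj P) r
    (coh_class G (A_quot P) r (push G r (A_proj P) f)) f')"
  define g' where "g' = (SOME g'. lifts G (B_mid P) (B_quot P) (B_proj P) s
    (coh_class G (B_quot P) s (push G s (B_proj P) g)) g')"
  have "lifts G (A_mid P) (A_quot P) (A_proj P) r (coh_class G (A_quot P) r (push G r (A_proj P) f)) f'"
    unfolding f'_def by (rule someI[of _ f]) (use f in \<open>simp add: lifts_def A.liftable_def\<close>)
  then have f': "f' \<in> A.liftable r"
    "coh_class G (A_quot P) r (push G r (A_proj P) f') = coh_class G (A_quot P) r (push G r (A_proj P) f)"
    by (auto simp: lifts_def A.liftable_def)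
  have "lifts G (B_mid P) (B_quot P) (B_proj P) s (coh_class G (B_quot P) s (push G s (B_proj P) g)) g'"
    unfolding g'_def by (rule someI[of _ g]) (use g in \<open>simp add: lifts_def B.liftable_def\<close>)
  then have g': "g' \<in> B.liftable s"
    "coh_class G (B_quot P) s (push G s (B_proj P) g') = coh_class G (B_quot P) s (push G s (B_proj P) g)"
    by (auto simp: lifts_def B.liftable_def)
  have "aug_cup G P r s (coh_class G (A_quot P) r (push G r (A_proj P) f))
      (coh_class G (B_quot P) s (push G s (B_proj P) g))
    = coh_class G (C_mod P) (Suc (r + s)) (aug r s f' g')"
    by (simp add: aug_cup_def Let_def aug_def A.bdry_def B.bdry_def flip: f'_def g'_def)
  also have "\<dots> = coh_class G (C_mod P) (Suc (r + s)) (aug r s f g)"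
    by (rule coh_class_aug_eqI) (use f g f' g' in auto)
  finally show ?thesis .
qed

end

section \<open>Morphisms of Tate products, possibly along the inclusion of a subgroup\<close>

locale tate_hom = P: tate G P + Q: tate K Q
  for G :: "'g topgroup" (structure) and K :: "'g topgroup"
    and P :: "('g, 'a1, 'a, 'a2, 'b1, 'b, 'b2, 'c) tate"
    and Q :: "('g, 'd1, 'd, 'd2, 'e1, 'e, 'e2, 'f) tate" +
  fixes \<alpha>' \<alpha> \<alpha>'' \<beta>' \<beta> \<beta>'' \<gamma>
  assumes A_sub_hom: "gmodule_hom G K (A_sub P) (A_sub Q) \<alpha>'"
    and A_mid_hom: "gmodule_hom G K (A_mid P) (A_mid Q) \<alpha>"
    and A_quot_hom: "gmodule_hom G K (A_quot P) (A_quot Q) \<alpha>''"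
    and B_sub_hom: "gmodule_hom G K (B_sub P) (B_sub Q) \<beta>'"
    and B_mid_hom: "gmodule_hom G K (B_mid P) (B_mid Q) \<beta>"
    and B_quot_hom: "gmodule_hom G K (B_quot P) (B_quot Q) \<beta>''"
    and C_hom: "gmodule_hom G K (C_mod P) (C_mod Q) \<gamma>"
    and A_inj_hom: "a1 \<in> carrier (A_sub P) \<Longrightarrow> A_inj Q (\<alpha>' a1) = \<alpha> (A_inj P a1)"
    and A_proj_hom: "a \<in> carrier (A_mid P) \<Longrightarrow> A_proj Q (\<alpha> a) = \<alpha>'' (A_proj P a)"
    and B_inj_hom: "b1 \<in> carrier (B_sub P) \<Longrightarrow> B_inj Q (\<beta>' b1) = \<beta> (B_inj P b1)"
    and B_proj_hom: "b \<in> carrier (B_mid P) \<Longrightarrow> B_proj Q (\<beta> b) = \<beta>'' (B_proj P b)"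
    and sub_mid_hom: "a1 \<in> carrier (A_sub P) \<Longrightarrow> b \<in> carrier (B_mid P) \<Longrightarrow>
      \<gamma> (sub_mid P a1 b) = sub_mid Q (\<alpha>' a1) (\<beta> b)"
    and mid_sub_hom: "a \<in> carrier (A_mid P) \<Longrightarrow> b1 \<in> carrier (B_sub P) \<Longrightarrow>
      \<gamma> (mid_sub P a b1) = mid_sub Q (\<alpha> a) (\<beta>' b1)"
begin

text \<open>Equivariance over K suffices although f and g live over G: after restriction to tuples
  in K the twisting product of entries lies in K.\<close>

lemma push_cup:
  assumes "gmodule_pairing G A B C p" "gmodule_hom G K A A2 \<phi>" "gmodule_hom G K B B2 \<psi>"
    and "f \<in> carrier (cochains G A r)" "g \<in> carrier (cochains G B s)"
    and "\<And>a b. a \<in> carrier A \<Longrightarrow> b \<in> carrier B \<Longrightarrow> \<gamma> (p a b) = p2 (\<phi> a) (\<psi> b)"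
  shows "push K (r + s) \<gamma> (cup G B p r s f g) = cup K B2 p2 r s (push K r \<phi> f) (push K s \<psi> g)"
proof -
  interpret p: gmodule_pairing G A B C p by fact
  interpret \<phi>: gmodule_hom G K A A2 \<phi> by fact
  interpret \<psi>: gmodule_hom G K B B2 \<psi> by fact
  have "\<gamma> (cup G B p r s f g x) = cup K B2 p2 r s (push K r \<phi> f) (push K s \<psi> g) x"
    if x: "x \<in> tuples K (r + s)" for x
  proof -
    have t: "restrict x {..<r} \<in> tuples K r" "(\<lambda>j\<in>{..<s}. x (r + j)) \<in> tuples K s"
        "tuple_prod K x r \<in> carrier K"
      using x by (auto intro!: Q.restrict_tuples Q.tuples_mem[of x "r + s"] Q.tuple_prod_closed)
    then have t': "tuple_prod G x r \<in> carrier G" "tuple_prod G x r \<in> carrier K"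
      using \<phi>.carrier_subset by (auto simp: \<phi>.tuple_prod_eq)
    show ?thesis
      using x t t' assms(4-6)
      by (simp add: cup_def push_def \<phi>.tuples_subset p.A.cochain_closed p.B.cochain_closed
          \<psi>.equivariantD \<phi>.tuple_prod_eq)
  qed
  then show ?thesis
    by (auto simp: push_def fun_eq_iff cup_def)
qed

lemma push_liftable_A: "f \<in> P.A.liftable r \<Longrightarrow> push K r \<alpha> f \<in> Q.A.liftable r"
  and push_A_proj: "f \<in> P.A.liftable r \<Longrightarrow>
    push K r (A_proj Q) (push K r \<alpha> f) = push K r \<alpha>'' (push G r (A_proj P) f)"
proof -
  interpret \<alpha>: gmodule_hom G K "A_mid P" "A_mid Q" \<alpha> by (rule A_mid_hom)
  interpret \<alpha>'': gmodule_hom G K "A_quot P" "A_quot Q" \<alpha>'' by (rule A_quot_hom)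
  assume f: "f \<in> P.A.liftable r"
  then show eq: "push K r (A_proj Q) (push K r \<alpha> f) = push K r \<alpha>'' (push G r (A_proj P) f)"
    using P.A.mid.cochain_closed[OF P.A.liftable_closed[OF f]]
    by (auto simp: push_def \<alpha>.tuples_subset A_proj_hom)
  show "push K r \<alpha> f \<in> Q.A.liftable r"
    using f \<alpha>''.push_cocycle unfolding Q.A.liftable_def mem_Collect_eq eq
    by (auto simp: P.A.liftable_def \<alpha>.push_closed)
qed

lemma push_liftable_B: "g \<in> P.B.liftable s \<Longrightarrow> push K s \<beta> g \<in> Q.B.liftable s"
  and push_B_proj: "g \<in> P.B.liftable s \<Longrightarrow>
    push K s (B_proj Q) (push K s \<beta> g) = push K s \<beta>'' (push G s (B_proj P) g)"
proof -
  interpret \<beta>: gmodule_hom G K "B_mid P" "B_mid Q" \<beta> by (rule B_mid_hom)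
  interpret \<beta>'': gmodule_hom G K "B_quot P" "B_quot Q" \<beta>'' by (rule B_quot_hom)
  assume g: "g \<in> P.B.liftable s"
  then show eq: "push K s (B_proj Q) (push K s \<beta> g) = push K s \<beta>'' (push G s (B_proj P) g)"
    using P.B.mid.cochain_closed[OF P.B.liftable_closed[OF g]]
    by (auto simp: push_def \<beta>.tuples_subset B_proj_hom)
  show "push K s \<beta> g \<in> Q.B.liftable s"
    using g \<beta>''.push_cocycle unfolding Q.B.liftable_def mem_Collect_eq eq
    by (auto simp: P.B.liftable_def \<beta>.push_closed)
qed

text \<open>Compared after the injective \<open>A_inj Q\<close>, where both sides become the
  coboundary of the pushed lift.\<close>

lemma push_bdry_A:
  assumes f: "f \<in> P.A.liftable r"
  shows "push K (Suc r) \<alpha>' (P.A.bdry r f) = Q.A.bdry r (push K r \<alpha> f)"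
proof -
  interpret \<alpha>': gmodule_hom G K "A_sub P" "A_sub Q" \<alpha>' by (rule A_sub_hom)
  interpret \<alpha>: gmodule_hom G K "A_mid P" "A_mid Q" \<alpha> by (rule A_mid_hom)
  have "push K (Suc r) (A_inj Q) (push K (Suc r) \<alpha>' (P.A.bdry r f))
      = push K (Suc r) \<alpha> (push G (Suc r) (A_inj P) (P.A.bdry r f))"
    using P.A.sub.cochain_closed[OF P.A.bdry_closed[OF f]]
    by (auto simp: push_def \<alpha>.tuples_subset A_inj_hom)
  then show ?thesis
    using f by (intro Q.A.bdry_eqI[symmetric] push_liftable_A \<alpha>'.push_closed P.A.bdry_closed)
      (auto simp: P.A.push_bdry \<alpha>.push_coboundary P.A.liftable_closed)
qed

lemma push_bdry_B:
  assumes g: "g \<in> P.B.liftable s"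
  shows "push K (Suc s) \<beta>' (P.B.bdry s g) = Q.B.bdry s (push K s \<beta> g)"
proof -
  interpret \<beta>': gmodule_hom G K "B_sub P" "B_sub Q" \<beta>' by (rule B_sub_hom)
  interpret \<beta>: gmodule_hom G K "B_mid P" "B_mid Q" \<beta> by (rule B_mid_hom)
  have "push K (Suc s) (B_inj Q) (push K (Suc s) \<beta>' (P.B.bdry s g))
      = push K (Suc s) \<beta> (push G (Suc s) (B_inj P) (P.B.bdry s g))"
    using P.B.sub.cochain_closed[OF P.B.bdry_closed[OF g]]
    by (auto simp: push_def \<beta>.tuples_subset B_inj_hom)
  then show ?thesis
    using g by (intro Q.B.bdry_eqI[symmetric] push_liftable_B \<beta>'.push_closed P.B.bdry_closed)
      (auto simp: P.B.push_bdry \<beta>.push_coboundary P.B.liftable_closed)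
qed

lemma push_aug:
  assumes f: "f \<in> P.A.liftable r" and g: "g \<in> P.B.liftable s"
  shows "push K (Suc (r + s)) \<gamma> (P.aug r s f g) = Q.aug r s (push K r \<alpha> f) (push K s \<beta> g)"
proof -
  interpret \<gamma>: gmodule_hom G K "C_mod P" "C_mod Q" \<gamma> by (rule C_hom)
  interpret K: comm_group "P.CC (Suc (r + s))" by (rule P.C.comm_group_cochains)
  have 1: "push K (Suc (r + s)) \<gamma> (P.cup_sub (Suc r) s (P.A.bdry r f) g)
      = Q.cup_sub (Suc r) s (Q.A.bdry r (push K r \<alpha> f)) (push K s \<beta> g)"
    using push_cup[OF P.p.gmodule_pairing_axioms A_sub_hom B_mid_hom P.A.bdry_closed[OF f]
        P.B.liftable_closed[OF g] sub_mid_hom]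
    by (simp add: push_bdry_A[OF f])
  have 2: "push K (Suc (r + s)) \<gamma> (P.cup_mid r (Suc s) f (P.B.bdry s g))
      = Q.cup_mid r (Suc s) (push K r \<alpha> f) (Q.B.bdry s (push K s \<beta> g))"
    using push_cup[OF P.q.gmodule_pairing_axioms A_mid_hom B_sub_hom P.A.liftable_closed[OF f]
        P.B.bdry_closed[OF g] mid_sub_hom]
    by (simp add: push_bdry_B[OF g])
  show ?thesis
    unfolding P.aug_def Q.aug_def
    using P.cup_sub_closed[OF f g] P.cup_mid_closed[OF f g]
    by (simp add: \<gamma>.push_mult \<gamma>.push_int_pow 1 2)
qed

end

section \<open>Induced modules\<close>

text \<open>Continuity into a discrete space is local constancy, a form that needs no knowledge of
  preimages.\<close>

lemma continuous_map_discrete_iff: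
  "continuous_map X (discrete_topology A) f \<longleftrightarrow> f \<in> topspace X \<rightarrow> A \<and>
    (\<forall>x0\<in>topspace X. \<exists>U. openin X U \<and> x0 \<in> U \<and> (\<forall>x\<in>U. f x = f x0))"
proof (intro iffI conjI ballI)
  fix x0 assume f: "continuous_map X (discrete_topology A) f" and x0: "x0 \<in> topspace X"
  have "openin X {x \<in> topspace X. f x \<in> {f x0}}"
    using openin_continuous_map_preimage[OF f, of "{f x0}"] continuous_map_funspace[OF f] x0 by auto
  then show "\<exists>U. openin X U \<and> x0 \<in> U \<and> (\<forall>x\<in>U. f x = f x0)"
    using x0 by (intro exI[of _ "{x \<in> topspace X. f x \<in> {f x0}}"]) auto
next
  assume f: "f \<in> topspace X \<rightarrow> A \<and> (\<forall>x0\<in>topspace X. \<exists>U. openin X U \<and> x0 \<in> U \<and> (\<forall>x\<in>U. f x = f x0))"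
  show "continuous_map X (discrete_topology A) f"
    unfolding continuous_map_def
  proof (intro conjI allI impI)
    fix V assume "openin (discrete_topology A) V"
    show "openin X {x \<in> topspace X. f x \<in> V}"
    proof (subst openin_subopen, clarify)
      fix x0 assume x0: "x0 \<in> topspace X" "f x0 \<in> V"
      from bspec[OF conjunct2[OF f] x0(1)]
      obtain U where U: "openin X U \<and> x0 \<in> U \<and> (\<forall>x\<in>U. f x = f x0)" ..
      have "x \<in> topspace X \<and> f x \<in> V" if "x \<in> U" for x
        using U that x0(2) openin_subset by (metis subsetD)
      with U have "openin X U \<and> x0 \<in> U \<and> U \<subseteq> {x \<in> topspace X. f x \<in> V}"
        by blast
      then show "\<exists>T. openin X T \<and> x0 \<in> T \<and> T \<subseteq> {x \<in> topspace X. f x \<in> V}"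
        by blast
    qed
  qed (use f in auto)
qed (metis Pi_I continuous_map_funspace funcset_mem topspace_discrete_topology)

lemma subtopgroup_simps [simp]:
  "carrier (subtopgroup G H) = H" "mult (subtopgroup G H) = mult G" "one (subtopgroup G H) = one G"
  "gtop (subtopgroup G H) = subtopology (gtop G) H"
  by (simp_all add: subtopgroup_def)

section \<open>Open subgroups: cosets and the retraction onto the subgroup\<close>

locale open_subgroup = topgrp G for G :: "'g topgroup" (structure) +
  fixes H :: "'g set"
  assumes compact: "compact_space (gtop G)" and subgroup_H: "subgroup H G" and open_H: "openin (gtop G) H"
begin

abbreviation K :: "'g topgroup" where "K \<equiv> subtopgroup G H"

lemma H_subset: "h \<in> H \<Longrightarrow> h \<in> carrier G"
  using subgroup.subset[OF subgroup_H] by blast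

lemma H_closed [simp]: "h \<in> H \<Longrightarrow> k \<in> H \<Longrightarrow> h \<otimes> k \<in> H" "\<one> \<in> H" "h \<in> H \<Longrightarrow> inv h \<in> H"
  using subgroup_H by (auto simp: subgroup_def)

lemma group_K: "group K"
proof (rule groupI)
  fix x assume x: "x \<in> carrier K"
  then show "\<exists>y\<in>carrier K. y \<otimes>\<^bsub>K\<^esub> x = \<one>\<^bsub>K\<^esub>"
    using H_subset[of x] by (intro bexI[of _ "inv x"]) auto
qed (use H_subset in \<open>auto simp: m_assoc\<close>)

lemma inv_K: "x \<in> H \<Longrightarrow> inv\<^bsub>K\<^esub> x = inv x"
  using H_subset[of x] by (intro group.inv_equality[OF group_K]) auto

lemma topgrp_K: "topgrp K"
proof
  have 1: "continuous_map (prod_topology (gtop K) (gtop K)) (gtop K) (\<lambda>(x, y). x \<otimes>\<^bsub>K\<^esub> y)"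
  proof -
    have "continuous_map (prod_topology (gtop K) (gtop K)) (gtop G) (\<lambda>z. fst z \<otimes> snd z)"
      by (intro continuous_map_mult; simp; rule continuous_map_into_fulltopology)
        (rule continuous_map_fst continuous_map_snd)+
    then show ?thesis
      by (simp add: continuous_map_in_subtopology case_prod_unfold Pi_iff)
  qed
  have "continuous_map (gtop K) (gtop G) (\<lambda>x. inv x)"
    unfolding subtopgroup_simps by (intro continuous_map_inv continuous_map_from_subtopology) simp
  then have "continuous_map (gtop K) (gtop K) (\<lambda>x. inv x)"
    by (simp add: continuous_map_in_subtopology Pi_iff)
  then have 2: "continuous_map (gtop K) (gtop K) (\<lambda>x. inv\<^bsub>K\<^esub> x)"
    by (rule continuous_map_eq) (simp add: inv_K)
  have "topspace (gtop K) = carrier K"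
    using H_subset by auto
  with group_K 1 2 show "topological_group K"
    by (simp only: topological_group_def simp_thms)
qed

sublocale K: topgrp K by (rule topgrp_K)

text \<open>A representative of the right coset Hy. The coset H gets the unit, which makes the
  retraction the identity on H.\<close>

definition rep :: "'g \<Rightarrow> 'g" where
  "rep y = (if clip G y \<in> H then \<one> else (SOME z. z \<in> H #> clip G y))"

text \<open>The H-component in y = \<open>retract y\<close> \<open>rep y\<close>. Left translation
  by H does not change \<open>rep\<close>, hence the equivariance.\<close>

definition retract :: "'g \<Rightarrow> 'g" where
  "retract y = clip G y \<otimes> inv (rep y)"

lemma rep_in_coset: "rep y \<in> H #> clip G y"
proof (cases "clip G y \<in> H")
  case True
  then show ?thesis
    using subgroup.rcos_const[OF subgroup_H group_axioms] by (simp add: rep_def)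
next
  case False
  then show ?thesis
    using someI[of "\<lambda>z. z \<in> H #> clip G y", OF rcos_self[OF clip_closed subgroup_H]]
    by (simp add: rep_def)
qed

lemma rep_closed [simp]: "rep y \<in> carrier G"
  using rep_in_coset r_coset_subset_G[OF subgroup.subset[OF subgroup_H] clip_closed] by blast

lemma rep_coset_eq: "x \<in> carrier G \<Longrightarrow> y \<in> carrier G \<Longrightarrow> H #> x = H #> y \<Longrightarrow> rep x = rep y"
  using rcos_self[OF _ subgroup_H] subgroup.rcos_const[OF subgroup_H group_axioms]
  by (metis clip_id coset_join1 rep_def subgroup.subset subgroup_H)

lemma rep_H_mult: "h \<in> H \<Longrightarrow> y \<in> carrier G \<Longrightarrow> rep (h \<otimes> y) = rep y"
  using H_subset subgroup.rcos_const[OF subgroup_H group_axioms] subgroup.subset[OF subgroup_H]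
  by (intro rep_coset_eq) (auto simp flip: coset_mult_assoc)

lemma retract_H [simp]: "retract y \<in> H"
proof -
  obtain h where "h \<in> H" "rep y = h \<otimes> clip G y"
    using rep_in_coset by (auto simp: r_coset_def)
  then show ?thesis
    using H_subset by (simp add: retract_def inv_mult_group flip: m_assoc)
qed

lemma retract_closed [simp]: "retract y \<in> carrier G"
  using H_subset by simp

lemma retract_rep [simp]: "y \<in> carrier G \<Longrightarrow> retract y \<otimes> rep y = y"
  by (simp add: retract_def m_assoc)

lemma retract_H_mult: "h \<in> H \<Longrightarrow> y \<in> carrier G \<Longrightarrow> retract (h \<otimes> y) = h \<otimes> retract y"
  using H_subset by (simp add: retract_def rep_H_mult m_assoc)

lemma retract_id: "h \<in> H \<Longrightarrow> retract h = h"
  using H_subset by (simp add: retract_def rep_def)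

lemma retract_clip [simp]: "retract (clip G y) = retract y"
  by (simp add: retract_def rep_def)

lemma open_rcoset:
  assumes "y \<in> carrier G"
  shows "openin (gtop G) (H #> y)"
proof -
  have "H #> y = {x \<in> carrier G. x \<otimes> inv y \<in> H}"
    using assms H_subset
    by (auto simp: r_coset_def m_assoc intro!: bexI[of _ "_ \<otimes> inv y"])
  moreover have "continuous_map (gtop G) (gtop G) (\<lambda>x. x \<otimes> inv y)"
    using assms by (intro continuous_map_mult) auto
  ultimately show ?thesis
    using openin_continuous_map_preimage[OF _ open_H] by force
qed

text \<open>\<open>rep\<close> is constant on right cosets, which are open. The discrete target is
  stronger than continuity into G and is what makes the image finite below.\<close>

lemma continuous_map_rep: "continuous_map (gtop G) (discrete_topology (carrier G)) rep"
  unfolding continuous_map_discrete_iff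
proof (intro conjI ballI)
  fix y assume "y \<in> topspace (gtop G)"
  then have y: "y \<in> carrier G" by simp
  show "\<exists>U. openin (gtop G) U \<and> y \<in> U \<and> (\<forall>x\<in>U. rep x = rep y)"
    using open_rcoset[OF y] rcos_self[OF y subgroup_H] rep_H_mult[OF _ y]
    by (intro exI[of _ "H #> y"]) (auto simp: r_coset_def)
qed auto

text \<open>Compactness of G enters here: a compact subset of a discrete space is finite, so H has
  finite index.\<close>

lemma finite_rep: "finite (rep ` carrier G)"
proof -
  have "compactin (discrete_topology (carrier G)) (rep ` topspace (gtop G))"
    using image_compactin[OF _ continuous_map_rep] compact by (simp add: compact_space_def)
  then show ?thesis
    by (simp add: compactin_discrete_topology)
qed

lemma continuous_map_retract: "continuous_map (gtop G) (gtop G) retract"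
proof -
  have "continuous_map (gtop G) (gtop G) rep"
    using continuous_map_compose[OF continuous_map_rep, of "gtop G" id] by (simp add: Pi_def)
  then have "continuous_map (gtop G) (gtop G) (\<lambda>y. y \<otimes> inv (rep y))"
    by (intro continuous_map_mult continuous_map_inv) auto
  then show ?thesis
    by (rule continuous_map_eq) (simp add: retract_def)
qed

lemma continuous_map_retract_K: "continuous_map (gtop G) (gtop K) retract"
  using continuous_map_retract by (auto simp: continuous_map_in_subtopology)

text \<open>Inversion exchanges right and left cosets: if a^-1 = h z with h in H and z =
  \<open>rep (inv a)\<close>, then aH = z^-1 H.\<close>

lemma finite_lcosets: "finite (lcosets H)"
proof (rule finite_subset)
  show "finite ((\<lambda>z. l_coset G (inv z) H) ` rep ` carrier G)"
    using finite_rep by blast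
  show "lcosets H \<subseteq> (\<lambda>z. l_coset G (inv z) H) ` rep ` carrier G"
  proof
    fix X assume "X \<in> lcosets H"
    then obtain a where a: "a \<in> carrier G" "X = l_coset G a H" by (auto simp: LCOSETS_def)
    have "l_coset G a H = l_coset G (inv (rep (inv a))) H"
    proof (rule Set.set_eqI)
      fix z
      have "z \<in> l_coset G a H \<longleftrightarrow> z \<in> carrier G \<and> inv a \<otimes> z \<in> H" if "a \<in> carrier G" for a
        using that subgroup.lcos_module_rev[OF subgroup_H group_axioms that]
          subgroup.lcos_module_imp[OF subgroup_H group_axioms that]
          subgroup.elemlcos_carrier[OF subgroup_H group_axioms that] by blast
      moreover have "inv a \<otimes> z \<in> H \<longleftrightarrow> rep (inv a) \<otimes> z \<in> H" if "z \<in> carrier G"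
      proof -
        have r: "inv a = retract (inv a) \<otimes> rep (inv a)" using a by simp
        have "inv a \<otimes> z = retract (inv a) \<otimes> (rep (inv a) \<otimes> z)"
          using that by (subst r) (simp add: m_assoc)
        moreover have "rep (inv a) \<otimes> z = inv (retract (inv a)) \<otimes> (inv a \<otimes> z)"
          using that by (subst r) (simp add: m_assoc inv_solve_left)
        ultimately show ?thesis
          by (metis H_closed(1,3) retract_H)
      qed
      ultimately show "z \<in> l_coset G a H \<longleftrightarrow> z \<in> l_coset G (inv (rep (inv a))) H"
        using a by auto
    qed
    with a show "X \<in> (\<lambda>z. l_coset G (inv z) H) ` rep ` carrier G" by auto
  qed
qed

lemma discrete_gmodule_K:
  assumes "discrete_gmodule G A"
  shows "discrete_gmodule K A"
proof
  interpret discrete_gmodule G A by fact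
  have "continuous_map (prod_topology (gtop K) (discrete_topology (carrier A)))
      (discrete_topology (carrier A)) (\<lambda>z. act A (fst z) (snd z))"
    by (intro continuous_map_act)
      (auto intro: continuous_map_into_fulltopology continuous_map_fst continuous_map_snd)
  then show "discrete_module K A"
    using H_subset M.comm_group_axioms act_hom act_mult
    by (auto simp: discrete_module_def case_prod_unfold)
qed

end

section \<open>The induced module as a discrete module\<close>

locale induced_module = open_subgroup G H + discrete_gmodule G A
  for G :: "'g topgroup" (structure) and H :: "'g set" and A :: "('g, 'a) gmodule"
begin

abbreviation I :: "('g, 'g \<Rightarrow> 'a) gmodule" where "I \<equiv> Ind G H A"

abbreviation CI :: "nat \<Rightarrow> ((nat \<Rightarrow> 'g) \<Rightarrow> 'g \<Rightarrow> 'a) monoid" where "CI \<equiv> cochains G I"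

lemma carrier_Ind: "c \<in> carrier I \<longleftrightarrow> c \<in> extensional (carrier G) \<and>
    continuous_map (gtop G) (discrete_topology (carrier A)) c \<and>
    (\<forall>h\<in>H. \<forall>x\<in>carrier G. c (h \<otimes> x) = act A h (c x))"
  by (simp add: Ind_def)

lemma mult_Ind: "x \<in> carrier G \<Longrightarrow> (c \<otimes>\<^bsub>I\<^esub> d) x = c x \<otimes>\<^bsub>A\<^esub> d x"
  and one_Ind: "x \<in> carrier G \<Longrightarrow> \<one>\<^bsub>I\<^esub> x = \<one>\<^bsub>A\<^esub>"
  and act_Ind: "x \<in> carrier G \<Longrightarrow> act I g c x = c (x \<otimes> g)"
  and extensional_Ind: "c \<otimes>\<^bsub>I\<^esub> d \<in> extensional (carrier G)" "\<one>\<^bsub>I\<^esub> \<in> extensional (carrier G)"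
    "act I g c \<in> extensional (carrier G)"
  by (simp_all add: Ind_def)

lemma Ind_closed [simp]: "c \<in> carrier I \<Longrightarrow> x \<in> carrier G \<Longrightarrow> c x \<in> carrier A"
  using continuous_map_funspace[of "gtop G" "discrete_topology (carrier A)" c]
  by (auto simp: carrier_Ind)

lemma Ind_equivariant: "c \<in> carrier I \<Longrightarrow> h \<in> H \<Longrightarrow> x \<in> carrier G \<Longrightarrow> c (h \<otimes> x) = act A h (c x)"
  by (simp add: carrier_Ind)

lemma Ind_eq_rep: "c \<in> carrier I \<Longrightarrow> x \<in> carrier G \<Longrightarrow> c x = act A (retract x) (c (rep x))"
  using Ind_equivariant[OF _ retract_H rep_closed, of c x x] by (simp only: retract_rep)

lemma Ind_eqI:
  assumes "c \<in> extensional (carrier G)" "d \<in> extensional (carrier G)"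
    and "\<And>x. x \<in> carrier G \<Longrightarrow> c x = d x"
  shows "c = d"
  using assms by (rule extensionalityI)

lemma IndI:
  assumes "continuous_map (gtop G) (discrete_topology (carrier A)) f"
    and "\<And>h x. h \<in> H \<Longrightarrow> x \<in> carrier G \<Longrightarrow> f (h \<otimes> x) = act A h (f x)"
  shows "(\<lambda>x\<in>carrier G. f x) \<in> carrier I"
  using assms H_subset by (auto simp: carrier_Ind)

lemma comm_group_Ind: "comm_group I"
proof (rule comm_groupI)
  fix c d assume c: "c \<in> carrier I" and d: "d \<in> carrier I"
  show "c \<otimes>\<^bsub>I\<^esub> d \<in> carrier I"
    using IndI[OF continuous_map_module_mult, of c d] c d H_subset
    by (simp add: Ind_def)
  show "c \<otimes>\<^bsub>I\<^esub> d = d \<otimes>\<^bsub>I\<^esub> c"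
    by (rule Ind_eqI) (use c d in \<open>auto simp: mult_Ind extensional_Ind M.m_comm\<close>)
  fix e assume e: "e \<in> carrier I"
  show "c \<otimes>\<^bsub>I\<^esub> d \<otimes>\<^bsub>I\<^esub> e = c \<otimes>\<^bsub>I\<^esub> (d \<otimes>\<^bsub>I\<^esub> e)"
    by (rule Ind_eqI) (use c d e in \<open>auto simp: mult_Ind extensional_Ind M.m_assoc\<close>)
next
  show "\<one>\<^bsub>I\<^esub> \<in> carrier I"
    using IndI[of "\<lambda>_. \<one>\<^bsub>A\<^esub>"] H_subset by (simp add: Ind_def)
next
  fix c assume c: "c \<in> carrier I"
  show "\<one>\<^bsub>I\<^esub> \<otimes>\<^bsub>I\<^esub> c = c"
    by (rule Ind_eqI) (use c in \<open>auto simp: mult_Ind one_Ind extensional_Ind carrier_Ind Ind_closed[OF c]\<close>)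
  show "\<exists>d\<in>carrier I. d \<otimes>\<^bsub>I\<^esub> c = \<one>\<^bsub>I\<^esub>"
  proof
    show "(\<lambda>x\<in>carrier G. inv\<^bsub>A\<^esub> c x) \<in> carrier I"
      using c H_subset by (intro IndI continuous_map_module_inv) (auto simp: carrier_Ind Ind_closed[OF c])
    show "(\<lambda>x\<in>carrier G. inv\<^bsub>A\<^esub> c x) \<otimes>\<^bsub>I\<^esub> c = \<one>\<^bsub>I\<^esub>"
      by (rule Ind_eqI) (use c in \<open>auto simp: mult_Ind one_Ind extensional_Ind\<close>)
  qed
qed

text \<open>
  An element of the induced module is determined by its finitely many values on coset
  representatives, so no uniformity argument is needed for continuity.
\<close>

lemma continuous_map_into_Ind:
  assumes F: "\<And>x. x \<in> topspace X \<Longrightarrow> F x \<in> carrier I"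
    and cont: "\<And>t. t \<in> carrier G \<Longrightarrow> continuous_map X (discrete_topology (carrier A)) (\<lambda>x. F x t)"
  shows "continuous_map X (discrete_topology (carrier I)) F"
  unfolding continuous_map_discrete_iff
proof (intro conjI ballI)
  fix x0 assume x0: "x0 \<in> topspace X"
  \<comment> \<open>A finite intersection of open sets, on which F keeps its values at all coset
    representatives and therefore everywhere.\<close>
  define U where "U = topspace X \<inter> (\<Inter>t\<in>rep ` carrier G. {x \<in> topspace X. F x t \<in> {F x0 t}})"
  have "openin X {x \<in> topspace X. F x t \<in> {F x0 t}}" if "t \<in> carrier G" for t
    using openin_continuous_map_preimage[OF cont[OF that], of "{F x0 t}"] F[OF x0] that by simp
  then have "openin X U"
    unfolding U_def using finite_rep by (intro openin_Int_Inter) auto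
  moreover have "x0 \<in> U"
    using x0 by (auto simp: U_def)
  moreover have "F x = F x0" if "x \<in> U" for x
  proof (rule Ind_eqI)
    have x: "x \<in> topspace X" and eq: "\<And>t. t \<in> carrier G \<Longrightarrow> F x (rep t) = F x0 (rep t)"
      using that by (auto simp: U_def)
    show "F x \<in> extensional (carrier G)" "F x0 \<in> extensional (carrier G)"
      using F[OF x] F[OF x0] by (auto simp: carrier_Ind)
    fix y assume y: "y \<in> carrier G"
    show "F x y = F x0 y"
      using Ind_eq_rep[OF F[OF x] y] Ind_eq_rep[OF F[OF x0] y] eq[OF y] by simp
  qed
  ultimately show "\<exists>U. openin X U \<and> x0 \<in> U \<and> (\<forall>x\<in>U. F x = F x0)"
    by blast
qed (use F in auto)

text \<open>Joint continuity: near x0 the element c x equals c x0, and c x0 is itself locally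
  constant on G; the two neighbourhoods are intersected.\<close>

lemma continuous_map_Ind_eval:
  assumes c: "continuous_map X (discrete_topology (carrier I)) c" and y: "continuous_map X (gtop G) y"
  shows "continuous_map X (discrete_topology (carrier A)) (\<lambda>x. c x (y x))"
  unfolding continuous_map_discrete_iff
proof (intro conjI ballI)
  have mem: "c x \<in> carrier I" "y x \<in> carrier G" if "x \<in> topspace X" for x
    using continuous_map_funspace[OF c] continuous_map_funspace[OF y] that by auto
  then show "(\<lambda>x. c x (y x)) \<in> topspace X \<rightarrow> carrier A"
    by auto
  fix x0 assume x0: "x0 \<in> topspace X"
  from conjunct2[OF c[unfolded continuous_map_discrete_iff], THEN bspec, OF x0]
  obtain U where U: "openin X U \<and> x0 \<in> U \<and> (\<forall>x\<in>U. c x = c x0)" ..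
  have "continuous_map (gtop G) (discrete_topology (carrier A)) (c x0)"
    using mem(1)[OF x0] by (simp add: carrier_Ind)
  from continuous_map_compose[OF y this]
  have "continuous_map X (discrete_topology (carrier A)) (\<lambda>x. c x0 (y x))"
    by (simp add: o_def)
  from conjunct2[OF this[unfolded continuous_map_discrete_iff], THEN bspec, OF x0]
  obtain V where V: "openin X V \<and> x0 \<in> V \<and> (\<forall>x\<in>V. c x0 (y x) = c x0 (y x0))" ..
  have "openin X (U \<inter> V) \<and> x0 \<in> U \<inter> V \<and> (\<forall>x\<in>U \<inter> V. c x (y x) = c x0 (y x0))"
    using U V by (metis IntE IntI openin_Int)
  then show "\<exists>U. openin X U \<and> x0 \<in> U \<and> (\<forall>x\<in>U. c x (y x) = c x0 (y x0))" ..
qed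

lemma act_Ind_closed: "g \<in> carrier G \<Longrightarrow> c \<in> carrier I \<Longrightarrow> act I g c \<in> carrier I"
proof -
  assume g: "g \<in> carrier G" and c: "c \<in> carrier I"
  have "continuous_map (gtop G) (gtop G) (\<lambda>x. x \<otimes> g)"
    using g by (intro continuous_map_mult) auto
  from continuous_map_compose[OF this] c
  have "continuous_map (gtop G) (discrete_topology (carrier A)) (\<lambda>x. c (x \<otimes> g))"
    by (auto simp: carrier_Ind o_def)
  from IndI[OF this] show ?thesis
    using g c H_subset by (simp add: Ind_def m_assoc)
qed

lemma discrete_module_Ind: "discrete_module G I"
  unfolding discrete_module_def
proof (intro conjI ballI)
  show "comm_group I" by (rule comm_group_Ind)
  interpret I: comm_group I by (rule comm_group_Ind)
  show "act I g \<in> hom I I" if "g \<in> carrier G" for g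
    using that by (intro homI act_Ind_closed Ind_eqI)
      (auto simp: act_Ind mult_Ind extensional_Ind)
  show "act I \<one> c = c" if "c \<in> carrier I" for c
    by (rule Ind_eqI) (use that in \<open>auto simp: act_Ind extensional_Ind carrier_Ind\<close>)
  show "act I (g \<otimes> h) c = act I g (act I h c)" if "g \<in> carrier G" "h \<in> carrier G" "c \<in> carrier I" for g h c
    by (rule Ind_eqI) (use that in \<open>auto simp: act_Ind extensional_Ind m_assoc\<close>)
  show "continuous_map (prod_topology (gtop G) (discrete_topology (carrier I)))
       (discrete_topology (carrier I)) (\<lambda>(g, c). act I g c)"
    unfolding case_prod_unfold
  proof (rule continuous_map_into_Ind)
    fix t assume t: "t \<in> carrier G"
    have "continuous_map (prod_topology (gtop G) (discrete_topology (carrier I)))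
       (discrete_topology (carrier A)) (\<lambda>x. snd x (t \<otimes> fst x))"
      using t by (intro continuous_map_Ind_eval continuous_map_mult continuous_map_snd continuous_map_fst) simp
    then show "continuous_map (prod_topology (gtop G) (discrete_topology (carrier I)))
       (discrete_topology (carrier A)) (\<lambda>x. act I (fst x) (snd x) t)"
      using t by (simp add: act_Ind)
  qed (auto intro: act_Ind_closed)
qed

sublocale I: discrete_gmodule G I
  by unfold_locales (rule discrete_module_Ind)

text \<open>Equivariant over H: (hc)(1) = c(h) = h c(1).\<close>

lemma eval_hom: "gmodule_hom G K I A (\<lambda>c. c \<one>)"
proof -
  interpret K: discrete_gmodule K A
    by (intro discrete_gmodule_K discrete_gmodule_axioms)
  show ?thesis
  proof
    show "(\<lambda>c. c \<one>) \<in> hom I A"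
      by (rule homI) (auto simp: mult_Ind)
    show "equivariant K I A (\<lambda>c. c \<one>)"
      using Ind_equivariant[of _ _ \<one>] H_subset by (auto simp: equivariant_def act_Ind)
    show "continuous_map (gtop K) (gtop G) (\<lambda>x. x)"
      by (simp add: continuous_map_from_subtopology)
  qed (use H_subset in auto)
qed

lemma ind_incl_hom: "gmodule_hom G G A I (ind_incl G A)"
proof
  have "ind_incl G A a \<in> carrier I" if "a \<in> carrier A" for a
    unfolding ind_incl_def
    by (rule IndI) (use that H_subset in \<open>auto intro!: continuous_map_act simp: act_mult\<close>)
  then show "ind_incl G A \<in> hom A I"
    by (intro homI Ind_eqI) (auto simp: ind_incl_def mult_Ind extensional_Ind)
  show "equivariant G A I (ind_incl G A)"
    unfolding equivariant_def
    by (intro ballI Ind_eqI) (auto simp: act_Ind ind_incl_def extensional_Ind act_mult)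
qed auto

section \<open>The trace of the induced module\<close>

lemma lcosets_ex: "X \<in> lcosets H \<Longrightarrow> \<exists>x\<in>carrier G. X = l_coset G x H"
  by (auto simp: LCOSETS_def)

lemma lcoset_rep:
  assumes "X \<in> lcosets H"
  shows "(SOME x. x \<in> X) \<in> X" "x \<in> X \<Longrightarrow> x \<in> carrier G"
    "x \<in> X \<Longrightarrow> y \<in> X \<Longrightarrow> \<exists>h\<in>H. y = x \<otimes> h"
proof -
  obtain z where z: "z \<in> carrier G" "X = l_coset G z H"
    using lcosets_ex[OF assms] by blast
  show "(SOME x. x \<in> X) \<in> X"
    using lcos_self[OF z(1) subgroup_H] z by (metis someI)
  show c: "x \<in> carrier G" if "x \<in> X" for x
    using subgroup.elemlcos_carrier[OF subgroup_H group_axioms z(1)] that z by blast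
  assume "x \<in> X" "y \<in> X"
  then obtain h k where "h \<in> H" "k \<in> H" "x = z \<otimes> h" "y = z \<otimes> k"
    using z by (auto simp: l_coset_def)
  moreover from this have "h \<otimes> (inv h \<otimes> k) = k"
    using H_subset by (simp flip: m_assoc)
  ultimately show "\<exists>h\<in>H. y = x \<otimes> h"
    using z H_subset by (intro bexI[of _ "inv h \<otimes> k"]) (simp_all add: m_assoc)
qed

definition trace_term :: "('g \<Rightarrow> 'a) \<Rightarrow> 'g set \<Rightarrow> 'a" where
  "trace_term c X = act A (SOME x. x \<in> X) (c (inv (SOME x. x \<in> X)))"

lemma ind_trace_eq: "ind_trace G H A c = (\<Otimes>\<^bsub>A\<^esub>X\<in>lcosets H. trace_term c X)"
  by (simp add: ind_trace_def trace_term_def Let_def)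

text \<open>Replacing x by xh changes nothing, since xh c(h^-1 x^-1) = x h h^-1 c(x^-1). Hence the
  chosen representative may be replaced by any other.\<close>

lemma trace_term_eq:
  assumes c: "c \<in> carrier I" and X: "X \<in> lcosets H" and x: "x \<in> X"
  shows "trace_term c X = act A x (c (inv x))"
proof -
  obtain h where h: "h \<in> H" "(SOME x. x \<in> X) = x \<otimes> h"
    using lcoset_rep(3)[OF X x lcoset_rep(1)[OF X]] by blast
  have "x \<in> carrier G" "h \<in> carrier G"
    using lcoset_rep(2)[OF X x] H_subset h by auto
  then show ?thesis
    using h Ind_equivariant[OF c, of "inv h" "inv x"] c
    by (simp add: trace_term_def h(2) inv_mult_group act_mult)
qed

lemma trace_term_closed: "c \<in> carrier I \<Longrightarrow> X \<in> lcosets H \<Longrightarrow> trace_term c X \<in> carrier A"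
  using lcoset_rep by (simp add: trace_term_def)

lemma ind_trace_closed: "c \<in> carrier I \<Longrightarrow> ind_trace G H A c \<in> carrier A"
  unfolding ind_trace_eq by (intro M.finprod_closed) (auto simp: trace_term_closed)

lemma translate_lcoset:
  assumes "g \<in> carrier G" "X \<in> lcosets H"
  shows "l_coset G g X \<in> lcosets H" "l_coset G (inv g) (l_coset G g X) = X"
proof -
  obtain z where z: "z \<in> carrier G" "X = l_coset G z H"
    using lcosets_ex[OF assms(2)] by blast
  have "l_coset G g X = l_coset G (g \<otimes> z) H"
    using assms z lcos_m_assoc[OF subgroup.subset[OF subgroup_H]] by simp
  then show "l_coset G g X \<in> lcosets H"
    using assms z by (auto simp: LCOSETS_def)
  have "X \<subseteq> carrier G"
    using lcoset_rep(2)[OF assms(2)] by blast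
  then show "l_coset G (inv g) (l_coset G g X) = X"
    using assms lcos_m_assoc[of X "inv g" g] lcos_mult_one by simp
qed

lemma bij_translate:
  assumes g: "g \<in> carrier G"
  shows "bij_betw (l_coset G g) (lcosets H) (lcosets H)"
  by (rule bij_betw_byWitness[of _ "l_coset G (inv g)"])
    (use translate_lcoset[OF g] translate_lcoset[of "inv g"] g in auto)

text \<open>For equivariance the sum is reindexed by the permutation X -> gX of the left cosets;
  with representative gx the action of g on c cancels: c((gx)^-1 g) = c(x^-1).\<close>

lemma ind_trace_hom: "gmodule_hom G G I A (ind_trace G H A)"
proof
  show "ind_trace G H A \<in> hom I A"
  proof (rule homI)
    fix c d assume c: "c \<in> carrier I" and d: "d \<in> carrier I"
    have "ind_trace G H A (c \<otimes>\<^bsub>I\<^esub> d) = (\<Otimes>\<^bsub>A\<^esub>X\<in>lcosets H. trace_term c X \<otimes>\<^bsub>A\<^esub> trace_term d X)"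
      unfolding ind_trace_eq
      by (rule M.finprod_cong')
        (use c d lcoset_rep in \<open>auto simp: trace_term_closed trace_term_def mult_Ind\<close>)
    then show "ind_trace G H A (c \<otimes>\<^bsub>I\<^esub> d) = ind_trace G H A c \<otimes>\<^bsub>A\<^esub> ind_trace G H A d"
      unfolding ind_trace_eq using c d by (simp add: M.finprod_multf trace_term_closed Pi_def)
  qed (rule ind_trace_closed)
  show "equivariant G I A (ind_trace G H A)"
    unfolding equivariant_def
  proof (intro ballI)
    fix g c assume g: "g \<in> carrier G" and c: "c \<in> carrier I"
    have shift: "trace_term (act I g c) (l_coset G g X) = act A g (trace_term c X)" if X: "X \<in> lcosets H" for X
    proof -
      obtain x where x: "x \<in> X" "x \<in> carrier G"
        using lcoset_rep[OF X] by blast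
      have "g \<otimes> x \<in> l_coset G g X"
        using x by (auto simp: l_coset_def)
      then show ?thesis
        using trace_term_eq[OF act_Ind_closed[OF g c] translate_lcoset(1)[OF g X]] trace_term_eq[OF c X x(1)] g x c
        by (simp add: act_Ind inv_mult_group m_assoc act_mult)
    qed
    have "ind_trace G H A (act I g c) = (\<Otimes>\<^bsub>A\<^esub>X\<in>l_coset G g ` (lcosets H). trace_term (act I g c) X)"
      using bij_betw_imp_surj_on[OF bij_translate[OF g]] by (simp add: ind_trace_eq)
    also have "\<dots> = (\<Otimes>\<^bsub>A\<^esub>X\<in>lcosets H. trace_term (act I g c) (l_coset G g X))"
      using bij_betw_imp_inj_on[OF bij_translate[OF g]] g c
      by (intro M.finprod_reindex) (auto simp: trace_term_closed act_Ind_closed translate_lcoset)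
    also have "\<dots> = (\<Otimes>\<^bsub>A\<^esub>X\<in>lcosets H. act A g (trace_term c X))"
      by (rule M.finprod_cong') (use g c shift in \<open>auto simp: trace_term_closed\<close>)
    also have "\<dots> = act A g (ind_trace G H A c)"
      unfolding ind_trace_eq using g c
      by (intro finprod_hom[symmetric, OF M.comm_group_axioms M.comm_group_axioms act_hom])
        (auto simp: trace_term_closed finite_lcosets)
    finally show "ind_trace G H A (act I g c) = act A g (ind_trace G H A c)" .
  qed
qed auto

end

section \<open>Shapiro's lemma\<close>

text \<open>One transport rule for two uses: invariance under \<open>clip\<close>, with \<theta> the
  identity and S everything, and equivariance under left translation, with \<theta> the action and S
  the group. S confines the entries to where c and \<rho> commute.\<close>

lemma (in comm_group) hprism_map_hom:
  assumes \<theta>: "group_hom G B \<theta>" and \<phi>: "\<And>ws. \<phi> ws \<in> carrier G"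
    and eq: "\<And>ws. set ws \<subseteq> S \<Longrightarrow> \<phi>' (map c ws) = \<theta> (\<phi> ws)"
    and \<rho>: "\<And>x. x \<in> S \<Longrightarrow> \<rho> (c x) = c (\<rho> x) \<and> \<rho> x \<in> S" and zs: "set zs \<subseteq> S"
  shows "hprism B \<rho> \<phi>' (map c zs) = \<theta> (hprism G \<rho> \<phi> zs)"
  using zs eq \<phi>
proof (induction zs arbitrary: \<phi> \<phi>')
  case Nil
  then show ?case using group_hom.hom_one[OF \<theta>] by simp
next
  case (Cons x xs)
  have 1: "hprism B \<rho> (\<lambda>ws. \<phi>' (c x # ws)) (map c xs) = \<theta> (hprism G \<rho> (\<lambda>ws. \<phi> (x # ws)) xs)"
    using Cons.prems Cons.prems(2)[of "x # _"] by (intro Cons.IH) auto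
  have "c x # \<rho> (c x) # map \<rho> (map c xs) = map c (x # \<rho> x # map \<rho> xs)"
    using Cons.prems(1) \<rho> by auto
  moreover have "set (x # \<rho> x # map \<rho> xs) \<subseteq> S"
    using Cons.prems(1) \<rho> by auto
  ultimately have 2: "\<phi>' (c x # \<rho> (c x) # map \<rho> (map c xs)) = \<theta> (\<phi> (x # \<rho> x # map \<rho> xs))"
    using Cons.prems(2) by (simp only:)
  show ?case
    using Cons.prems(3) group_hom.hom_mult[OF \<theta>] group_hom.hom_inv[OF \<theta>]
    by (simp only: list.map hprism.simps 1 2 hprism_closed inv_closed)
qed

text \<open>Every summand of the prism evaluates \<phi> on a list with one entry more than
  \<open>zs\<close>.\<close>

lemma (in comm_group) hprism_eq_one:
  assumes "\<And>ws. length ws = Suc (length zs) \<Longrightarrow> \<phi> ws = \<one>"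
  shows "hprism G \<rho> \<phi> zs = \<one>"
  using assms
proof (induction zs arbitrary: \<phi>)
  case (Cons x xs)
  have "hprism G \<rho> (\<lambda>ws. \<phi> (x # ws)) xs = \<one>"
    using Cons.prems by (intro Cons.IH) simp
  then show ?case using Cons.prems by simp
qed simp

context induced_module
begin

sublocale KM: discrete_gmodule K A
  by (intro discrete_gmodule_K discrete_gmodule_axioms)

sublocale ev: gmodule_hom G K I A "\<lambda>c. c \<one>"
  by (rule eval_hom)

text \<open>
  Evaluating the homogeneous cochain of \<open>F\<close> at \<open>\<one>\<close> identifies the cochains of \<open>G\<close> in the induced
  module with the \<open>H\<close>-equivariant homogeneous cochains on \<open>G\<close> (\<open>hcochain\<close> below).
\<close>

definition shp :: "nat \<Rightarrow> ((nat \<Rightarrow> 'g) \<Rightarrow> 'g \<Rightarrow> 'a) \<Rightarrow> 'g list \<Rightarrow> 'a" where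
  "shp r F zs = hmg G I r F zs \<one>"

lemma shp_closed [simp]: "F \<in> carrier (CI r) \<Longrightarrow> shp r F zs \<in> carrier A"
  by (simp add: shp_def)

text \<open>Acting by the base point and evaluating at the unit is evaluation at the base point, so
  no action on A remains.\<close>

lemma shp_eq: "length zs = Suc r \<Longrightarrow> shp r F zs = F (steps G r zs) (clip G (zs ! 0))"
  by (simp add: shp_def hmg_def act_Ind)

lemma shp_wrong_length: "length zs \<noteq> Suc r \<Longrightarrow> shp r F zs = \<one>\<^bsub>A\<^esub>"
  by (simp add: shp_def hmg_def one_Ind)

lemma shp_walk:
  assumes "y \<in> carrier G" "x \<in> tuples G r"
  shows "shp r F (walk G r y x) = F x y"
  using assms by (simp add: shp_eq steps_walk walk_nth)

lemma shp_inject: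
  assumes F: "F \<in> carrier (CI r)" and F': "F' \<in> carrier (CI r)"
    and eq: "\<And>zs. shp r F zs = shp r F' zs"
  shows "F = F'"
proof (rule I.cochain_eqI[of _ r])
  fix x assume x: "x \<in> tuples G r"
  show "F x = F' x"
  proof (rule Ind_eqI)
    show "F x \<in> extensional (carrier G)" "F' x \<in> extensional (carrier G)"
      using I.cochain_closed[OF F x] I.cochain_closed[OF F' x] carrier_Ind by blast+
    fix y assume "y \<in> carrier G"
    then show "F x y = F' x y"
      using eq[of "walk G r y x"] x by (simp add: shp_walk)
  qed
qed (use F F' I.cochain_extensional in blast)+

lemma shp_coboundary:
  assumes "F \<in> carrier (CI r)"
  shows "shp (Suc r) (coboundary G I r F) = hdiff A (shp r F)"
proof
  fix zs
  show "shp (Suc r) (coboundary G I r F) zs = hdiff A (shp r F) zs"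
    unfolding shp_def I.hmg_coboundary[OF assms]
    by (rule hdiff_hom[OF I.M.comm_group_axioms M.comm_group_axioms ev.hom]) (use assms in auto)
qed

lemma shp_mult_inv:
  assumes F: "F \<in> carrier (CI r)" and F': "F' \<in> carrier (CI r)"
  shows "shp r (F \<otimes>\<^bsub>CI r\<^esub> inv\<^bsub>CI r\<^esub> F') zs = shp r F zs \<otimes>\<^bsub>A\<^esub> inv\<^bsub>A\<^esub> shp r F' zs"
proof -
  interpret N: comm_group "CI r" by (rule I.comm_group_cochains)
  interpret e: group_hom I A "\<lambda>c. c \<one>"
    by unfold_locales (rule ev.hom)
  show ?thesis
  proof (cases "length zs = Suc r")
    case True
    have c: "F (steps G r zs) \<in> carrier I" "F' (steps G r zs) \<in> carrier I"
      using F F' I.cochain_closed by auto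
    have "hmg G I r (inv\<^bsub>CI r\<^esub> F') zs = inv\<^bsub>I\<^esub> hmg G I r F' zs"
      using True c(2) by (simp add: hmg_def I.cochains_inv[OF _ F'])
    then show ?thesis
      using F F' unfolding shp_def by (simp add: I.hmg_mult mult_Ind e.hom_inv)
  next
    case False
    then show ?thesis by (simp add: shp_wrong_length)
  qed
qed

lemma shp_one [simp]: "shp r \<one>\<^bsub>CI r\<^esub> zs = \<one>\<^bsub>A\<^esub>"
  by (simp add: shp_def one_Ind)

text \<open>The conditions on wrong lengths and on \<open>clip\<close> record the conventions that
  make these functions total; without them such a function could not be recovered from a
  cochain.\<close>

definition hcochain :: "nat \<Rightarrow> ('g list \<Rightarrow> 'a) \<Rightarrow> bool" where
  "hcochain r \<psi> \<longleftrightarrow> (\<forall>zs. \<psi> zs \<in> carrier A) \<and> (\<forall>zs. length zs \<noteq> Suc r \<longrightarrow> \<psi> zs = \<one>\<^bsub>A\<^esub>) \<and>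
     (\<forall>zs. \<psi> (map (clip G) zs) = \<psi> zs) \<and>
     (\<forall>h\<in>H. \<forall>zs. set zs \<subseteq> carrier G \<longrightarrow> \<psi> (map (mult G h) zs) = act A h (\<psi> zs)) \<and>
     continuous_map (product_topology (\<lambda>_. gtop G) {..<Suc r}) (discrete_topology (carrier A))
       (\<lambda>x. \<psi> (map x [0..<Suc r]))"

lemma hcochain_continuous:
  assumes \<psi>: "hcochain r \<psi>" and fs: "\<And>f. f \<in> set fs \<Longrightarrow> continuous_map X (gtop G) f"
  shows "continuous_map X (discrete_topology (carrier A)) (\<lambda>t. \<psi> (map (\<lambda>f. f t) fs))"
proof (cases "length fs = Suc r")
  case True
  have "continuous_map X (product_topology (\<lambda>_. gtop G) {..<Suc r}) (\<lambda>t. \<lambda>i\<in>{..<Suc r}. (fs ! i) t)"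
    unfolding continuous_map_componentwise using fs True by auto
  moreover have "continuous_map (product_topology (\<lambda>_. gtop G) {..<Suc r}) (discrete_topology (carrier A))
       (\<lambda>x. \<psi> (map x [0..<Suc r]))"
    using \<psi> unfolding hcochain_def by blast
  ultimately have "continuous_map X (discrete_topology (carrier A))
      ((\<lambda>x. \<psi> (map x [0..<Suc r])) \<circ> (\<lambda>t. \<lambda>i\<in>{..<Suc r}. (fs ! i) t))"
    by (rule continuous_map_compose)
  moreover have "map (\<lambda>i\<in>{..<Suc r}. (fs ! i) t) [0..<Suc r] = map (\<lambda>f. f t) fs" for t
    using True by (intro nth_equalityI) (auto simp del: upt_Suc)
  ultimately show ?thesis
    by (simp only: o_def)
next
  case False
  then have "(\<lambda>t. \<psi> (map (\<lambda>f. f t) fs)) = (\<lambda>_. \<one>\<^bsub>A\<^esub>)"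
    using \<psi> unfolding hcochain_def by auto
  then show ?thesis by simp
qed

lemma hcochain_continuous_walk:
  assumes "hcochain r \<psi>" "continuous_map X (gtop G) y"
    and "\<And>i. i < r \<Longrightarrow> continuous_map X (gtop G) (\<lambda>t. x t i)" "\<And>t. t \<in> topspace X \<Longrightarrow> x t \<in> tuples G r"
  shows "continuous_map X (discrete_topology (carrier A)) (\<lambda>t. \<psi> (walk G r (y t) (x t)))"
proof -
  have "continuous_map X (gtop G) (\<lambda>t. tuple_prod G (x t) i)" if "i \<le> r" for i
    using that assms(3) by (induction i) (auto intro: continuous_map_mult)
  then have "continuous_map X (discrete_topology (carrier A))
      (\<lambda>t. \<psi> (map (\<lambda>f. f t) (map (\<lambda>i t. y t \<otimes> tuple_prod G (x t) i) [0..<Suc r])))"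
    using assms(2) by (intro hcochain_continuous[OF assms(1)]) (auto intro!: continuous_map_mult simp del: upt_Suc)
  then show ?thesis
    by (simp only: walk_def list.map_comp o_def)
qed

lemma hcochain_shp:
  assumes F: "F \<in> carrier (CI r)"
  shows "hcochain r (shp r F)"
  unfolding hcochain_def
proof (intro conjI allI ballI impI)
  fix zs :: "'g list"
  show "shp r F zs \<in> carrier A" "length zs \<noteq> Suc r \<Longrightarrow> shp r F zs = \<one>\<^bsub>A\<^esub>"
    using F by (auto simp: shp_wrong_length)
  have "steps G r (map (clip G) zs) = steps G r zs" if "length zs = Suc r"
    using that by (auto simp: steps_def)
  then show "shp r F (map (clip G) zs) = shp r F zs"
    by (cases "length zs = Suc r") (auto simp: shp_eq shp_wrong_length)
  fix h assume h: "h \<in> H" and zs: "set zs \<subseteq> carrier G"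
  show "shp r F (map (mult G h) zs) = act A h (shp r F zs)"
  proof (cases "length zs = Suc r")
    case True
    have c: "zs ! i \<in> carrier G" if "i \<le> r" for i
      using zs True that nth_mem[of i zs] by auto
    have hG: "h \<in> carrier G" using h by (rule H_subset)
    have clip: "clip G (map (mult G h) zs ! i) = h \<otimes> zs ! i" "clip G (zs ! i) = zs ! i" if "i \<le> r" for i
      using True c[OF that] hG that by simp_all
    \<comment> \<open>Left translation of all vertices does not change the steps. Only the base
      point moves, and equivariance of the element of the induced module takes \<open>h\<close>
      out.\<close>
    have cancel: "inv (h \<otimes> a) \<otimes> (h \<otimes> b) = inv a \<otimes> b" if "a \<in> carrier G" "b \<in> carrier G" for a b
    proof -
      have "inv h \<otimes> (h \<otimes> b) = b"
        using hG that by (simp flip: m_assoc)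
      then show ?thesis
        using hG that by (simp add: inv_mult_group m_assoc)
    qed
    have "steps G r (map (mult G h) zs) = steps G r zs"
      unfolding steps_def by (rule restrict_ext) (simp add: clip cancel c)
    then show ?thesis
      using True c[of 0] clip[of 0] Ind_equivariant[OF I.cochain_closed[OF F steps_tuples] h] by (simp add: shp_eq)
  next
    case False
    then show ?thesis
      using H_subset[OF h] by (simp add: shp_wrong_length)
  qed
next
  let ?X = "product_topology (\<lambda>_. gtop G) {..<Suc r}"
  let ?w = "\<lambda>x. \<lambda>i\<in>{..<r}. inv clip G (x i) \<otimes> clip G (x (Suc i))"
  have co: "continuous_map ?X (gtop G) (\<lambda>x. clip G (x i))" if "i < Suc r" for i
    by (rule continuous_map_eq[OF continuous_map_coordinate[OF that]]) (use that in \<open>simp add: PiE_iff\<close>)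
  have "continuous_map ?X (discrete_topology (carrier A))
      (\<lambda>x. F (?w x) (clip G (x 0)))"
  proof (rule continuous_map_Ind_eval[OF I.continuous_map_cochain[OF F] co])
    fix i assume i: "i < r"
    have "continuous_map ?X (gtop G) (\<lambda>x. inv clip G (x i) \<otimes> clip G (x (Suc i)))"
      by (intro continuous_map_mult continuous_map_inv co) (use i in auto)
    then show "continuous_map ?X (gtop G) (\<lambda>x. (?w x) i)"
      using i by simp
  qed simp_all
  moreover have "shp r F (map x [0..<Suc r]) = F (?w x) (clip G (x 0))" for x
  proof -
    have "steps G r (map x [0..<Suc r]) = (?w x)"
      unfolding steps_def by (rule restrict_ext) (simp del: upt_Suc)
    moreover have "map x [0..<Suc r] ! 0 = x 0"
      by (simp del: upt_Suc)
    ultimately show ?thesis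
      by (simp add: shp_eq del: upt_Suc)
  qed
  ultimately show "continuous_map ?X (discrete_topology (carrier A)) (\<lambda>x. shp r F (map x [0..<Suc r]))"
    by (simp only:)
qed

text \<open>The inverse construction: F(x)(y) is the value of \<psi> at the vertices that start at y
  and have steps x.\<close>

lemma hcochain_imp_shp:
  assumes \<psi>: "hcochain r \<psi>"
  shows "\<exists>F\<in>carrier (CI r). \<forall>zs. shp r F zs = \<psi> zs"
proof
  define F where "F = (\<lambda>x. \<lambda>y\<in>carrier G. \<psi> (walk G r y x))"
  have mem: "F x \<in> carrier I" if x: "x \<in> tuples G r" for x
    unfolding F_def
  proof (rule IndI)
    show "continuous_map (gtop G) (discrete_topology (carrier A)) (\<lambda>y. \<psi> (walk G r y x))"
      by (rule hcochain_continuous_walk[OF \<psi>]) (use x in \<open>auto simp: tuples_mem\<close>)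
    fix h y assume h: "h \<in> H" and y: "y \<in> carrier G"
    have "walk G r (h \<otimes> y) x = map (mult G h) (walk G r y x)"
      using H_subset[OF h] y x by (auto simp: walk_def m_assoc)
    moreover have "set (walk G r y x) \<subseteq> carrier G"
      using x y by (auto simp: walk_def)
    ultimately show "\<psi> (walk G r (h \<otimes> y) x) = act A h (\<psi> (walk G r y x))"
      using \<psi> h by (simp add: hcochain_def)
  qed
  show Fc: "(\<lambda>x\<in>tuples G r. F x) \<in> carrier (CI r)"
  proof (intro I.cochainI continuous_map_into_Ind)
    fix t assume t: "t \<in> carrier G"
    have "continuous_map (product_topology (\<lambda>_. gtop G) {..<r}) (discrete_topology (carrier A)) (\<lambda>x. \<psi> (walk G r t x))"
      by (rule hcochain_continuous_walk[OF \<psi>])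
        (use t in \<open>auto intro: continuous_map_coordinate simp: tuples_def\<close>)
    then show "continuous_map (product_topology (\<lambda>_. gtop G) {..<r}) (discrete_topology (carrier A)) (\<lambda>x. F x t)"
      using t by (simp add: F_def)
  qed (use mem in \<open>simp add: tuples_def\<close>)
  show "\<forall>zs. shp r (\<lambda>x\<in>tuples G r. F x) zs = \<psi> zs"
  proof
    fix zs
    show "shp r (\<lambda>x\<in>tuples G r. F x) zs = \<psi> zs"
      using \<psi> by (cases "length zs = Suc r")
        (auto simp: shp_eq shp_wrong_length F_def walk_steps hcochain_def)
  qed
qed

text \<open>Extends a cochain of H to vertices in G. Since the retraction commutes with left
  translation by H, the extension is H-equivariant and so is a cochain of G in the induced
  module.\<close>

lemma hcochain_hmg_retract:
  assumes u: "u \<in> carrier (cochains K A r)"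
  shows "hcochain r (\<lambda>zs. hmg K A r u (map retract zs))"
  unfolding hcochain_def
proof (intro conjI allI ballI impI)
  fix zs :: "'g list"
  show "hmg K A r u (map retract zs) \<in> carrier A"
    using u by (rule KM.hmg_closed)
  show "length zs \<noteq> Suc r \<Longrightarrow> hmg K A r u (map retract zs) = \<one>\<^bsub>A\<^esub>"
    by (simp add: hmg_def)
  show "hmg K A r u (map retract (map (clip G) zs)) = hmg K A r u (map retract zs)"
    by (simp add: o_def)
  fix h assume h: "h \<in> H" and zs: "set zs \<subseteq> carrier G"
  show "hmg K A r u (map retract (map (mult G h) zs)) = act A h (hmg K A r u (map retract zs))"
  proof (cases "length zs = Suc r")
    case True
    have c: "zs ! i \<in> carrier G" if "i \<le> r" for i
      using zs True that nth_mem[of i zs] by auto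
    have hG: "h \<in> carrier G" using h by (rule H_subset)
    have clipK: "clip K a = a" if "a \<in> H" for a
      using that by (simp add: clip_def)
    have clipz: "clip K (map retract (map (mult G h) zs) ! i) = h \<otimes> retract (zs ! i)"
      "clip K (map retract zs ! i) = retract (zs ! i)" if "i \<le> r" for i
      using True c[OF that] h that by (simp_all add: clipK retract_H_mult)
    have cancel: "inv\<^bsub>K\<^esub> (h \<otimes> a) \<otimes> (h \<otimes> b) = inv\<^bsub>K\<^esub> a \<otimes> b" if "a \<in> H" "b \<in> H" for a b
    proof -
      have "inv h \<otimes> (h \<otimes> b) = b"
        using hG H_subset that by (simp flip: m_assoc)
      then show ?thesis
        using h hG H_subset that by (simp add: inv_K inv_mult_group m_assoc)
    qed
    have s: "steps K r (map retract (map (mult G h) zs)) = steps K r (map retract zs)"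
      unfolding steps_def by (rule restrict_ext) (simp only: clipz cancel lessThan_iff less_imp_le
          Suc_leI subtopgroup_simps retract_H)
    show ?thesis
      using True h KM.act_mult[of h "retract (zs ! 0)"] KM.cochain_closed[OF u K.steps_tuples]
      by (simp only: hmg_def s length_map clipz if_True simp_thms subtopgroup_simps retract_H le0)
  next
    case False
    then show ?thesis
      using h KM.act_unit[of h] by (simp add: hmg_def)
  qed
next
  let ?X = "product_topology (\<lambda>_. gtop G) {..<Suc r}"
  let ?w = "\<lambda>x. \<lambda>i\<in>{..<r}. inv\<^bsub>K\<^esub> retract (x i) \<otimes>\<^bsub>K\<^esub> retract (x (Suc i))"
  have co: "continuous_map ?X (gtop K) (\<lambda>x. retract (x i))" if "i < Suc r" for i
    using continuous_map_compose[OF continuous_map_coordinate[OF that] continuous_map_retract_K]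
    by (simp only: o_def)
  have "continuous_map ?X (discrete_topology (carrier A))
      (\<lambda>x. act A (retract (x 0)) (u (?w x)))"
  proof (rule KM.continuous_map_act[OF co KM.continuous_map_cochain[OF u]])
    fix i assume i: "i < r"
    have "continuous_map ?X (gtop K) (\<lambda>x. inv\<^bsub>K\<^esub> retract (x i) \<otimes>\<^bsub>K\<^esub> retract (x (Suc i)))"
      by (intro K.continuous_map_mult K.continuous_map_inv co) (use i in auto)
    then show "continuous_map ?X (gtop K) (\<lambda>x. ?w x i)"
      using i by simp
  qed simp_all
  moreover have "hmg K A r u (map retract (map x [0..<Suc r]))
      = act A (retract (x 0)) (u (?w x))" for x
  proof -
    have clipK: "clip K (retract a) = retract a" for a
      by (simp add: clip_def)
    have "steps K r (map retract (map x [0..<Suc r])) = ?w x"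
      unfolding steps_def by (rule restrict_ext) (simp add: clipK del: upt_Suc)
    moreover have "map retract (map x [0..<Suc r]) ! 0 = retract (x 0)"
      by (simp del: upt_Suc)
    ultimately show ?thesis
      by (simp add: hmg_def clipK del: upt_Suc)
  qed
  ultimately show "continuous_map ?X (discrete_topology (carrier A)) (\<lambda>x. hmg K A r u (map retract (map x [0..<Suc r])))"
    by (simp only:)
qed

text \<open>The homotopy stays inside the H-equivariant continuous cochains because the retraction
  is equivariant and continuous.\<close>

lemma hcochain_hprism:
  assumes \<psi>: "hcochain (Suc r) \<psi>"
  shows "hcochain r (hprism A retract \<psi>)"
  unfolding hcochain_def
proof (intro conjI allI ballI impI)
  have c: "\<psi> zs \<in> carrier A" for zs
    using \<psi> by (simp add: hcochain_def)
  fix zs :: "'g list"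
  show "hprism A retract \<psi> zs \<in> carrier A"
    by (simp add: c)
  show "hprism A retract \<psi> zs = \<one>\<^bsub>A\<^esub>" if "length zs \<noteq> Suc r"
    using \<psi> that by (intro M.hprism_eq_one) (auto simp: hcochain_def)
  have id: "group_hom A A (\<lambda>a. a)"
    by unfold_locales (simp add: hom_def)
  show "hprism A retract \<psi> (map (clip G) zs) = hprism A retract \<psi> zs"
    by (rule M.hprism_map_hom[OF id, where S = UNIV]) (use \<psi> c in \<open>auto simp: hcochain_def\<close>)
  fix h assume h: "h \<in> H" and zs: "set zs \<subseteq> carrier G"
  show "hprism A retract \<psi> (map (mult G h) zs) = act A h (hprism A retract \<psi> zs)"
    by (rule M.hprism_map_hom[OF act_group_hom[OF H_subset[OF h]], where S = "carrier G"])
      (use \<psi> c h zs in \<open>auto simp: hcochain_def retract_H_mult\<close>)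
next
  let ?X = "product_topology (\<lambda>_. gtop G) {..<Suc r}"
  \<comment> \<open>Generalised over a prefix \<open>ps\<close>: the recursion of the prism moves
    heads unchanged into the argument of \<psi>, so the induction has to carry them along.\<close>
  have gen: "continuous_map ?X (discrete_topology (carrier A))
      (\<lambda>x. hprism A retract (\<lambda>ws. \<psi> (map (\<lambda>f. f x) ps @ ws)) (map (\<lambda>f. f x) fs))"
    if "\<And>f. f \<in> set ps \<union> set fs \<Longrightarrow> continuous_map ?X (gtop G) f" for ps fs
    using that
  proof (induction fs arbitrary: ps)
    case Nil
    then show ?case by simp
  next
    case (Cons f fs)
    have r: "continuous_map ?X (gtop G) (\<lambda>x. retract (k x))" if "k \<in> set (f # fs)" for k
      using continuous_map_compose[OF Cons.prems[of k] continuous_map_retract] that by (auto simp: o_def)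
    have 1: "continuous_map ?X (discrete_topology (carrier A))
      (\<lambda>x. \<psi> (map (\<lambda>k. k x) (ps @ f # map (\<lambda>k x. retract (k x)) (f # fs))))"
      by (rule hcochain_continuous[OF \<psi>]) (use Cons.prems r in auto)
    have 2: "continuous_map ?X (discrete_topology (carrier A))
      (\<lambda>x. hprism A retract (\<lambda>ws. \<psi> (map (\<lambda>k. k x) (ps @ [f]) @ ws)) (map (\<lambda>k. k x) fs))"
      by (rule Cons.IH) (use Cons.prems in auto)
    show ?case
      using continuous_map_module_mult[OF 1 continuous_map_module_inv[OF 2]] by (simp add: o_def)
  qed
  have "continuous_map ?X (discrete_topology (carrier A))
      (\<lambda>x. hprism A retract (\<lambda>ws. \<psi> (map (\<lambda>f. f x) [] @ ws)) (map (\<lambda>f. f x) (map (\<lambda>i x. x i) [0..<Suc r])))"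
    by (rule gen) (auto intro: continuous_map_coordinate simp del: upt_Suc)
  then show "continuous_map ?X (discrete_topology (carrier A)) (\<lambda>x. hprism A retract \<psi> (map x [0..<Suc r]))"
    by (simp add: o_def del: upt_Suc)
qed

section \<open>The Shapiro map; corestriction and restriction on representatives\<close>

lemma shapiro_coh_class:
  assumes "F \<in> carrier (CI r)"
  shows "shapiro G H A r (coh_class G I r F) = coh_class K A r (push K r (\<lambda>c. c \<one>) F)"
  using ev.coh_class_push_some[OF assms] by (simp add: shapiro_def push_def)

lemma walk_K: "walk K r y x = walk G r y x"
  by (simp add: walk_def ev.tuple_prod_eq)

text \<open>Surjectivity on cocycles and not only on classes: \<open>u\<close> is extended along the
  retraction, which fixes the vertices in H, so evaluation returns \<open>u\<close> itself.\<close>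

lemma shapiro_surj:
  assumes u: "u \<in> cocycles K A r"
  shows "\<exists>F\<in>cocycles G I r. push K r (\<lambda>c. c \<one>) F = u"
proof -
  have uc: "u \<in> carrier (cochains K A r)" and du: "coboundary K A r u = \<one>\<^bsub>cochains K A (Suc r)\<^esub>"
    using u by (auto simp: cocycles_iff)
  obtain F where F: "F \<in> carrier (CI r)" and shp: "\<And>zs. shp r F zs = hmg K A r u (map retract zs)"
    using hcochain_imp_shp[OF hcochain_hmg_retract[OF uc]] by blast
  have shp': "shp r F = (\<lambda>zs. hmg K A r u (map retract zs))"
    using shp by (rule ext)
  have "coboundary G I r F = \<one>\<^bsub>CI (Suc r)\<^esub>"
  proof (rule shp_inject)
    fix zs
    have "hdiff A (shp r F) zs = hdiff A (hmg K A r u) (map retract zs)"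
      unfolding shp' by (rule M.hdiff_map)
    also have "\<dots> = \<one>\<^bsub>A\<^esub>"
      by (simp add: du flip: KM.hmg_coboundary[OF uc])
    finally show "shp (Suc r) (coboundary G I r F) zs = shp (Suc r) \<one>\<^bsub>CI (Suc r)\<^esub> zs"
      by (simp add: shp_coboundary[OF F])
  qed (use F I.coboundary_closed I.coboundaries_closed[OF I.one_coboundaries] in auto)
  moreover have "push K r (\<lambda>c. c \<one>) F = u"
  proof (rule KM.cochain_eqI[of _ r])
    fix x assume x: "x \<in> tuples K r"
    \<comment> \<open>A walk from the unit with steps in H stays in H, where the retraction is the
      identity.\<close>
    have "set (walk K r \<one> x) \<subseteq> H"
      using x K.tuple_prod_closed[OF x] by (auto simp: walk_def ev.tuple_prod_eq)
    then have "map retract (walk K r \<one> x) = walk K r \<one> x"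
      using retract_id by (auto intro!: map_idI)
    then have "F x \<one> = hmg K A r u (walk K r \<one> x)"
      using shp[of "walk G r \<one> x"] shp_walk[of \<one> x r F] ev.tuples_subset[OF x] by (simp add: walk_K)
    also have "\<dots> = u x"
      using KM.hmg_walk[OF uc _ x, of \<one>] KM.act_one KM.cochain_closed[OF uc x] by simp
    finally show "push K r (\<lambda>c. c \<one>) F x = u x"
      using x by (simp add: push_def)
  qed (use uc KM.cochain_extensional in \<open>auto simp: push_def\<close>)
  ultimately show ?thesis
    using F by (auto simp: cocycles_iff)
qed

text \<open>For a base point z0 in H, equivariance gives F(x)(z0) = z0 F(x)(1): on vertices in H, F
  is determined by its evaluation.\<close>

lemma hmg_push_eval:
  assumes F: "F \<in> carrier (CI r)" and zs: "set zs \<subseteq> H"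
  shows "hmg K A r (push K r (\<lambda>c. c \<one>) F) zs = shp r F zs"
proof (cases "length zs = Suc r")
  case True
  have c: "zs ! i \<in> H" if "i \<le> r" for i
    using zs True that nth_mem[of i zs] by auto
  have "steps K r zs = steps G r zs"
    using c H_subset by (auto simp: steps_def clip_def inv_K)
  moreover have "shp r F zs = act A (zs ! 0) (F (steps G r zs) \<one>)"
    using True c[of 0] H_subset Ind_equivariant[OF I.cochain_closed[OF F steps_tuples], of "zs ! 0" \<one> zs]
    by (simp add: shp_eq)
  ultimately show ?thesis
    using True c[of 0] K.steps_tuples[of r zs] by (simp add: hmg_def push_def clip_def)
qed (simp add: shp_wrong_length hmg_def)

text \<open>F is a cocycle, so the homotopy writes it as its retracted version minus the coboundary
  of the prism. The retracted version sees only the evaluation of F, which bounds.\<close>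

lemma shapiro_inj:
  assumes F: "F \<in> cocycles G I r" and e: "push K r (\<lambda>c. c \<one>) F \<in> coboundaries K A r"
  shows "F \<in> coboundaries G I r"
proof -
  have Fc: "F \<in> carrier (CI r)" and dF: "coboundary G I r F = \<one>\<^bsub>CI (Suc r)\<^esub>"
    using F by (auto simp: cocycles_iff)
  have "hdiff A (shp r F) = (\<lambda>_. \<one>\<^bsub>A\<^esub>)"
    using shp_coboundary[OF Fc] by (simp add: dF fun_eq_iff)
  then have prism: "hdiff A (hprism A retract (shp r F)) zs = shp r F (map retract zs) \<otimes>\<^bsub>A\<^esub> inv\<^bsub>A\<^esub> shp r F zs" for zs
    using M.hprism_homotopy[of "shp r F" retract zs] Fc by simp
  have retr: "shp r F (map retract zs) = hmg K A r (push K r (\<lambda>c. c \<one>) F) (map retract zs)" for zs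
    by (rule hmg_push_eval[OF Fc, symmetric]) auto
  show ?thesis
  proof (cases r)
    case 0
    \<comment> \<open>In degree 0 the prism would have degree -1: it evaluates F on at least two
      vertices, where F takes its default value.\<close>
    have "hprism A retract (shp r F) zs = \<one>\<^bsub>A\<^esub>" for zs
    proof (cases zs)
      case (Cons x xs)
      then show ?thesis
        by (intro M.hprism_eq_one shp_wrong_length) (simp add: 0)
    qed simp
    then have "hprism A retract (shp r F) = (\<lambda>_. \<one>\<^bsub>A\<^esub>)" ..
    moreover have "shp r F (map retract zs) = \<one>\<^bsub>A\<^esub>" for zs
      unfolding retr using e 0 by (simp add: coboundaries_def)
    ultimately have "inv\<^bsub>A\<^esub> shp r F zs = \<one>\<^bsub>A\<^esub>" for zs
      using prism[of zs] Fc by simp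
    then have "shp r F zs = shp r \<one>\<^bsub>CI r\<^esub> zs" for zs
      using Fc M.inv_eq_1_iff[of "shp r F zs"] by simp
    then have "F = \<one>\<^bsub>CI r\<^esub>"
      by (intro shp_inject[OF Fc I.coboundaries_closed[OF I.one_coboundaries]])
    then show ?thesis
      using I.one_coboundaries by simp
  next
    case (Suc q)
    with e obtain v where v: "v \<in> carrier (cochains K A q)" "push K r (\<lambda>c. c \<one>) F = coboundary K A q v"
      by (auto simp: coboundaries_def)
    obtain V where V: "V \<in> carrier (CI q)" "\<And>zs. shp q V zs = hmg K A q v (map retract zs)"
      using hcochain_imp_shp[OF hcochain_hmg_retract[OF v(1)]] by blast
    have "hcochain (Suc q) (shp r F)"
      using hcochain_shp[OF Fc] Suc by simp
    then obtain U where U: "U \<in> carrier (CI q)" "\<And>zs. shp q U zs = hprism A retract (shp r F) zs"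
      using hcochain_imp_shp[OF hcochain_hprism] by blast
    have V': "shp q V = (\<lambda>zs. hmg K A q v (map retract zs))"
      using V(2) by (rule ext)
    have U': "shp q U = hprism A retract (shp r F)"
      using U(2) by (rule ext)
    interpret N: comm_group "CI r" by (rule I.comm_group_cochains)
    have cb: "coboundary G I q V \<in> coboundaries G I r" "coboundary G I q U \<in> coboundaries G I r"
      using V U Suc by (auto simp: coboundaries_def)
    \<comment> \<open>V extends along the retraction the cochain v bounded by the evaluation, and U
      is the prism of F.\<close>
    have "F = coboundary G I q V \<otimes>\<^bsub>CI r\<^esub> inv\<^bsub>CI r\<^esub> coboundary G I q U"
    proof (rule shp_inject[OF Fc])
      show "coboundary G I q V \<otimes>\<^bsub>CI r\<^esub> inv\<^bsub>CI r\<^esub> coboundary G I q U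
        \<in> carrier (CI r)"
        using cb I.coboundaries_closed by simp
      fix zs
      have "shp r (coboundary G I q V) zs = hdiff A (hmg K A q v) (map retract zs)"
        unfolding Suc shp_coboundary[OF V(1)] V' by (rule M.hdiff_map)
      also have "\<dots> = shp r F (map retract zs)"
        unfolding retr v(2) using KM.hmg_coboundary[OF v(1)] by (simp add: Suc)
      finally have 1: "shp r (coboundary G I q V) zs = shp r F (map retract zs)" .
      have 2: "shp r (coboundary G I q U) zs = shp r F (map retract zs) \<otimes>\<^bsub>A\<^esub> inv\<^bsub>A\<^esub> shp r F zs"
        using prism[of zs] shp_coboundary[OF U(1)] by (simp add: Suc U')
      show "shp r F zs = shp r (coboundary G I q V \<otimes>\<^bsub>CI r\<^esub> inv\<^bsub>CI r\<^esub> coboundary G I q U) zs"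
        using cb I.coboundaries_closed Fc by (simp add: shp_mult_inv 1 2 M.group_ac)
    qed
    then show ?thesis
      using cb subgroup.m_closed[OF I.subgroup_coboundaries] subgroup.m_inv_closed[OF I.subgroup_coboundaries]
      by simp
  qed
qed

text \<open>Reduces to trivial kernel by applying \<open>shapiro_inj\<close> to the quotient of two
  representing cocycles.\<close>

lemma inj_on_shapiro: "inj_on (shapiro G H A r) (carrier (cohomology G I r))"
proof (rule inj_onI)
  fix \<alpha> \<beta> assume "\<alpha> \<in> carrier (cohomology G I r)" "\<beta> \<in> carrier (cohomology G I r)"
    and eq: "shapiro G H A r \<alpha> = shapiro G H A r \<beta>"
  then obtain f g where f: "f \<in> cocycles G I r" "\<alpha> = coh_class G I r f"
    and g: "g \<in> cocycles G I r" "\<beta> = coh_class G I r g"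
    by (auto simp: I.carrier_cohomology)
  have c: "f \<in> carrier (CI r)" "g \<in> carrier (CI r)"
    using f g by (auto simp: cocycles_iff)
  interpret N: comm_group "CI r" by (rule I.comm_group_cochains)
  interpret N': comm_group "CI (Suc r)" by (rule I.comm_group_cochains)
  interpret L: comm_group "cochains K A r" by (rule KM.comm_group_cochains)
  interpret d: group_hom "CI r" "CI (Suc r)" "coboundary G I r"
    by (rule I.coboundary_group_hom)
  interpret p: group_hom "CI r" "cochains K A r" "push K r (\<lambda>c. c \<one>)"
    by unfold_locales (rule ev.push_hom)
  let ?h = "f \<otimes>\<^bsub>CI r\<^esub> inv\<^bsub>CI r\<^esub> g"
  have "coh_class K A r (push K r (\<lambda>c. c \<one>) f) = coh_class K A r (push K r (\<lambda>c. c \<one>) g)"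
    using eq f g c by (simp add: shapiro_coh_class)
  then obtain b where b: "b \<in> coboundaries K A r"
    "push K r (\<lambda>c. c \<one>) f = b \<otimes>\<^bsub>cochains K A r\<^esub> push K r (\<lambda>c. c \<one>) g"
    using KM.coh_class_eqD[OF ev.push_closed[OF c(1)]] by blast
  have "?h \<in> cocycles G I r"
    using f g c by (simp add: cocycles_iff d.hom_mult d.hom_inv)
  moreover have "push K r (\<lambda>c. c \<one>) ?h = b"
    using b c KM.coboundaries_closed[OF b(1)] by (simp add: p.hom_mult p.hom_inv L.m_assoc)
  ultimately have "?h \<in> coboundaries G I r"
    using shapiro_inj b by blast
  moreover have "f = ?h \<otimes>\<^bsub>CI r\<^esub> g"
    using c by (simp add: N.m_assoc)
  ultimately show "\<alpha> = \<beta>"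
    using I.coh_class_eqI[OF c(2)] f g by metis
qed

text \<open>Evaluates \<open>cor\<close> without computing an inverse: once a cocycle F with the
  given evaluation is known, injectivity of the Shapiro map determines the value of
  \<open>inv_into\<close>.\<close>

lemma cor_coh_class:
  assumes F: "F \<in> cocycles G I r"
  shows "cor G H A r (coh_class K A r (push K r (\<lambda>c. c \<one>) F)) = coh_class G A r (push G r (ind_trace G H A) F)"
proof -
  have Fc: "F \<in> carrier (CI r)"
    using F by (simp add: cocycles_iff)
  have "coh_class G I r F \<in> carrier (cohomology G I r)"
    using F by (simp add: I.carrier_cohomology)
  then have "inv_into (carrier (cohomology G I r)) (shapiro G H A r)
      (coh_class K A r (push K r (\<lambda>c. c \<one>) F)) = coh_class G I r F"
    using inv_into_f_f[OF inj_on_shapiro] shapiro_coh_class[OF Fc] by metis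
  then show ?thesis
    unfolding cor_def by (simp add: coh_push_coh_class[OF ind_trace_hom Fc])
qed

text \<open>Recovers the naive restriction of cochains: the embedding of a into the induced module
  has value 1a = a at the unit.\<close>

lemma res_coh_class:
  assumes f: "f \<in> carrier (cochains G A r)"
  shows "res G H A r (coh_class G A r f) = coh_class K A r (push K r (\<lambda>a. a) f)"
proof -
  have "push G r (ind_incl G A) f \<in> carrier (CI r)"
    by (rule gmodule_hom.push_closed[OF ind_incl_hom f])
  moreover have "push K r (\<lambda>c. c \<one>) (push G r (ind_incl G A) f) = push K r (\<lambda>a. a) f"
    unfolding push_def
    by (rule restrict_ext) (simp add: ev.tuples_subset ind_incl_def cochain_closed[OF f])
  ultimately show ?thesis
    by (simp add: res_def coh_push_coh_class[OF ind_incl_hom f] shapiro_coh_class)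
qed

end

section \<open>The induced Tate product\<close>

definition ind_map :: "'g topgroup \<Rightarrow> ('a \<Rightarrow> 'b) \<Rightarrow> ('g \<Rightarrow> 'a) \<Rightarrow> ('g \<Rightarrow> 'b)" where
  "ind_map G \<phi> c = (\<lambda>x\<in>carrier G. \<phi> (c x))"

text \<open>The twist of b by x is what keeps the result H-equivariant in x: both factors at hx are
  h times those at x.\<close>

definition ind_pair :: "'g topgroup \<Rightarrow> ('g, 'b) gmodule \<Rightarrow> ('a \<Rightarrow> 'b \<Rightarrow> 'c) \<Rightarrow> ('g \<Rightarrow> 'a) \<Rightarrow> 'b \<Rightarrow> ('g \<Rightarrow> 'c)" where
  "ind_pair G B p c b = (\<lambda>x\<in>carrier G. p (c x) (act B x b))"

definition ind_tate :: "'g topgroup \<Rightarrow> 'g set \<Rightarrow> ('g, 'a1, 'a, 'a2, 'b1, 'b, 'b2, 'c) tate \<Rightarrow>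
    ('g, 'g \<Rightarrow> 'a1, 'g \<Rightarrow> 'a, 'g \<Rightarrow> 'a2, 'b1, 'b, 'b2, 'g \<Rightarrow> 'c) tate" where
  "ind_tate G H P =
     \<lparr>A_sub = Ind G H (A_sub P), A_mid = Ind G H (A_mid P), A_quot = Ind G H (A_quot P),
      A_inj = ind_map G (A_inj P), A_proj = ind_map G (A_proj P),
      B_sub = B_sub P, B_mid = B_mid P, B_quot = B_quot P, B_inj = B_inj P, B_proj = B_proj P,
      C_mod = Ind G H (C_mod P),
      sub_mid = ind_pair G (B_mid P) (sub_mid P), mid_sub = ind_pair G (B_sub P) (mid_sub P)\<rparr>"

lemma ind_tate_simps [simp]:
  "A_sub (ind_tate G H P) = Ind G H (A_sub P)" "A_mid (ind_tate G H P) = Ind G H (A_mid P)"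
  "A_quot (ind_tate G H P) = Ind G H (A_quot P)"
  "A_inj (ind_tate G H P) = ind_map G (A_inj P)" "A_proj (ind_tate G H P) = ind_map G (A_proj P)"
  "B_sub (ind_tate G H P) = B_sub P" "B_mid (ind_tate G H P) = B_mid P" "B_quot (ind_tate G H P) = B_quot P"
  "B_inj (ind_tate G H P) = B_inj P" "B_proj (ind_tate G H P) = B_proj P"
  "C_mod (ind_tate G H P) = Ind G H (C_mod P)"
  "sub_mid (ind_tate G H P) = ind_pair G (B_mid P) (sub_mid P)"
  "mid_sub (ind_tate G H P) = ind_pair G (B_sub P) (mid_sub P)"
  by (simp_all add: ind_tate_def)

context open_subgroup
begin

lemma induced_moduleI: "discrete_gmodule G A \<Longrightarrow> induced_module G H A"
  by (intro induced_module.intro open_subgroup_axioms)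

lemma discrete_module_K: "discrete_module G A \<Longrightarrow> discrete_module K A"
  using discrete_gmodule_K[of A]
  by (simp add: discrete_gmodule_def discrete_gmodule_axioms_def topgrp_axioms)

lemma ind_map_hom:
  assumes "gmodule_hom G G A B \<phi>"
  shows "gmodule_hom G G (Ind G H A) (Ind G H B) (ind_map G \<phi>)"
proof -
  interpret \<phi>: gmodule_hom G G A B \<phi> by fact
  interpret A: induced_module G H A by (rule induced_moduleI) (rule \<phi>.A.discrete_gmodule_axioms)
  interpret B: induced_module G H B by (rule induced_moduleI) (rule \<phi>.B.discrete_gmodule_axioms)
  show ?thesis
  proof
    have cl: "ind_map G \<phi> c \<in> carrier (Ind G H B)" if c: "c \<in> carrier (Ind G H A)" for c
      unfolding ind_map_def
    proof (rule B.IndI)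
      show "continuous_map (gtop G) (discrete_topology (carrier B)) (\<lambda>x. \<phi> (c x))"
        by (rule continuous_map_discrete_unop) (use c A.carrier_Ind in auto)
      fix h x assume "h \<in> H" "x \<in> carrier G"
      then show "\<phi> (c (h \<otimes> x)) = act B h (\<phi> (c x))"
        using c H_subset by (simp add: A.Ind_equivariant \<phi>.equivariantD)
    qed
    show "ind_map G \<phi> \<in> hom (Ind G H A) (Ind G H B)"
      by (intro homI cl B.Ind_eqI) (auto simp: ind_map_def A.mult_Ind B.mult_Ind \<phi>.map_mult B.extensional_Ind)
    show "equivariant G (Ind G H A) (Ind G H B) (ind_map G \<phi>)"
      unfolding equivariant_def
      by (intro ballI B.Ind_eqI) (auto simp: ind_map_def A.act_Ind B.act_Ind B.extensional_Ind)
  qed auto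
qed

text \<open>Preimages under \<open>i\<close> are unique, so pointwise preimages are automatically
  H-equivariant. Preimages under \<open>j\<close> are not, so they are chosen at coset
  representatives only and spread by the action.\<close>

lemma short_exact_Ind:
  assumes "short_exact_sequence G A' A A'' i j"
  shows "short_exact G (Ind G H A') (Ind G H A) (Ind G H A'') (ind_map G i) (ind_map G j)"
proof -
  interpret S: short_exact_sequence G A' A A'' i j by fact
  interpret I': induced_module G H A' by (rule induced_moduleI) (rule S.sub.discrete_gmodule_axioms)
  interpret I: induced_module G H A by (rule induced_moduleI) (rule S.mid.discrete_gmodule_axioms)
  interpret I'': induced_module G H A'' by (rule induced_moduleI) (rule S.quot.discrete_gmodule_axioms)
  interpret i: gmodule_hom G G "Ind G H A'" "Ind G H A" "ind_map G i"
    by (rule ind_map_hom[OF S.i.gmodule_hom_axioms])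
  interpret j: gmodule_hom G G "Ind G H A" "Ind G H A''" "ind_map G j"
    by (rule ind_map_hom[OF S.j.gmodule_hom_axioms])
  have inj: "inj_on (ind_map G i) (carrier (Ind G H A'))"
  proof (rule inj_onI)
    fix c d assume c: "c \<in> carrier (Ind G H A')" and d: "d \<in> carrier (Ind G H A')"
      and eq: "ind_map G i c = ind_map G i d"
    show "c = d"
    proof (rule I'.Ind_eqI)
      fix x assume "x \<in> carrier G"
      then show "c x = d x"
        using fun_cong[OF eq, of x] inj_onD[OF S.inj_i] c d by (simp add: ind_map_def)
    qed (use c d I'.carrier_Ind in blast)+
  qed
  have ker1: "ind_map G j (ind_map G i c) = \<one>\<^bsub>Ind G H A''\<^esub>" if c: "c \<in> carrier (Ind G H A')" for c
    by (rule I''.Ind_eqI) (use c in \<open>auto simp: ind_map_def I''.one_Ind I''.extensional_Ind\<close>)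
  have ker2: "c \<in> ind_map G i ` carrier (Ind G H A')"
    if c: "c \<in> carrier (Ind G H A)" and jc: "ind_map G j c = \<one>\<^bsub>Ind G H A''\<^esub>" for c
  proof
    let ?s = "inv_into (carrier A') i"
    have k: "j (c x) = \<one>\<^bsub>A''\<^esub>" if "x \<in> carrier G" for x
      using fun_cong[OF jc, of x] that by (simp add: ind_map_def I''.one_Ind)
    have s: "?s (c x) \<in> carrier A'" "i (?s (c x)) = c x" if "x \<in> carrier G" for x
      using S.inv_i k c that by auto
    show "c = ind_map G i (ind_map G ?s c)"
      by (rule I.Ind_eqI) (use s c I.carrier_Ind in \<open>auto simp: ind_map_def\<close>)
    have cc: "continuous_map (gtop G) (discrete_topology (carrier A)) c"
      using c I.carrier_Ind by blast
    show "ind_map G ?s c \<in> carrier (Ind G H A')"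
      unfolding ind_map_def
    proof (rule I'.IndI)
      show "continuous_map (gtop G) (discrete_topology (carrier A')) (\<lambda>x. ?s (c x))"
        \<comment> \<open>\<open>?s\<close> has values in A' only on the image of \<open>i\<close>,
          so it cannot be composed as a map on all of A; local constancy of \<open>c\<close> passes
          to the composite directly.\<close>
        unfolding continuous_map_discrete_iff
      proof (intro conjI ballI)
        fix x0 assume "x0 \<in> topspace (gtop G)"
        from conjunct2[OF cc[unfolded continuous_map_discrete_iff], THEN bspec, OF this]
        obtain U where "openin (gtop G) U \<and> x0 \<in> U \<and> (\<forall>x\<in>U. c x = c x0)" ..
        then have "openin (gtop G) U \<and> x0 \<in> U \<and> (\<forall>x\<in>U. ?s (c x) = ?s (c x0))"
          by metis
        then show "\<exists>U. openin (gtop G) U \<and> x0 \<in> U \<and> (\<forall>x\<in>U. ?s (c x) = ?s (c x0))" ..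
      qed (use s in auto)
      fix h x assume h: "h \<in> H" and x: "x \<in> carrier G"
      then have hG: "h \<in> carrier G" "h \<otimes> x \<in> carrier G"
        using H_subset by auto
      show "?s (c (h \<otimes> x)) = act A' h (?s (c x))"
        by (rule inj_onD[OF S.inj_i])
          (use s[OF x] s[OF hG(2)] hG h x c in \<open>simp_all add: S.i.equivariantD I.Ind_equivariant\<close>)
    qed
  qed
  have surj: "c \<in> ind_map G j ` carrier (Ind G H A)" if c: "c \<in> carrier (Ind G H A'')" for c
  proof
    let ?s = "inv_into (carrier A) j"
    have s: "?s a \<in> carrier A" "j (?s a) = a" if "a \<in> carrier A''" for a
      using that S.surj_j by (auto intro: inv_into_into f_inv_into_f)
    \<comment> \<open>Spreads the lifts at representatives equivariantly, by x =
      \<open>retract x\<close> \<open>rep x\<close>.\<close>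
    let ?d = "\<lambda>x. act A (retract x) (?s (c (rep x)))"
    have "continuous_map (gtop G) (discrete_topology (carrier A'')) c"
      using c I''.carrier_Ind by blast
    moreover have "continuous_map (gtop G) (gtop G) rep"
      using continuous_map_compose[OF continuous_map_rep, of "gtop G" id] by (simp add: Pi_def)
    ultimately have "continuous_map (gtop G) (discrete_topology (carrier A'')) (\<lambda>x. c (rep x))"
      using continuous_map_compose[of "gtop G" "gtop G" rep] by (simp add: o_def)
    then have "continuous_map (gtop G) (discrete_topology (carrier A)) (\<lambda>x. ?s (c (rep x)))"
      by (rule continuous_map_discrete_unop) (rule s)
    then have "continuous_map (gtop G) (discrete_topology (carrier A)) ?d"
      by (rule S.mid.continuous_map_act[OF continuous_map_retract])
    then show "(\<lambda>x\<in>carrier G. ?d x) \<in> carrier (Ind G H A)"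
      by (rule I.IndI) (use c s H_subset in \<open>auto simp: retract_H_mult rep_H_mult S.mid.act_mult\<close>)
    show "c = ind_map G j (\<lambda>x\<in>carrier G. ?d x)"
    proof (rule I''.Ind_eqI)
      show "c \<in> extensional (carrier G)"
        using c I''.carrier_Ind by blast
      fix x assume x: "x \<in> carrier G"
      then have "j (?d x) = act A'' (retract x) (c (rep x))"
        using c s by (simp add: S.j.equivariantD)
      then show "c x = ind_map G j (\<lambda>x\<in>carrier G. ?d x) x"
        using x I''.Ind_eq_rep[OF c x] by (simp add: ind_map_def)
    qed (simp add: ind_map_def)
  qed
  show ?thesis
    unfolding short_exact_def mon_def epi_def kernel_def
    using i.hom j.hom i.equivariant j.equivariant I'.discrete_module_Ind I.discrete_module_Ind
      I''.discrete_module_Ind inj ker1 ker2 surj i.hom_closed j.hom_closed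
    by blast
qed

text \<open>Equivariance over G amounts to c(yg) \<times> ygb = (gc)(y) \<times> y(gb).\<close>

lemma bilinear_pairing_Ind:
  assumes "gmodule_pairing G A B C p"
  shows "bilinear_pairing G (Ind G H A) B (Ind G H C) (ind_pair G B p)"
proof -
  interpret p: gmodule_pairing G A B C p by fact
  interpret A: induced_module G H A by (rule induced_moduleI) (rule p.A.discrete_gmodule_axioms)
  interpret C: induced_module G H C by (rule induced_moduleI) (rule p.C.discrete_gmodule_axioms)
  have cl: "ind_pair G B p c b \<in> carrier (Ind G H C)" if c: "c \<in> carrier (Ind G H A)" and b: "b \<in> carrier B" for c b
    unfolding ind_pair_def
  proof (rule C.IndI)
    show "continuous_map (gtop G) (discrete_topology (carrier C)) (\<lambda>x. p (c x) (act B x b))"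
    proof (rule continuous_map_discrete_binop[where p = p])
      show "continuous_map (gtop G) (discrete_topology (carrier A)) c"
        using c A.carrier_Ind by blast
      show "continuous_map (gtop G) (discrete_topology (carrier B)) (\<lambda>x. act B x b)"
        using b by (intro p.B.continuous_map_act) auto
    qed auto
    fix h x assume "h \<in> H" "x \<in> carrier G"
    then show "p (c (h \<otimes> x)) (act B (h \<otimes> x) b) = act C h (p (c x) (act B x b))"
      using c b H_subset by (simp add: A.Ind_equivariant p.act_pairing p.B.act_mult)
  qed
  show ?thesis
    unfolding bilinear_pairing_def
  proof (intro conjI ballI)
    fix c assume c: "c \<in> carrier (Ind G H A)"
    show "ind_pair G B p c \<in> hom B (Ind G H C)"
      by (intro homI cl c C.Ind_eqI)
        (use c in \<open>auto simp: ind_pair_def C.mult_Ind C.extensional_Ind p.pairing_mult_right\<close>)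
  next
    fix b assume b: "b \<in> carrier B"
    show "(\<lambda>c. ind_pair G B p c b) \<in> hom (Ind G H A) (Ind G H C)"
      by (intro homI cl b C.Ind_eqI)
        (use b in \<open>auto simp: ind_pair_def A.mult_Ind C.mult_Ind C.extensional_Ind p.pairing_mult_left\<close>)
  next
    fix g c b assume g: "g \<in> carrier G" and c: "c \<in> carrier (Ind G H A)" and b: "b \<in> carrier B"
    show "act (Ind G H C) g (ind_pair G B p c b) = ind_pair G B p (act (Ind G H A) g c) (act B g b)"
      by (rule C.Ind_eqI)
        (use g c b in \<open>auto simp: ind_pair_def A.act_Ind C.act_Ind C.extensional_Ind p.B.act_mult\<close>)
  qed
qed

lemma restriction_hom:
  assumes "discrete_gmodule G A"
  shows "gmodule_hom G K A A (\<lambda>a. a)"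
proof -
  interpret discrete_gmodule G A by fact
  interpret K: discrete_gmodule K A by (rule discrete_gmodule_K) fact
  show ?thesis
  proof
    show "continuous_map (gtop K) (gtop G) (\<lambda>x. x)"
      by (simp add: continuous_map_from_subtopology)
  qed (use H_subset in \<open>auto simp: hom_def equivariant_def\<close>)
qed

lemma identity_hom:
  assumes "discrete_gmodule G A"
  shows "gmodule_hom G G A A (\<lambda>a. a)"
proof -
  interpret discrete_gmodule G A by fact
  show ?thesis
    by unfold_locales (auto simp: hom_def equivariant_def)
qed

lemma ind_trace_natural:
  assumes "gmodule_hom G G A B \<phi>" and c: "c \<in> carrier (Ind G H A)"
  shows "\<phi> (ind_trace G H A c) = ind_trace G H B (ind_map G \<phi> c)"
proof -
  interpret \<phi>: gmodule_hom G G A B \<phi> by fact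
  interpret A: induced_module G H A by (rule induced_moduleI) (rule \<phi>.A.discrete_gmodule_axioms)
  interpret B: induced_module G H B by (rule induced_moduleI) (rule \<phi>.B.discrete_gmodule_axioms)
  have "\<phi> (A.trace_term c X) = B.trace_term (ind_map G \<phi> c) X" if "X \<in> lcosets H" for X
    using A.lcoset_rep[OF that] c
    by (simp add: A.trace_term_def B.trace_term_def ind_map_def \<phi>.equivariantD)
  then show ?thesis
    unfolding A.ind_trace_eq B.ind_trace_eq using c
    by (subst finprod_hom[OF \<phi>.A.M.comm_group_axioms \<phi>.B.M.comm_group_axioms \<phi>.hom])
      (auto simp: A.trace_term_closed finite_lcosets intro!: \<phi>.B.M.finprod_cong'
        B.trace_term_closed gmodule_hom.hom_closed[OF ind_map_hom[OF \<phi>.gmodule_hom_axioms]])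
qed

text \<open>The projection formula for modules, summand by summand: moving x inside the pairing
  cancels the twist x^-1 on b.\<close>

lemma ind_trace_projection:
  assumes "gmodule_pairing G A B C p" and c: "c \<in> carrier (Ind G H A)" and b: "b \<in> carrier B"
  shows "ind_trace G H C (ind_pair G B p c b) = p (ind_trace G H A c) b"
proof -
  interpret p: gmodule_pairing G A B C p by fact
  interpret A: induced_module G H A by (rule induced_moduleI) (rule p.A.discrete_gmodule_axioms)
  interpret C: induced_module G H C by (rule induced_moduleI) (rule p.C.discrete_gmodule_axioms)
  have eq: "C.trace_term (ind_pair G B p c b) X = p (A.trace_term c X) b" if "X \<in> lcosets H" for X
    using A.lcoset_rep[OF that] c b
    by (simp add: A.trace_term_def C.trace_term_def ind_pair_def p.act_pairing)
  have "p (\<Otimes>\<^bsub>A\<^esub>X\<in>lcosets H. A.trace_term c X) b = (\<Otimes>\<^bsub>C\<^esub>X\<in>lcosets H. p (A.trace_term c X) b)"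
    using finprod_hom[OF p.A.M.comm_group_axioms p.C.M.comm_group_axioms p.pairing_hom_left[OF b],
        of "lcosets H" "A.trace_term c"] c
    by (simp add: A.trace_term_closed finite_lcosets)
  also have "\<dots> = (\<Otimes>\<^bsub>C\<^esub>X\<in>lcosets H. C.trace_term (ind_pair G B p c b) X)"
    by (rule p.C.M.finprod_cong') (use eq c b A.trace_term_closed in auto)
  finally show ?thesis
    by (simp add: A.ind_trace_eq C.ind_trace_eq)
qed

end

section \<open>Evaluation and trace as morphisms of Tate products, and the projection
  formula\<close>

locale induced_tate = open_subgroup G H + tate G P
  for G :: "'g topgroup" (structure) and H :: "'g set"
    and P :: "('g, 'a1, 'a, 'a2, 'b1, 'b, 'b2, 'c) tate"
begin

sublocale IA': induced_module G H "A_sub P"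
  by (rule induced_moduleI) (rule A.sub.discrete_gmodule_axioms)

sublocale IA: induced_module G H "A_mid P"
  by (rule induced_moduleI) (rule A.mid.discrete_gmodule_axioms)

sublocale IA'': induced_module G H "A_quot P"
  by (rule induced_moduleI) (rule A.quot.discrete_gmodule_axioms)

sublocale IB'': induced_module G H "B_quot P"
  by (rule induced_moduleI) (rule B.quot.discrete_gmodule_axioms)

sublocale IC: induced_module G H "C_mod P"
  by (rule induced_moduleI) (rule C.discrete_gmodule_axioms)

lemma tate_ind_tate: "tate G (ind_tate G H P)"
proof
  have "ind_pair G (B_mid P) (sub_mid P) c (B_inj P b) = ind_pair G (B_sub P) (mid_sub P) (ind_map G (A_inj P) c) b"
    if "c \<in> carrier (Ind G H (A_sub P))" "b \<in> carrier (B_sub P)" for c b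
    unfolding ind_pair_def
    by (rule restrict_ext) (use that in \<open>simp add: ind_map_def pairings_agree flip: B.i.equivariantD\<close>)
  then show "tate_product G (ind_tate G H P)"
    using tate_product short_exact_Ind[OF A.short_exact_sequence_axioms] IC.discrete_module_Ind
      bilinear_pairing_Ind[OF p.gmodule_pairing_axioms] bilinear_pairing_Ind[OF q.gmodule_pairing_axioms]
    by (simp add: tate_product_def)
qed

lemma short_exact_K:
  assumes "short_exact G M' M M'' i j"
  shows "short_exact K M' M M'' i j"
  using assms H_subset by (auto simp: short_exact_def equivariant_def discrete_module_K)

lemma tate_K: "tate K P"
  by unfold_locales
    (use tate_product H_subset in \<open>simp add: tate_product_def bilinear_pairing_def short_exact_K discrete_module_K\<close>)

sublocale IT: tate G "ind_tate G H P" by (rule tate_ind_tate)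

sublocale TK: tate K P by (rule tate_K)

lemma eval_tate_hom:
  "tate_hom G K (ind_tate G H P) P (\<lambda>c. c \<one>) (\<lambda>c. c \<one>) (\<lambda>c. c \<one>) (\<lambda>b. b) (\<lambda>b. b) (\<lambda>b. b) (\<lambda>c. c \<one>)"
proof (intro tate_hom.intro tate_hom_axioms.intro tate_ind_tate tate_K; unfold ind_tate_simps)
  show "gmodule_hom G K (Ind G H (A_sub P)) (A_sub P) (\<lambda>c. c \<one>)" by (rule IA'.eval_hom)
  show "gmodule_hom G K (Ind G H (A_mid P)) (A_mid P) (\<lambda>c. c \<one>)" by (rule IA.eval_hom)
  show "gmodule_hom G K (Ind G H (A_quot P)) (A_quot P) (\<lambda>c. c \<one>)" by (rule IA''.eval_hom)
  show "gmodule_hom G K (Ind G H (C_mod P)) (C_mod P) (\<lambda>c. c \<one>)" by (rule IC.eval_hom)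
  show "gmodule_hom G K (B_sub P) (B_sub P) (\<lambda>b. b)"
    by (rule restriction_hom) (rule B.sub.discrete_gmodule_axioms)
  show "gmodule_hom G K (B_mid P) (B_mid P) (\<lambda>b. b)"
    by (rule restriction_hom) (rule B.mid.discrete_gmodule_axioms)
  show "gmodule_hom G K (B_quot P) (B_quot P) (\<lambda>b. b)"
    by (rule restriction_hom) (rule B.quot.discrete_gmodule_axioms)
qed (simp_all add: ind_map_def ind_pair_def)

lemma trace_tate_hom:
  "tate_hom G G (ind_tate G H P) P (ind_trace G H (A_sub P)) (ind_trace G H (A_mid P)) (ind_trace G H (A_quot P))
    (\<lambda>b. b) (\<lambda>b. b) (\<lambda>b. b) (ind_trace G H (C_mod P))"
proof (intro tate_hom.intro tate_hom_axioms.intro tate_ind_tate tate_axioms; unfold ind_tate_simps)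
  show "gmodule_hom G G (Ind G H (A_sub P)) (A_sub P) (ind_trace G H (A_sub P))" by (rule IA'.ind_trace_hom)
  show "gmodule_hom G G (Ind G H (A_mid P)) (A_mid P) (ind_trace G H (A_mid P))" by (rule IA.ind_trace_hom)
  show "gmodule_hom G G (Ind G H (A_quot P)) (A_quot P) (ind_trace G H (A_quot P))" by (rule IA''.ind_trace_hom)
  show "gmodule_hom G G (Ind G H (C_mod P)) (C_mod P) (ind_trace G H (C_mod P))" by (rule IC.ind_trace_hom)
  show "gmodule_hom G G (B_sub P) (B_sub P) (\<lambda>b. b)"
    by (rule identity_hom) (rule B.sub.discrete_gmodule_axioms)
  show "gmodule_hom G G (B_mid P) (B_mid P) (\<lambda>b. b)"
    by (rule identity_hom) (rule B.mid.discrete_gmodule_axioms)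
  show "gmodule_hom G G (B_quot P) (B_quot P) (\<lambda>b. b)"
    by (rule identity_hom) (rule B.quot.discrete_gmodule_axioms)
  show "A_inj P (ind_trace G H (A_sub P) c) = ind_trace G H (A_mid P) (ind_map G (A_inj P) c)"
    if "c \<in> carrier (Ind G H (A_sub P))" for c
    by (rule ind_trace_natural[OF A.i.gmodule_hom_axioms that])
  show "A_proj P (ind_trace G H (A_mid P) c) = ind_trace G H (A_quot P) (ind_map G (A_proj P) c)"
    if "c \<in> carrier (Ind G H (A_mid P))" for c
    by (rule ind_trace_natural[OF A.j.gmodule_hom_axioms that])
  show "ind_trace G H (C_mod P) (ind_pair G (B_mid P) (sub_mid P) c b) = sub_mid P (ind_trace G H (A_sub P) c) b"
    if "c \<in> carrier (Ind G H (A_sub P))" "b \<in> carrier (B_mid P)" for c b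
    by (rule ind_trace_projection[OF p.gmodule_pairing_axioms that])
  show "ind_trace G H (C_mod P) (ind_pair G (B_sub P) (mid_sub P) c b) = mid_sub P (ind_trace G H (A_mid P) c) b"
    if "c \<in> carrier (Ind G H (A_mid P))" "b \<in> carrier (B_sub P)" for c b
    by (rule ind_trace_projection[OF q.gmodule_pairing_axioms that])
qed simp_all

lemma cor_aug_cup_res:
  assumes \<alpha>: "\<alpha> \<in> carrier (cohomology K (A_quot P) r)" and \<beta>: "\<beta> \<in> carrier (cohomology G (B_quot P) s)"
  shows "cor G H (C_mod P) (Suc (r + s)) (aug_cup K P r s \<alpha> (res G H (B_quot P) s \<beta>))
    = aug_cup G P r s (cor G H (A_quot P) r \<alpha>) \<beta>"
proof -
  interpret ev: tate_hom G K "ind_tate G H P" P "\<lambda>c. c \<one>" "\<lambda>c. c \<one>" "\<lambda>c. c \<one>" "\<lambda>b. b" "\<lambda>b. b" "\<lambda>b. b" "\<lambda>c. c \<one>"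
    by (rule eval_tate_hom)
  interpret tr: tate_hom G G "ind_tate G H P" P "ind_trace G H (A_sub P)" "ind_trace G H (A_mid P)"
    "ind_trace G H (A_quot P)" "\<lambda>b. b" "\<lambda>b. b" "\<lambda>b. b" "ind_trace G H (C_mod P)"
    by (rule trace_tate_hom)
  obtain u where u: "u \<in> cocycles K (A_quot P) r" "\<alpha> = coh_class K (A_quot P) r u"
    using \<alpha> by (auto simp: IA''.KM.carrier_cohomology)
  obtain v where v: "v \<in> cocycles G (B_quot P) s" "\<beta> = coh_class G (B_quot P) s v"
    using \<beta> by (auto simp: B.quot.carrier_cohomology)
  \<comment> \<open>The evaluation is exactly \<open>u\<close>, so no correcting coboundary has to
    be carried along.\<close>
  obtain F'' where F'': "F'' \<in> cocycles G (Ind G H (A_quot P)) r" "push K r (\<lambda>c. c \<one>) F'' = u"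
    using IA''.shapiro_surj[OF u(1)] by blast
  obtain F where F: "F \<in> carrier (cochains G (Ind G H (A_mid P)) r)" "push G r (ind_map G (A_proj P)) F = F''"
    using IT.A.lift_cochain[of F'' r] F''(1) by (auto simp: cocycles_iff)
  obtain g where g: "g \<in> carrier (cochains G (B_mid P) s)" "push G s (B_proj P) g = v"
    using B.lift_cochain[of v s] v(1) by (auto simp: cocycles_iff)
  have Fl: "F \<in> IT.A.liftable r"
    unfolding IT.A.liftable_def using F F'' by simp
  have gl: "g \<in> B.liftable s" "g \<in> IT.B.liftable s"
    unfolding B.liftable_def IT.B.liftable_def using g v by simp_all
  \<comment> \<open>\<open>push\<close> along the identity still restricts to tuples; it returns
    \<open>g\<close> because cochains are extensional.\<close>
  have pg: "push G s (\<lambda>b. b) g = g"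
    using B.mid.cochain_extensional[OF g(1)] by (simp add: push_def extensional_restrict)
  let ?W = "IT.aug r s F g"
  have W: "?W \<in> cocycles G (Ind G H (C_mod P)) (Suc (r + s))"
    using IT.aug_cocycle[OF Fl gl(2)] by simp
  have \<alpha>_eq: "\<alpha> = coh_class K (A_quot P) r (push K r (A_proj P) (push K r (\<lambda>c. c \<one>) F))"
    using ev.push_A_proj[OF Fl] u(2) F'' F by simp
  have res_eq: "res G H (B_quot P) s \<beta> = coh_class K (B_quot P) s (push K s (B_proj P) (push K s (\<lambda>b. b) g))"
    using ev.push_B_proj[OF gl(2)] v IB''.res_coh_class[of v s] g by (simp add: cocycles_iff)
  have cor_eq: "cor G H (A_quot P) r \<alpha>
      = coh_class G (A_quot P) r (push G r (A_proj P) (push G r (ind_trace G H (A_mid P)) F))"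
    using tr.push_A_proj[OF Fl] IA''.cor_coh_class[OF F''(1)] u(2) F'' F by simp
  have \<beta>_eq: "\<beta> = coh_class G (B_quot P) s (push G s (B_proj P) g)"
    using v g by simp
  have "aug_cup K P r s \<alpha> (res G H (B_quot P) s \<beta>)
      = coh_class K (C_mod P) (Suc (r + s)) (TK.aug r s (push K r (\<lambda>c. c \<one>) F) (push K s (\<lambda>b. b) g))"
    unfolding \<alpha>_eq res_eq
    by (rule TK.aug_cup_coh_class[OF ev.push_liftable_A[OF Fl] ev.push_liftable_B[OF gl(2)]])
  \<comment> \<open>The cocycle over H is now the evaluation of \<open>?W\<close>, the form in which
    \<open>cor\<close> can be computed.\<close>
  also have "\<dots> = coh_class K (C_mod P) (Suc (r + s)) (push K (Suc (r + s)) (\<lambda>c. c \<one>) ?W)"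
    by (simp only: ev.push_aug[OF Fl gl(2)])
  finally have "cor G H (C_mod P) (Suc (r + s)) (aug_cup K P r s \<alpha> (res G H (B_quot P) s \<beta>))
      = coh_class G (C_mod P) (Suc (r + s)) (push G (Suc (r + s)) (ind_trace G H (C_mod P)) ?W)"
    by (simp only: IC.cor_coh_class[OF W])
  also have "\<dots> = coh_class G (C_mod P) (Suc (r + s)) (aug r s (push G r (ind_trace G H (A_mid P)) F) g)"
    using tr.push_aug[OF Fl gl(2)] by (simp add: pg)
  also have "\<dots> = aug_cup G P r s (cor G H (A_quot P) r \<alpha>) \<beta>"
    unfolding cor_eq \<beta>_eq
    by (rule aug_cup_coh_class[symmetric, OF tr.push_liftable_A[OF Fl] gl(1)])
  finally show ?thesis .
qed

end

theorem theorem4p10: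
  fixes G :: "'g topgroup" and H :: "'g set"
    and P :: "('g, 'a1, 'a, 'a2, 'b1, 'b, 'b2, 'c) tate"
    and r s :: nat
    and \<alpha> :: "((nat \<Rightarrow> 'g) \<Rightarrow> 'a2) set"
    and \<beta> :: "((nat \<Rightarrow> 'g) \<Rightarrow> 'b2) set"
  assumes "profinite_group G"
    and "subgroup H G" and "openin (gtop G) H"
    and "tate_product G P"
    and "\<alpha> \<in> carrier (cohomology (subtopgroup G H) (A_quot P) r)"
    and "\<beta> \<in> carrier (cohomology G (B_quot P) s)"
  shows "cor G H (C_mod P) (r + s + 1)
           (aug_cup (subtopgroup G H) P r s \<alpha> (res G H (B_quot P) s \<beta>))
         = aug_cup G P r s (cor G H (A_quot P) r \<alpha>) \<beta>"
proof -
  interpret induced_tate G H P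
    using assms(1-4)
    by (intro induced_tate.intro open_subgroup.intro open_subgroup_axioms.intro tate.intro
        tate_axioms.intro topgrp.intro) (auto simp: profinite_group_def)
  show ?thesis
    using cor_aug_cup_res[OF assms(5,6)] by simp
qed

end
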